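(* Let $G=(V,E,c,[\lambda_{\min},\lambda_{\max}],s,t)$ be a source-sink-monotone parametric flow network. Then the algorithm PBFS described below, run on $G$, terminates and returns a breakpoint function for $G$.
   Context: Flow networks, flows, cuts: a flow network $(V,E,c,s,t)$ has finite $V$, $E\subseteq V\times V$ with all reverse edges present (possibly capacity $0$), capacities $c\ge 0$. A flow $f$ satisfies $f(e)\le c(e)$, $f(u,v)=-f(v,u)$, and conservation at vertices other than $s,t$; residual capacity is $c(e)-f(e)$, an edge is residual if it is positive and saturated if it is $0$. A cut $(V_s,V_t)$ partitions $V$ with $s\in V_s,t\in V_t$; the sink-minimal minimum cut is the (unique) minimum-capacity cut minimizing $|V_t|$. A parametric flow network $G=(V,E,c,[\lambda_{\min},\lambda_{\max}],s,t)$ assigns each edge a capacity function $c(e)\colon[\lambda_{\min},\lambda_{\max}]\to\mathbb{R}_{\ge0}$ (assumed to be functions whose roots can be computed); $G[\lambda]$ is the flow network with capacities $c(e)(\lambda)$. It is source-sink-monotone if $c(s,v)$ is non-decreasing for $v\ne t$, $c(v,t)$ is non-increasing for $v\ne s$, and all other capacities are constant. A breakpoint function is $\beta\colon V\to\mathbb{R}_{\ge0}\cup\{\infty\}$ such that for every $\lambda\in[\lambda_{\min},\lambda_{\max}]$ the sink-minimal minimum cut of $G[\lambda]$ is $(\{v:\beta(v)\le\lambda\},\{v:\beta(v)>\lambda\})$. Contracting a vertex set $V'\subseteq V\setminus\{t\}$ into $s$ means removing $V'$, redirecting incident edges to/from $s$ and merging parallel edges with summed capacities (and summed flows). Algorithm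 PBFS. (1) Initialization: compute a maximum flow $f_{\rm init}$ in $G[\lambda_{\min}]$. By a reverse BFS from $t$ in its residual graph compute the set $V_t$ of vertices from which $t$ is reachable, a shortest-path in-tree $T$ rooted at $t$ consisting of residual edges, and distance labels $d(v)$ (BFS distance to $t$; $d=\infty$ outside $V_t$). Set $\beta(v)=\lambda_{\min}$ for $v\notin V_t$, $\beta(v)=\infty$ for $v\in V_t$, and contract $V\setminus V_t$ into $s$. For each vertex $u$ keep a pointer ("current edge") into its list of outgoing edges, initially at the first edge. (2) Flow functions: each edge carries a flow function $f(e)$ of $\lambda$ (with $f(v,u)=-f(u,v)$) and each vertex an excess function; initially $f=f_{\rm init}$ (constant) and all excesses $0$. For every edge $e=(s,v)$ or $e=(v,t)$ saturated by $f_{\rm init}$ at $\lambda_{\min}$, set $f(e):=c(e)$ as a function and add the change in flow to the excess function of $v$ (inflow change for $(s,v)$, negative outflow change for $(v,t)$). Then drain at $\lambda_{\min}$. "Draining at $\lambda$" means: for the vertices $u\ne t$ with modified excess, processed in decreasing order of $d(u)$, add the excess function of $u$ to the flow function of $u$'s tree edge $e=(u,v)$, add it to the excess of $v$, set the excess of $u$ to $0$, and set the flow limit $\lambda_{\rm root}(e)$ to the smallest root of $c(e)-f(e)$ in $[\lambda,\infty)$ ($\infty$ if none). Non-tree edges have flow limit $\infty$. (3) Main loop, with $\lambda_0=\lambda_{\min}$ and $i=0$, while $\lambda_i<\lambda_{\max}$: let $\lambda_{i+1}$ be the minimum flow limit over tree edges; if $\lambda_{i+1}>\lambda_{\max}$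 return $\beta$. Residuality is now evaluated at $\lambda_{i+1}$ (edge $e$ residual iff $c(e)(\lambda_{i+1})-f(e)(\lambda_{i+1})>0$; edges into contracted vertices are ignored). Remove every tree edge $e=(u,v)$ with $\lambda_{\rm root}(e)=\lambda_{i+1}$ ("tree-edge removal": replace $f(e)$ by the function $c(e)+f(e)(\lambda_{i+1})-c(e)(\lambda_{i+1})$, add the difference old minus new flow to the excess of $u$ and subtract it from the excess of $v$, set $\lambda_{\rm root}(e)=\infty$, delete $e$ from $T$, and make $u$ an orphan). Then, while orphans remain, take an orphan $u$: (a) advance $u$'s current-edge pointer over its outgoing edges looking for a residual edge $(u,v)$ with $d(u)=d(v)+1$; if found, add it to $T$ and continue. (b) Otherwise perform tree-edge removal on every tree edge $(w,u)$ into $u$ (making each such $w$ an orphan); then, if $u$ has a residual outgoing edge, choose one $(u,w)$ minimizing $d(w)$; if $d(w)<|V_t|-1$, set $d(u)=d(w)+1$, add $(u,w)$ to $T$ and reset $u$'s current-edge pointer to its first edge. (c) Otherwise set $\beta(u)=\lambda_{i+1}$, remove $u$ from $V_t$ and contract $u$ into $s$. When no orphans remain, drain at $\lambda_{i+1}$ (over all vertices whose excess was modified in this iteration), set $i:=i+1$, and repeat. When the loop ends, return $\beta$.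
   Formalization: Capacity functions are assumed continuous on [λmin,λmax], with 0≤λmin; initially every tree edge (not only drained ones) gets as flow limit the smallest root of c(e)−f(e) from λmin on; self-loops are ignored when looking for residual edges. *)

theory Defs
  imports Complex_Main "HOL-Library.Extended_Nat" "HOL-Library.Extended_Real"
begin

section \<open>Flow networks\<close>

record ('v, 'c) network =
  verts :: "'v set"
  edges :: "('v \<times> 'v) set"
  cap :: "'v \<times> 'v \<Rightarrow> 'c"
  source :: 'v
  sink :: 'v

definition flow_network :: "('v, real) network \<Rightarrow> bool" where
  "flow_network N \<longleftrightarrow>
     finite (verts N) \<and> edges N \<subseteq> verts N \<times> verts N \<and> sym (edges N) \<and>
     source N \<in> verts N \<and> sink N \<in> verts N \<and> source N \<noteq> sink N \<and>
     (\<forall>e\<in>edges N. 0 \<le> cap N e)"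

text \<open>Only the values of a flow on the edges of the network are meaningful.\<close>

definition is_flow :: "('v, real) network \<Rightarrow> ('v \<times> 'v \<Rightarrow> real) \<Rightarrow> bool" where
  "is_flow N f \<longleftrightarrow>
     (\<forall>e\<in>edges N. f e \<le> cap N e) \<and>
     (\<forall>(u, v)\<in>edges N. f (v, u) = - f (u, v)) \<and>
     (\<forall>v\<in>verts N - {source N, sink N}. (\<Sum>u | (u, v) \<in> edges N. f (u, v)) = 0)"

definition flow_value :: "('v, real) network \<Rightarrow> ('v \<times> 'v \<Rightarrow> real) \<Rightarrow> real" where
  "flow_value N f = (\<Sum>u | (u, sink N) \<in> edges N. f (u, sink N))"

definition is_max_flow :: "('v, real) network \<Rightarrow> ('v \<times> 'v \<Rightarrow> real) \<Rightarrow> bool" where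
  "is_max_flow N f \<longleftrightarrow> is_flow N f \<and> (\<forall>g. is_flow N g \<longrightarrow> flow_value N g \<le> flow_value N f)"

definition residual_edges :: "('v, real) network \<Rightarrow> ('v \<times> 'v \<Rightarrow> real) \<Rightarrow> ('v \<times> 'v) set" where
  "residual_edges N f = {e \<in> edges N. 0 < cap N e - f e}"

definition is_cut :: "('v, real) network \<Rightarrow> 'v set \<Rightarrow> 'v set \<Rightarrow> bool" where
  "is_cut N A B \<longleftrightarrow> A \<union> B = verts N \<and> A \<inter> B = {} \<and> source N \<in> A \<and> sink N \<in> B"

definition cut_cap :: "('v, real) network \<Rightarrow> 'v set \<Rightarrow> 'v set \<Rightarrow> real" where
  "cut_cap N A B = (\<Sum>e \<in> edges N \<inter> A \<times> B. cap N e)"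

definition is_min_cut :: "('v, real) network \<Rightarrow> 'v set \<Rightarrow> 'v set \<Rightarrow> bool" where
  "is_min_cut N A B \<longleftrightarrow>
     is_cut N A B \<and> (\<forall>A' B'. is_cut N A' B' \<longrightarrow> cut_cap N A B \<le> cut_cap N A' B')"

definition is_sink_minimal_min_cut :: "('v, real) network \<Rightarrow> 'v set \<Rightarrow> 'v set \<Rightarrow> bool" where
  "is_sink_minimal_min_cut N A B \<longleftrightarrow>
     is_min_cut N A B \<and> (\<forall>A' B'. is_min_cut N A' B' \<longrightarrow> card B \<le> card B')"


section \<open>Parametric flow networks\<close>

record 'v pnetwork = "('v, real \<Rightarrow> real) network" +
  lmin :: real
  lmax :: real

definition at_param :: "'v pnetwork \<Rightarrow> real \<Rightarrow> ('v, real) network" where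
  "at_param G l = \<lparr>verts = verts G, edges = edges G, cap = (\<lambda>e. cap G e l),
                   source = source G, sink = sink G\<rparr>"

text \<open>
  Capacity functions are total in HOL; only their values on \<open>{lmin G..lmax G}\<close> matter.
  Nonnegativity of \<open>lmin G\<close> is forced by breakpoints being nonnegative (the source has
  breakpoint at most \<open>lmin G\<close>).  Continuity makes precise that capacity functions are functions
  whose (smallest) roots can be computed: it guarantees that \<open>c(e) - f(e)\<close> changes sign only at
  roots and that smallest roots exist.
\<close>

definition parametric_flow_network :: "'v pnetwork \<Rightarrow> bool" where
  "parametric_flow_network G \<longleftrightarrow>
     0 \<le> lmin G \<and> lmin G \<le> lmax G \<and>
     (\<forall>l\<in>{lmin G..lmax G}. flow_network (at_param G l)) \<and>
     (\<forall>e\<in>edges G. continuous_on {lmin G..lmax G} (cap G e))"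

definition source_sink_monotone :: "'v pnetwork \<Rightarrow> bool" where
  "source_sink_monotone G \<longleftrightarrow>
     (\<forall>v. (source G, v) \<in> edges G \<and> v \<noteq> sink G \<longrightarrow>
        mono_on {lmin G..lmax G} (cap G (source G, v))) \<and>
     (\<forall>v. (v, sink G) \<in> edges G \<and> v \<noteq> source G \<longrightarrow>
        antimono_on {lmin G..lmax G} (cap G (v, sink G))) \<and>
     (\<forall>(u, v)\<in>edges G.
        \<not> (u = source G \<and> v \<noteq> sink G) \<and> \<not> (v = sink G \<and> u \<noteq> source G) \<longrightarrow>
        (\<exists>k. \<forall>l\<in>{lmin G..lmax G}. cap G (u, v) l = k))"

definition breakpoint_function :: "'v pnetwork \<Rightarrow> ('v \<Rightarrow> ereal) \<Rightarrow> bool" where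
  "breakpoint_function G \<beta> \<longleftrightarrow>
     (\<forall>v\<in>verts G. 0 \<le> \<beta> v) \<and>
     (\<forall>l\<in>{lmin G..lmax G}.
        is_sink_minimal_min_cut (at_param G l)
          {v \<in> verts G. \<beta> v \<le> ereal l} {v \<in> verts G. \<beta> v > ereal l})"

text \<open>
  Contraction of a vertex set \<open>U\<close> into the source.  Functions on edges (capacities as well as
  flows) are summed over the edges that are merged; edges that would become loops at the source
  are dropped.
\<close>

definition redirect :: "'v pnetwork \<Rightarrow> 'v set \<Rightarrow> 'v \<times> 'v \<Rightarrow> 'v \<times> 'v" where
  "redirect G U = (let h = (\<lambda>v. if v \<in> U then source G else v) in map_prod h h)"

definition merge :: "'v pnetwork \<Rightarrow> 'v set \<Rightarrow> ('v \<times> 'v \<Rightarrow> real \<Rightarrow> real) \<Rightarrow> 'v \<times> 'v \<Rightarrow> real \<Rightarrow> real" where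
  "merge G U g e x = (\<Sum>e' | e' \<in> edges G \<and> redirect G U e' = e. g e' x)"

definition contract :: "'v pnetwork \<Rightarrow> 'v set \<Rightarrow> 'v pnetwork" where
  "contract G U = G\<lparr>verts := insert (source G) (verts G - U),
                    edges := redirect G U ` edges G - {(source G, source G)},
                    cap := merge G U (cap G)\<rparr>"


section \<open>Algorithm PBFS\<close>

text \<open>The edge relation \<open>R\<close> below is the one of a residual graph.\<close>

definition bfs_dist :: "('v \<times> 'v) set \<Rightarrow> 'v \<Rightarrow> 'v \<Rightarrow> enat" where
  "bfs_dist R t v = (INF n \<in> {n. (v, t) \<in> R ^^ n}. enat n)"

definition shortest_path_in_tree :: "('v \<times> 'v) set \<Rightarrow> 'v \<Rightarrow> ('v \<times> 'v) set \<Rightarrow> bool" where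
  "shortest_path_in_tree R t T \<longleftrightarrow>
     T \<subseteq> R \<and> single_valued T \<and> Domain T = {v. (v, t) \<in> R\<^sup>*} - {t} \<and>
     (\<forall>v n. bfs_dist R t v = enat n \<longrightarrow> (v, t) \<in> T ^^ n)"

text \<open>
  The network component of a state is the current contracted network, so that its vertices are
  those of \<open>V\<^sub>t\<close> together with the source.  The set \<open>modified\<close> contains the vertices of \<open>V\<^sub>t\<close>
  whose excess was modified and not drained yet.
\<close>

record 'v pbfs_state =
  net :: "'v pnetwork"
  flow :: "'v \<times> 'v \<Rightarrow> real \<Rightarrow> real"
  excess :: "'v \<Rightarrow> real \<Rightarrow> real"
  modified :: "'v set"
  tree :: "('v \<times> 'v) set"
  label :: "'v \<Rightarrow> enat"
  current :: "'v \<Rightarrow> nat"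
  limit :: "'v \<times> 'v \<Rightarrow> ereal"
  bp :: "'v \<Rightarrow> ereal"
  orphans :: "'v set"
  lam :: real

definition sink_side :: "'v pbfs_state \<Rightarrow> 'v set" where
  "sink_side \<sigma> = verts (net \<sigma>) - {source (net \<sigma>)}"

text \<open>
  Smallest root in \<open>[l, \<infinity>)\<close> of a function that is defined up to \<open>lmax G\<close>; it is \<open>\<infinity>\<close> if there
  is no root, since the infimum of the empty set is the top element.
\<close>

definition smallest_root :: "'v pnetwork \<Rightarrow> real \<Rightarrow> (real \<Rightarrow> real) \<Rightarrow> ereal" where
  "smallest_root G l g = (INF x \<in> {x. l \<le> x \<and> x \<le> lmax G \<and> g x = 0}. ereal x)"

definition set_flow ::
  "('v \<times> 'v \<Rightarrow> real \<Rightarrow> real) \<Rightarrow> 'v \<times> 'v \<Rightarrow> (real \<Rightarrow> real) \<Rightarrow> ('v \<times> 'v \<Rightarrow> real \<Rightarrow> real)" where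
  "set_flow f e g = f(prod.swap e := (\<lambda>x. - g x), e := g)"

text \<open>
  Initial state before the first draining, for a given maximum flow \<open>f0\<close> at \<open>lmin G\<close>
  and a given in-tree \<open>T\<close>.  \<open>S\<close> is the set of saturated edges of the contracted network that
  leave the source or enter the sink.  Every tree edge gets its flow limit here; draining
  then updates the limits of those tree edges whose flow it changes.  (A tree edge into the sink
  may have a decreasing capacity although no excess ever arrives at its tail.)
\<close>

definition init_state :: "'v pnetwork \<Rightarrow> ('v \<times> 'v \<Rightarrow> real) \<Rightarrow> ('v \<times> 'v) set \<Rightarrow> 'v pbfs_state" where
  "init_state G f0 T =
    (let s = source G; t = sink G;
         R = residual_edges (at_param G (lmin G)) f0;
         Vt = {v. (v, t) \<in> R\<^sup>*};
         N = contract G (verts G - Vt);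
         f1 = merge G (verts G - Vt) (\<lambda>e x. f0 e);
         S = {e \<in> edges N. (fst e = s \<or> snd e = t) \<and> f1 e (lmin G) = cap N e (lmin G)};
         f2 = (\<lambda>e. if e \<in> S then cap N e
                   else if prod.swap e \<in> S then (\<lambda>x. - cap N (prod.swap e) x)
                   else f1 e)
     in \<lparr>net = N,
         flow = f2,
         excess = (\<lambda>v x. (if (s, v) \<in> S then cap N (s, v) x - f1 (s, v) x else 0)
                       - (if (v, t) \<in> S then cap N (v, t) x - f1 (v, t) x else 0)),
         modified = {v \<in> Vt. (s, v) \<in> S \<or> (v, t) \<in> S},
         tree = T,
         label = bfs_dist R t,
         current = (\<lambda>u. 0),
         limit = (\<lambda>e. if e \<in> T then smallest_root G (lmin G) (\<lambda>x. cap N e x - f2 e x) else \<infinity>),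
         bp = (\<lambda>v. if v \<in> Vt then \<infinity> else ereal (lmin G)),
         orphans = {},
         lam = lmin G\<rparr>)"

definition drain_edge :: "'v \<Rightarrow> 'v \<Rightarrow> 'v pbfs_state \<Rightarrow> 'v pbfs_state" where
  "drain_edge u v \<sigma> =
    (let g = (\<lambda>x. flow \<sigma> (u, v) x + excess \<sigma> u x)
     in \<sigma>\<lparr>flow := set_flow (flow \<sigma>) (u, v) g,
          excess := (excess \<sigma>)(v := (\<lambda>x. excess \<sigma> v x + excess \<sigma> u x), u := (\<lambda>x. 0)),
          modified := insert v (modified \<sigma> - {u}),
          limit := (limit \<sigma>)((u, v) :=
            smallest_root (net \<sigma>) (lam \<sigma>) (\<lambda>x. cap (net \<sigma>) (u, v) x - g x))\<rparr>)"

definition remove_tree_edge :: "'v \<times> 'v \<Rightarrow> 'v pbfs_state \<Rightarrow> 'v pbfs_state" where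
  "remove_tree_edge e \<sigma> =
    (let u = fst e; v = snd e; l = lam \<sigma>; c = cap (net \<sigma>) e; old = flow \<sigma> e;
         new = (\<lambda>x. c x + old l - c l)
     in \<sigma>\<lparr>flow := set_flow (flow \<sigma>) e new,
          excess := (excess \<sigma>)(u := (\<lambda>x. excess \<sigma> u x + (old x - new x)),
                               v := (\<lambda>x. excess \<sigma> v x - (old x - new x))),
          modified := modified \<sigma> \<union> {u, v},
          tree := tree \<sigma> - {e},
          limit := (limit \<sigma>)(e := \<infinity>),
          orphans := insert u (orphans \<sigma>)\<rparr>)"

text \<open>Removal of a finite set of tree edges, one after the other in any order.\<close>

definition remove_tree_edges :: "('v \<times> 'v) set \<Rightarrow> 'v pbfs_state \<Rightarrow> 'v pbfs_state \<Rightarrow> bool" where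
  "remove_tree_edges F \<sigma> \<sigma>' \<longleftrightarrow>
     (\<exists>es. distinct es \<and> set es = F \<and> \<sigma>' = fold remove_tree_edge es \<sigma>)"

text \<open>
  Edges into contracted vertices are ignored.  So are loops, which are residual whenever they
  have positive capacity but cannot be edges of a tree.
\<close>

definition residual :: "'v pbfs_state \<Rightarrow> 'v \<Rightarrow> 'v \<Rightarrow> bool" where
  "residual \<sigma> u v \<longleftrightarrow> v \<in> sink_side \<sigma> \<and> v \<noteq> u \<and> (u, v) \<in> edges (net \<sigma>) \<and>
     0 < cap (net \<sigma>) (u, v) (lam \<sigma>) - flow \<sigma> (u, v) (lam \<sigma>)"

definition admissible :: "'v pbfs_state \<Rightarrow> 'v \<Rightarrow> 'v \<Rightarrow> bool" where
  "admissible \<sigma> u v \<longleftrightarrow> residual \<sigma> u v \<and> label \<sigma> u = label \<sigma> v + 1"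

definition relabel_target :: "'v pbfs_state \<Rightarrow> 'v \<Rightarrow> 'v \<Rightarrow> bool" where
  "relabel_target \<sigma> u w \<longleftrightarrow> residual \<sigma> u w \<and> (\<forall>w'. residual \<sigma> u w' \<longrightarrow> label \<sigma> w \<le> label \<sigma> w') \<and>
     label \<sigma> w < enat (card (sink_side \<sigma>) - 1)"

definition contract_vertex :: "'v \<Rightarrow> 'v pbfs_state \<Rightarrow> 'v pbfs_state" where
  "contract_vertex u \<sigma> =
     \<sigma>\<lparr>net := contract (net \<sigma>) {u},
       flow := merge (net \<sigma>) {u} (flow \<sigma>),
       modified := modified \<sigma> - {u},
       bp := (bp \<sigma>)(u := ereal (lam \<sigma>)),
       orphans := orphans \<sigma> - {u}\<rparr>"

text \<open>The order of the adjacency lists is arbitrary.  The lists refer to the original network.\<close>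

definition adjacency_lists :: "'v pnetwork \<Rightarrow> ('v \<Rightarrow> 'v list) \<Rightarrow> bool" where
  "adjacency_lists G adj \<longleftrightarrow>
     (\<forall>u\<in>verts G. distinct (adj u) \<and> set (adj u) = {v. (u, v) \<in> edges G})"

datatype 'v config =
    Start
  | Drain "'v pbfs_state"
  | Loop "'v pbfs_state"
  | Adopt "'v pbfs_state"
  | Return "'v \<Rightarrow> ereal"

text \<open>
  The algorithm as a nondeterministic transition system: all choices that it leaves open (maximum
  flow, search tree, order of draining among equal labels, choice of orphans and of edges)
  are arbitrary.
\<close>

inductive pbfs_step :: "'v pnetwork \<Rightarrow> ('v \<Rightarrow> 'v list) \<Rightarrow> 'v config \<Rightarrow> 'v config \<Rightarrow> bool"
  for G :: "'v pnetwork" and adj :: "'v \<Rightarrow> 'v list" where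
  init:
    "is_max_flow (at_param G (lmin G)) f0 \<Longrightarrow>
     shortest_path_in_tree (residual_edges (at_param G (lmin G)) f0) (sink G) T \<Longrightarrow>
     pbfs_step G adj Start (Drain (init_state G f0 T))"
| drain:
    "u \<in> modified \<sigma> - {sink G} \<Longrightarrow>
     \<forall>w \<in> modified \<sigma> - {sink G}. label \<sigma> w \<le> label \<sigma> u \<Longrightarrow>
     (u, v) \<in> tree \<sigma> \<Longrightarrow>
     pbfs_step G adj (Drain \<sigma>) (Drain (drain_edge u v \<sigma>))"
| drained:
    "modified \<sigma> \<subseteq> {sink G} \<Longrightarrow>
     pbfs_step G adj (Drain \<sigma>) (Loop \<sigma>)"
| loop_end:
    "\<not> lam \<sigma> < lmax G \<Longrightarrow>
     pbfs_step G adj (Loop \<sigma>) (Return (bp \<sigma>))"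
| no_breakpoint:
    "lam \<sigma> < lmax G \<Longrightarrow>
     (INF e \<in> tree \<sigma>. limit \<sigma> e) > ereal (lmax G) \<Longrightarrow>
     pbfs_step G adj (Loop \<sigma>) (Return (bp \<sigma>))"
| next_breakpoint:
    "lam \<sigma> < lmax G \<Longrightarrow>
     (INF e \<in> tree \<sigma>. limit \<sigma> e) = ereal l \<Longrightarrow>
     l \<le> lmax G \<Longrightarrow>
     remove_tree_edges {e \<in> tree \<sigma>. limit \<sigma> e = ereal l} (\<sigma>\<lparr>lam := l, modified := {}\<rparr>) \<sigma>' \<Longrightarrow>
     pbfs_step G adj (Loop \<sigma>) (Adopt \<sigma>')"
| adopted:
    "orphans \<sigma> = {} \<Longrightarrow>
     pbfs_step G adj (Adopt \<sigma>) (Drain \<sigma>)"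
| adopt:
    "u \<in> orphans \<sigma> \<Longrightarrow>
     current \<sigma> u \<le> j \<Longrightarrow> j < length (adj u) \<Longrightarrow>
     admissible \<sigma> u (adj u ! j) \<Longrightarrow>
     \<forall>k. current \<sigma> u \<le> k \<and> k < j \<longrightarrow> \<not> admissible \<sigma> u (adj u ! k) \<Longrightarrow>
     pbfs_step G adj (Adopt \<sigma>)
       (Adopt (\<sigma>\<lparr>current := (current \<sigma>)(u := j),
                 tree := insert (u, adj u ! j) (tree \<sigma>),
                 orphans := orphans \<sigma> - {u}\<rparr>))"
| relabel:
    "u \<in> orphans \<sigma> \<Longrightarrow>
     \<forall>k. current \<sigma> u \<le> k \<and> k < length (adj u) \<longrightarrow> \<not> admissible \<sigma> u (adj u ! k) \<Longrightarrow>
     remove_tree_edges {e \<in> tree \<sigma>. snd e = u} \<sigma> \<sigma>' \<Longrightarrow>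
     relabel_target \<sigma>' u w \<Longrightarrow>
     pbfs_step G adj (Adopt \<sigma>)
       (Adopt (\<sigma>'\<lparr>label := (label \<sigma>')(u := label \<sigma>' w + 1),
                  tree := insert (u, w) (tree \<sigma>'),
                  current := (current \<sigma>')(u := 0),
                  orphans := orphans \<sigma>' - {u}\<rparr>))"
| contract:
    "u \<in> orphans \<sigma> \<Longrightarrow>
     \<forall>k. current \<sigma> u \<le> k \<and> k < length (adj u) \<longrightarrow> \<not> admissible \<sigma> u (adj u ! k) \<Longrightarrow>
     remove_tree_edges {e \<in> tree \<sigma>. snd e = u} \<sigma> \<sigma>' \<Longrightarrow>
     \<nexists>w. relabel_target \<sigma>' u w \<Longrightarrow>
     pbfs_step G adj (Adopt \<sigma>) (Adopt (contract_vertex u \<sigma>'))"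

definition terminates_from :: "('a \<Rightarrow> 'a \<Rightarrow> bool) \<Rightarrow> 'a \<Rightarrow> bool" where
  "terminates_from step a \<longleftrightarrow> \<not> (\<exists>run. run 0 = a \<and> (\<forall>i :: nat. step (run i) (run (Suc i))))"

definition halts_in :: "('a \<Rightarrow> 'a \<Rightarrow> bool) \<Rightarrow> 'a \<Rightarrow> 'a \<Rightarrow> bool" where
  "halts_in step a b \<longleftrightarrow> step\<^sup>*\<^sup>* a b \<and> \<not> (\<exists>c. step b c)"

end

(*
  Let A be the set of contracted vertices, including the source, and B the rest.  Between two
  breakpoints the flow functions restricted to B form a flow of the contracted network that
  saturates all edges from A to B: by conservation, and by induction from the leaves to the
  root, the flow on every tree edge is nondecreasing in the parameter, so no residual capacity
  becomes negative before a tree edge reaches its flow limit.  As every vertex of B reaches the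
  sink along residual tree edges, a source side that properly contains A has a larger capacity.
  Other source sides X are reduced to X Un A and X Int A by submodularity; that X Int A does not
  beat A persists since the capacity of a source side X inside A minus that
  of A is nondecreasing in the parameter for a source-sink-monotone network.

  Termination: labels are bounded and only grow, and an edge that has stopped being admissible
  becomes admissible again only after its tail is relabeled.  Each round of the main loop
  saturates an admissible tree edge.
*)
theory Submission
  imports Defs "HOL-Analysis.Elementary_Metric_Spaces"
begin

text \<open>The obstacle is that in the middle of a round flows, excesses, labels and the tree are
  all in flux. What tames this is that every flow function changes only by a function that vanishes
  at the current parameter \<open>lam\<close>: excesses are zero there (\<open>excess_lam\<close>),
  and a removed tree edge keeps its flow value there. Apart from contractions, the residual graph at
  \<open>lam\<close> is therefore frozen while orphans are processed, and labels and pointers can be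
  treated as in a static network; only the behaviour beyond \<open>lam\<close> is rewritten. That
  behaviour matters again after draining, so flow limits have to be correct only for tails outside
  \<open>modified\<close>. Removing a tree edge freezes its residual capacity from
  \<open>lam\<close> on; hence away from the tree and its reversals nothing changes with the
  parameter, and the tree alone decides how long the current cut stays minimum. Optimality is
  witnessed by the inflow of the sink: it equals the capacity of the current cut
  (\<open>cut_A\<close>), and no other cut is smaller.\<close>

section \<open>Flows and cuts\<close>

text \<open>The flow inside \<open>Y\<close> cancels in pairs, and conservation leaves
  \<open>t\<close> as the only vertex of \<open>Y\<close> that can have nonzero total inflow.
  Nothing is asked of the vertices of \<open>X\<close>, so the lemma serves plain networks as well
  as those whose source stands for many contracted vertices.\<close>

lemma sum_cut_antisymmetric:
  fixes g :: "'v \<Rightarrow> 'v \<Rightarrow> real"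
  assumes fin: "finite X" "finite Y" and disj: "X \<inter> Y = {}" and t: "t \<in> Y"
    and anti: "\<And>u v. u \<in> Y \<Longrightarrow> v \<in> Y \<Longrightarrow> g v u = - g u v"
    and cons: "\<And>v. v \<in> Y - {t} \<Longrightarrow> (\<Sum>u\<in>X \<union> Y. g u v) = 0"
  shows "(\<Sum>u\<in>X. \<Sum>v\<in>Y. g u v) = (\<Sum>u\<in>X \<union> Y. g u t)"
proof -
  have inner: "(\<Sum>v\<in>Y. \<Sum>u\<in>Y. g u v) = 0"
  proof -
    have "(\<Sum>v\<in>Y. \<Sum>u\<in>Y. g u v) = (\<Sum>v\<in>Y. \<Sum>u\<in>Y. - g v u)"
      by (intro sum.cong refl anti)
    also have "\<dots> = - (\<Sum>v\<in>Y. \<Sum>u\<in>Y. g v u)"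
      by (simp add: sum_negf)
    also have "(\<Sum>v\<in>Y. \<Sum>u\<in>Y. g v u) = (\<Sum>v\<in>Y. \<Sum>u\<in>Y. g u v)"
      by (rule sum.swap)
    finally show ?thesis by simp
  qed
  have "(\<Sum>u\<in>X \<union> Y. g u t) = (\<Sum>v\<in>Y. \<Sum>u\<in>X \<union> Y. g u v)"
    using cons by (subst sum.remove[OF fin(2) t]) simp
  also have "\<dots> = (\<Sum>v\<in>Y. \<Sum>u\<in>X. g u v) + (\<Sum>v\<in>Y. \<Sum>u\<in>Y. g u v)"
    by (simp add: sum.union_disjoint fin disj sum.distrib)
  also have "\<dots> = (\<Sum>u\<in>X. \<Sum>v\<in>Y. g u v)"
    by (simp add: inner sum.swap[of _ Y X])
  finally show ?thesis by simp
qed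

lemma sum_edges_into:
  assumes "finite V" "E \<subseteq> V \<times> V"
  shows "(\<Sum>u | (u, v) \<in> E. f (u, v)) = (\<Sum>u\<in>V. if (u, v) \<in> E then f (u, v) else (0::real))"
proof -
  have "{u. (u, v) \<in> E} = {u \<in> V. (u, v) \<in> E}"
    using assms by auto
  then show ?thesis
    using sum.inter_filter[of V "\<lambda>u. f (u, v)" "\<lambda>u. (u, v) \<in> E"] assms by simp
qed

lemma sum_edges_between:
  assumes "finite A" "finite B" 
  shows "(\<Sum>e \<in> E \<inter> A \<times> B. f e) = (\<Sum>u\<in>A. \<Sum>v\<in>B. if (u, v) \<in> E then f (u, v) else (0::real))"
proof -
  have "(\<Sum>e \<in> E \<inter> A \<times> B. f e) = (\<Sum>e \<in> A \<times> B. if e \<in> E then f e else 0)"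
    by (subst Int_commute, rule sum.inter_restrict) (simp add: assms)
  also have "\<dots> = (\<Sum>u\<in>A. \<Sum>v\<in>B. if (u, v) \<in> E then f (u, v) else 0)"
    by (subst sum.cartesian_product) (auto intro!: sum.cong)
  finally show ?thesis .
qed

text \<open>Weak duality. For the cuts of the algorithm, equality comes from saturation, in
  \<open>cut_A\<close>.\<close>

lemma flow_value_le_cut_cap:
  assumes N: "flow_network N" and f: "is_flow N f" and cut: "is_cut N X Y"
  shows "flow_value N f \<le> cut_cap N X Y"
proof -
  define g where "g u v = (if (u, v) \<in> edges N then f (u, v) else 0)" for u v
  have V: "finite (verts N)" "edges N \<subseteq> verts N \<times> verts N" "sym (edges N)"
    using N by (auto simp: flow_network_def)
  have XY: "X \<union> Y = verts N" "X \<inter> Y = {}" "source N \<in> X" "sink N \<in> Y"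
    using cut by (auto simp: is_cut_def)
  have fin: "finite X" "finite Y"
    using V XY(1) by (metis finite_Un)+
  have "flow_value N f = (\<Sum>u\<in>X \<union> Y. g u (sink N))"
    by (simp add: flow_value_def XY(1) g_def sum_edges_into[OF V(1,2)])
  also have "\<dots> = (\<Sum>u\<in>X. \<Sum>v\<in>Y. g u v)"
  proof (rule sum_cut_antisymmetric[symmetric])
    show "g v u = - g u v" for u v
      using f symD[OF V(3), of u v] symD[OF V(3), of v u] by (auto simp: g_def is_flow_def)
    show "(\<Sum>u\<in>X \<union> Y. g u v) = 0" if "v \<in> Y - {sink N}" for v
    proof -
      have "v \<in> verts N - {source N, sink N}"
        using that XY by auto
      then have "(\<Sum>u | (u, v) \<in> edges N. f (u, v)) = 0"
        using f by (auto simp: is_flow_def)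
      then show ?thesis
        by (simp add: XY(1) g_def sum_edges_into[OF V(1,2)])
    qed
  qed (use fin XY in auto)
  also have "\<dots> \<le> (\<Sum>u\<in>X. \<Sum>v\<in>Y. if (u, v) \<in> edges N then cap N (u, v) else 0)"
    using f by (intro sum_mono) (auto simp: g_def is_flow_def)
  also have "\<dots> = cut_cap N X Y"
    by (simp add: cut_cap_def sum_edges_between fin)
  finally show ?thesis .
qed

section \<open>Maximum flows: existence by compactness, and absence of augmenting walks\<close>

lemma convergent_subsequence_finite:
  fixes F :: "nat \<Rightarrow> 'e \<Rightarrow> real"
  assumes "finite S" "\<And>e. e \<in> S \<Longrightarrow> bounded (range (\<lambda>n. F n e))"
  shows "\<exists>r :: nat \<Rightarrow> nat. strict_mono r \<and> (\<forall>e\<in>S. convergent (\<lambda>n. F (r n) e))"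
  using assms
proof (induction S)
  case empty
  show ?case by (intro exI[of _ id]) (auto simp: strict_mono_def)
next
  case (insert e S)
  then obtain r :: "nat \<Rightarrow> nat" where r: "strict_mono r" "\<And>e. e \<in> S \<Longrightarrow> convergent (\<lambda>n. F (r n) e)"
    by auto
  have "bounded (range (\<lambda>n. F (r n) e))"
    using insert.prems[of e] by (rule bounded_subset) auto
  then obtain l q where q: "strict_mono (q :: nat \<Rightarrow> nat)" "((\<lambda>n. F (r n) e) \<circ> q) \<longlonglongrightarrow> l"
    using bounded_imp_convergent_subsequence by blast
  have "convergent (\<lambda>n. F ((r \<circ> q) n) e')" if "e' \<in> S" for e'
    using convergent_subseq_convergent[OF r(2)[OF that] q(1)] by (simp add: o_def)
  moreover have "convergent (\<lambda>n. F ((r \<circ> q) n) e)"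
    using q(2) by (auto simp: convergent_def o_def)
  ultimately show ?case
    using strict_mono_o[OF r(1) q(1)] by blast
qed

text \<open>Without this, the rule \<open>init\<close> might not apply and \<open>Start\<close>
  would be stuck. Capacities are real, so repeated augmentation need not terminate; instead, flows
  whose values approach the supremum have a subsequence converging on each of the finitely many
  edges.\<close>

lemma max_flow_exists:
  assumes N: "flow_network N"
  shows "\<exists>f. is_max_flow N f"
proof -
  have V: "finite (verts N)" "edges N \<subseteq> verts N \<times> verts N" "sym (edges N)"
    using N by (auto simp: flow_network_def)
  have finE: "finite (edges N)"
    using V finite_subset by blast
  have fin: "finite {u. (u, v) \<in> edges N}" for v
    using finite_subset[of "{u. (u, v) \<in> edges N}" "verts N"] V by auto
  define W where "W = {flow_value N f | f. is_flow N f}"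
  have zero: "is_flow N (\<lambda>_. 0)"
    using N by (auto simp: is_flow_def flow_network_def)
  have "is_cut N {source N} (verts N - {source N})"
    using N by (auto simp: is_cut_def flow_network_def)
  then have bdd: "bdd_above W"
    using flow_value_le_cut_cap[OF N] by (auto simp: W_def bdd_above_def)
  have ne: "W \<noteq> {}"
    using zero by (auto simp: W_def)
  have "\<exists>f. is_flow N f \<and> flow_value N f > Sup W - 1 / real (Suc n)" for n
    using less_cSup_iff[OF ne bdd, of "Sup W - 1 / real (Suc n)"] by (auto simp: W_def)
  then obtain F where F: "\<And>n. is_flow N (F n)"
      and val: "\<And>n. flow_value N (F n) > Sup W - 1 / real (Suc n)"
    by metis
  have "bounded (range (\<lambda>n. F n e))" if "e \<in> edges N" for e
  proof -
    obtain u v where e: "e = (u, v)" by force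
    \<comment> \<open>Antisymmetry turns the capacity of the reverse edge into a lower
      bound.\<close>
    have "\<bar>F n e\<bar> \<le> max (cap N (u, v)) (cap N (v, u))" for n
    proof -
      have "(u, v) \<in> edges N" "(v, u) \<in> edges N"
        using that e V(3) by (auto dest: symD)
      then have "F n (u, v) \<le> cap N (u, v)" "F n (v, u) \<le> cap N (v, u)" "F n (v, u) = - F n (u, v)"
        using F[of n] by (auto simp: is_flow_def)
      then show ?thesis by (simp add: e)
    qed
    then show ?thesis
      by (auto simp: bounded_iff)
  qed
  then obtain r where r: "strict_mono r" "\<And>e. e \<in> edges N \<Longrightarrow> convergent (\<lambda>n. F (r n) e)"
    using convergent_subsequence_finite[OF finE, of F] by auto
  define L where "L e = lim (\<lambda>n. F (r n) e)" for e
  have L: "(\<lambda>n. F (r n) e) \<longlonglongrightarrow> L e" if "e \<in> edges N" for e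
    using r(2)[OF that] by (simp add: L_def convergent_LIMSEQ_iff)
  have "is_flow N L"
    unfolding is_flow_def
  proof (intro conjI ballI)
    fix e assume e: "e \<in> edges N"
    show "L e \<le> cap N e"
      using F e by (intro LIMSEQ_le_const2[OF L[OF e]]) (auto simp: is_flow_def)
  next
    fix e assume e: "e \<in> edges N"
    obtain u v where uv: "e = (u, v)" by force
    have "(v, u) \<in> edges N"
      using e uv V(3) by (auto dest: symD)
    moreover have "(\<lambda>n. F (r n) (v, u)) = (\<lambda>n. - F (r n) (u, v))"
      using F e uv by (fastforce simp: is_flow_def)
    ultimately have "(\<lambda>n. F (r n) (v, u)) \<longlonglongrightarrow> L (v, u)" "(\<lambda>n. F (r n) (v, u)) \<longlonglongrightarrow> - L (u, v)"
      using L[of "(v, u)"] tendsto_minus[OF L[OF e]] uv by auto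
    then show "case e of (u, v) \<Rightarrow> L (v, u) = - L (u, v)"
      using LIMSEQ_unique uv by auto
  next
    fix v assume v: "v \<in> verts N - {source N, sink N}"
    have "(\<lambda>n. \<Sum>u | (u, v) \<in> edges N. F (r n) (u, v)) \<longlonglongrightarrow> (\<Sum>u | (u, v) \<in> edges N. L (u, v))"
      by (intro tendsto_sum L) simp
    moreover have "(\<lambda>n. \<Sum>u | (u, v) \<in> edges N. F (r n) (u, v)) = (\<lambda>n. 0)"
      using F v by (auto simp: is_flow_def)
    ultimately show "(\<Sum>u | (u, v) \<in> edges N. L (u, v)) = 0"
      using LIMSEQ_unique tendsto_const by metis
  qed
  moreover have "flow_value N g \<le> flow_value N L" if "is_flow N g" for g
  proof -
    have "(\<lambda>n. flow_value N (F (r n))) \<longlonglongrightarrow> flow_value N L"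
      unfolding flow_value_def by (intro tendsto_sum L) simp
    moreover have "(\<lambda>n. Sup W - 1 / real (Suc (r n))) \<longlonglongrightarrow> Sup W - 0"
      using LIMSEQ_subseq_LIMSEQ[OF LIMSEQ_inverse_real_of_nat r(1)]
      by (intro tendsto_intros) (simp add: o_def inverse_eq_divide)
    ultimately have "Sup W - 0 \<le> flow_value N L"
      using val by (intro LIMSEQ_le[of "\<lambda>n. Sup W - 1 / real (Suc (r n))"]) (auto intro!: exI[of _ 0] less_imp_le)
    moreover have "flow_value N g \<le> Sup W"
      using that by (intro cSup_upper bdd) (auto simp: W_def)
    ultimately show ?thesis by simp
  qed
  ultimately show ?thesis
    by (auto simp: is_max_flow_def)
qed

text \<open>
  The unit flows along the edges of a residual walk add up to \<open>d\<close>; a walk may repeat edges,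
  which only makes \<open>d\<close> larger there and so only forces a smaller step size.
\<close>

lemma residual_walk_unit_flow:
  assumes V: "finite V" and E: "E \<subseteq> V \<times> V" "sym E" and R: "R \<subseteq> E" and walk: "(v, t) \<in> R\<^sup>*"
  shows "\<exists>d :: 'v \<times> 'v \<Rightarrow> real. (\<forall>e\<in>E. 0 < d e \<longrightarrow> e \<in> R) \<and> (\<forall>x y. d (y, x) = - d (x, y)) \<and>
     (\<forall>y. (\<Sum>x | (x, y) \<in> E. d (x, y)) = of_bool (y = t) - of_bool (y = v))"
  using walk
proof (induction rule: converse_rtrancl_induct)
  case base
  show ?case by (intro exI[of _ "\<lambda>_. 0"]) auto
next
  case (step u v)
  then obtain d :: "'v \<times> 'v \<Rightarrow> real" where d: "\<And>e. e \<in> E \<Longrightarrow> 0 < d e \<Longrightarrow> e \<in> R"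
    "\<And>x y. d (y, x) = - d (x, y)"
    "\<And>y. (\<Sum>x | (x, y) \<in> E. d (x, y)) = of_bool (y = t) - of_bool (y = v)"
    by blast
  \<comment> \<open>One more unit along the first edge, cancelled on its reversal to keep
    antisymmetry; for a loop the two terms cancel.\<close>
  define d' where "d' e = d e + of_bool (e = (u, v)) - of_bool (e = (v, u))" for e
  have uv: "(u, v) \<in> E" "(v, u) \<in> E"
    using step.hyps(1) R E by (auto dest: symD)
  have fin: "finite {x. (x, y) \<in> E}" for y
    using finite_subset[of "{x. (x, y) \<in> E}" V] V E by auto
  have "(\<Sum>x | (x, y) \<in> E. d' (x, y)) = of_bool (y = t) - of_bool (y = u)" for y
  proof -
    have single: "(\<Sum>x | (x, y) \<in> E. of_bool ((x, y) = (a, b)) :: real) = of_bool (y = b)" if "(a, b) \<in> E" for a b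
    proof -
      have "(\<Sum>x | (x, y) \<in> E. of_bool ((x, y) = (a, b)) :: real) =
          (\<Sum>x | (x, y) \<in> E. if x = a then of_bool (y = b) else 0)"
        by (intro sum.cong) auto
      then show ?thesis
        using fin that by (auto simp: sum.delta)
    qed
    show ?thesis
      using single[OF uv(1)] single[OF uv(2)] d(3)[of y]
      by (simp add: d'_def sum.distrib sum_subtractf)
  qed
  moreover have "e \<in> R" if "e \<in> E" "0 < d' e" for e
  proof (cases "e = (u, v)")
    case False
    then have "d' e \<le> d e"
      by (simp add: d'_def)
    then show ?thesis
      using that d(1)[of e] by linarith
  qed (use step.hyps(1) in simp)
  moreover have "d' (y, x) = - d' (x, y)" for x y
    unfolding d'_def d(2)[of x y] by (simp add: conj_commute)
  ultimately show ?case by blast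
qed

lemma max_flow_no_augmenting_walk:
  assumes N: "flow_network N" and max: "is_max_flow N f"
  shows "(source N, sink N) \<notin> (residual_edges N f)\<^sup>*"
proof
  define R where "R = residual_edges N f"
  assume "(source N, sink N) \<in> (residual_edges N f)\<^sup>*"
  then have walk: "(source N, sink N) \<in> R\<^sup>*"
    by (simp add: R_def)
  have V: "finite (verts N)" "edges N \<subseteq> verts N \<times> verts N" "sym (edges N)" "source N \<noteq> sink N"
    using N by (auto simp: flow_network_def)
  have f: "is_flow N f"
    using max by (simp add: is_max_flow_def)
  have RE: "R \<subseteq> edges N"
    by (auto simp: R_def residual_edges_def)
  then have "finite R"
    using V by (meson finite_SigmaI finite_subset)
  obtain d :: "'a \<times> 'a \<Rightarrow> real" where d: "\<And>e. e \<in> edges N \<Longrightarrow> 0 < d e \<Longrightarrow> e \<in> R"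
    "\<And>x y. d (y, x) = - d (x, y)"
    "\<And>y. (\<Sum>x | (x, y) \<in> edges N. d (x, y)) = of_bool (y = sink N) - of_bool (y = source N)"
    using residual_walk_unit_flow[OF V(1,2,3) RE walk] by blast
  \<comment> \<open>A step that fits into every residual edge with positive \<open>d\<close>; the
    element 1 makes the minimum well-defined even if there is none.\<close>
  define \<epsilon> where "\<epsilon> = Min (insert 1 ((\<lambda>e. (cap N e - f e) / d e) ` {e \<in> R. 0 < d e}))"
  have "\<epsilon> > 0"
  proof -
    have "finite {e \<in> R. 0 < d e}"
      using \<open>finite R\<close> by simp
    moreover have "0 < (cap N e - f e) / d e" if "e \<in> R" "0 < d e" for e
      using that by (simp add: R_def residual_edges_def)
    ultimately show ?thesis
      unfolding \<epsilon>_def by (subst Min_gr_iff) auto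
  qed
  have small: "\<epsilon> * d e \<le> cap N e - f e" if "e \<in> edges N" for e
  proof (cases "0 < d e")
    case True
    have "\<epsilon> \<le> (cap N e - f e) / d e"
      using d(1)[OF that True] True \<open>finite R\<close> by (auto simp: \<epsilon>_def intro!: Min_le)
    then show ?thesis
      using True by (simp add: pos_le_divide_eq)
  next
    case False
    then have "\<epsilon> * d e \<le> 0"
      using \<open>\<epsilon> > 0\<close> by (simp add: mult_nonneg_nonpos)
    then show ?thesis
      using f that by (auto simp: is_flow_def intro: order_trans)
  qed
  define g where "g e = f e + \<epsilon> * d e" for e
  have sum: "(\<Sum>x | (x, y) \<in> edges N. g (x, y)) =
      (\<Sum>x | (x, y) \<in> edges N. f (x, y)) + \<epsilon> * (of_bool (y = sink N) - of_bool (y = source N))" for y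
    by (simp add: g_def sum.distrib sum_distrib_left[symmetric] d(3))
  have "is_flow N g"
    unfolding is_flow_def
  proof (intro conjI ballI)
    show "g e \<le> cap N e" if "e \<in> edges N" for e
      using small[OF that] by (simp add: g_def)
    show "case e of (u, v) \<Rightarrow> g (v, u) = - g (u, v)" if "e \<in> edges N" for e
    proof (cases e)
      case (Pair u v)
      then have "f (v, u) = - f (u, v)"
        using f that by (auto simp: is_flow_def)
      then show ?thesis
        unfolding Pair g_def by (simp add: d(2)[of u v])
    qed
    show "(\<Sum>u | (u, v) \<in> edges N. g (u, v)) = 0" if "v \<in> verts N - {source N, sink N}" for v
      using f that by (auto simp: sum is_flow_def)
  qed
  then have "flow_value N g \<le> flow_value N f"
    using max by (simp add: is_max_flow_def)
  then show False
    using V(4) \<open>\<epsilon> > 0\<close> by (simp add: flow_value_def sum)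
qed

section \<open>Shortest paths\<close>

lemma bfs_dist_le: "(v, t) \<in> R ^^ n \<Longrightarrow> bfs_dist R t v \<le> enat n"
  unfolding bfs_dist_def by (rule INF_lower) simp

lemma bfs_dist_witness:
  assumes "bfs_dist R t v = enat n"
  shows "(v, t) \<in> R ^^ n"
proof -
  let ?S = "enat ` {n. (v, t) \<in> R ^^ n}"
  have "?S \<noteq> {}"
    using assms by (intro notI) (simp add: bfs_dist_def top_enat_def)
  then obtain k where "k \<in> ?S"
    by auto
  then have "Inf ?S \<in> ?S"
    by (rule wellorder_InfI)
  then show ?thesis
    using assms by (auto simp: bfs_dist_def)
qed

lemma bfs_dist_finite:
  assumes "(v, t) \<in> R\<^sup>*"
  obtains n where "bfs_dist R t v = enat n"
proof -
  obtain m where "(v, t) \<in> R ^^ m"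
    using assms rtrancl_imp_relpow by blast
  then show ?thesis
    using bfs_dist_le[of v t m R] that by (cases "bfs_dist R t v") auto
qed

lemma bfs_dist_sink [simp]: "bfs_dist R t t = 0"
  using bfs_dist_le[of t t 0 R] by (simp add: zero_enat_def[symmetric])

lemma bfs_dist_edge:
  assumes "(u, v) \<in> R"
  shows "bfs_dist R t u \<le> bfs_dist R t v + 1"
proof (cases "bfs_dist R t v")
  case (enat n)
  then have "(u, t) \<in> R ^^ Suc n"
    using assms bfs_dist_witness relpow_Suc_I2 by metis
  then show ?thesis
    using bfs_dist_le[of u t "Suc n" R] enat by (simp add: one_enat_def)
qed simp

text \<open>Each vertex picks a successor whose distance is one smaller; following the choices
  realises every distance, as the last clause of \<open>shortest_path_in_tree\<close> demands. Like
  \<open>max_flow_exists\<close>, this keeps \<open>Start\<close> from being stuck.\<close>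

lemma shortest_path_in_tree_exists: "\<exists>T. shortest_path_in_tree R t T"
proof -
  have ex: "\<exists>w. (v, w) \<in> R \<and> (\<exists>n. bfs_dist R t v = enat (Suc n) \<and> bfs_dist R t w = enat n)"
    if v: "(v, t) \<in> R\<^sup>*" "v \<noteq> t" for v
  proof -
    obtain n where n: "bfs_dist R t v = enat n"
      using bfs_dist_finite[OF v(1)] by blast
    have n_walk: "(v, t) \<in> R ^^ n"
      by (rule bfs_dist_witness[OF n])
    then obtain m where m: "n = Suc m"
      using v(2) by (cases n) auto
    obtain w where w: "(v, w) \<in> R" "(w, t) \<in> R ^^ m"
      using n_walk unfolding m by (metis relpow_Suc_D2)
    have "bfs_dist R t w \<le> enat m"
      by (rule bfs_dist_le[OF w(2)])
    moreover have "enat (Suc m) \<le> bfs_dist R t w + 1"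
      using bfs_dist_edge[OF w(1)] n m by metis
    ultimately have "bfs_dist R t w = enat m"
      by (cases "bfs_dist R t w") (auto simp: one_enat_def)
    then show ?thesis
      using w n m by blast
  qed
  define p where "p v = (SOME w. (v, w) \<in> R \<and> (\<exists>n. bfs_dist R t v = enat (Suc n) \<and> bfs_dist R t w = enat n))" for v
  have p: "(v, p v) \<in> R \<and> (\<exists>n. bfs_dist R t v = enat (Suc n) \<and> bfs_dist R t (p v) = enat n)"
    if "(v, t) \<in> R\<^sup>*" "v \<noteq> t" for v
    unfolding p_def by (rule someI_ex[OF ex[OF that]])
  define T where "T = {(v, p v) | v. (v, t) \<in> R\<^sup>* \<and> v \<noteq> t}"
  have "(v, t) \<in> T ^^ n" if "bfs_dist R t v = enat n" for v n
    using that
  proof (induction n arbitrary: v)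
    case 0
    then show ?case using bfs_dist_witness[of R t v 0] by simp
  next
    case (Suc n)
    have v: "(v, t) \<in> R\<^sup>*"
      using bfs_dist_witness[OF Suc.prems] relpow_imp_rtrancl by blast
    moreover have "v \<noteq> t"
      using Suc.prems by (auto simp: zero_enat_def)
    ultimately have "(v, p v) \<in> T" "bfs_dist R t (p v) = enat n"
      using p[of v] Suc.prems by (auto simp: T_def)
    then show ?case
      using Suc.IH relpow_Suc_I2 by metis
  qed
  moreover have "T \<subseteq> R" "single_valued T" "Domain T = {v. (v, t) \<in> R\<^sup>*} - {t}"
    using p by (auto simp: T_def single_valued_def)
  ultimately show ?thesis
    unfolding shortest_path_in_tree_def by blast
qed

lemma relpow_subset:
  fixes R T :: "('v \<times> 'v) set"
  shows "(x, y) \<in> T ^^ n \<Longrightarrow> T \<subseteq> R \<Longrightarrow> (x, y) \<in> R ^^ n"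
  by (induction n arbitrary: y) auto

text \<open>The walk that the tree provides from \<open>u\<close> must start with
  \<open>(u, v)\<close>, as the tree is single-valued. Its remainder bounds the distance of
  \<open>v\<close> from above, and \<open>bfs_dist_edge\<close> bounds it from below.\<close>

lemma shortest_path_in_tree_step:
  assumes T: "shortest_path_in_tree R t T" and uv: "(u, v) \<in> T"
  shows "(v, t) \<in> R\<^sup>*" "bfs_dist R t u = bfs_dist R t v + 1"
proof -
  have TR: "T \<subseteq> R" and sv: "single_valued T" and dom: "Domain T = {v. (v, t) \<in> R\<^sup>*} - {t}"
    and walk: "\<And>v n. bfs_dist R t v = enat n \<Longrightarrow> (v, t) \<in> T ^^ n"
    using T by (auto simp: shortest_path_in_tree_def)
  have u: "(u, t) \<in> R\<^sup>*" "u \<noteq> t"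
    using uv dom by auto
  obtain n where n: "bfs_dist R t u = enat n"
    using bfs_dist_finite[OF u(1)] by blast
  have "(u, t) \<in> T ^^ n"
    by (rule walk[OF n])
  with u(2) obtain m where m: "n = Suc m"
    by (cases n) auto
  with \<open>(u, t) \<in> T ^^ n\<close> obtain w where w: "(u, w) \<in> T" "(w, t) \<in> T ^^ m"
    by (metis relpow_Suc_D2)
  then have "w = v"
    using sv uv by (auto dest: single_valuedD)
  then have vm: "(v, t) \<in> R ^^ m"
    using w(2) relpow_subset[OF _ TR] by blast
  then show "(v, t) \<in> R\<^sup>*"
    by (rule relpow_imp_rtrancl)
  have "bfs_dist R t u \<le> bfs_dist R t v + 1"
    using uv TR by (intro bfs_dist_edge) auto
  moreover have "bfs_dist R t v \<le> enat m"
    by (rule bfs_dist_le[OF vm])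
  ultimately show "bfs_dist R t u = bfs_dist R t v + 1"
    using n m by (cases "bfs_dist R t v") (auto simp: one_enat_def)
qed

text \<open>All labels from 0 up to \<open>d v\<close> occur along the chain, so \<open>B\<close>
  has more than \<open>d v\<close> members. Used for the initial distances and, in
  \<open>label_less_card\<close>, for a tree without orphans.\<close>

lemma label_chain_bound:
  fixes d :: "'v \<Rightarrow> enat"
  assumes fin: "finite B" and t: "d t = 0" and v: "v \<in> B"
    and finite_label: "\<And>v. v \<in> B \<Longrightarrow> d v \<noteq> \<infinity>"
    and chain: "\<And>v. v \<in> B - {t} \<Longrightarrow> \<exists>w\<in>B. d v = d w + 1"
  shows "d v < enat (card B)"
proof -
  obtain k where k: "d v = enat k"
    using finite_label[OF v] by auto
  have "\<forall>j\<le>k. \<exists>w\<in>B. d w = enat j" if "v \<in> B" "d v = enat k" for v k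
    using that
  proof (induction k arbitrary: v)
    case 0
    then show ?case by auto
  next
    case (Suc k)
    then have "v \<noteq> t"
      using t by (auto simp: zero_enat_def)
    then obtain w where w: "w \<in> B" "d v = d w + 1"
      using chain[of v] Suc.prems by auto
    then have "d w = enat k"
      using Suc.prems by (cases "d w") (auto simp: one_enat_def)
    then show ?case
      using Suc.IH[OF w(1)] Suc.prems by (auto simp: le_Suc_eq)
  qed
  then have "enat ` {..k} \<subseteq> d ` B"
    using k v by (force simp: image_iff)
  then have "card (enat ` {..k}) \<le> card (d ` B)"
    by (intro card_mono) (use fin in auto)
  also have "\<dots> \<le> card B"
    by (rule card_image_le[OF fin])
  also have "card (enat ` {..k}) = Suc k"
    by (subst card_image) (auto simp: inj_on_def)
  finally show ?thesis
    using k by simp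
qed

text \<open>A positive value at \<open>l\<close> rules out a root there, so each limit lies strictly
  beyond the parameter at which it is computed. The roots form a compact set, so the infimum in
  \<open>smallest_root\<close> is attained if there are any.\<close>

lemma smallest_root_cases:
  fixes g :: "real \<Rightarrow> real"
  assumes cont: "continuous_on {l..lmax G} g" and l: "l \<le> lmax G" and pos: "0 < g l"
  shows "smallest_root G l g = \<infinity> \<and> (\<forall>x\<in>{l..lmax G}. 0 < g x) \<or>
     (\<exists>y\<in>{l<..lmax G}. smallest_root G l g = ereal y \<and> g y = 0 \<and> (\<forall>x\<in>{l..<y}. 0 < g x))"
proof -
  define S where "S = {x. l \<le> x \<and> x \<le> lmax G \<and> g x = 0}"
  have posI: "0 < g x" if x: "l \<le> x" "x \<le> lmax G" "\<And>z. z \<in> S \<Longrightarrow> x < z" for x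
  proof (rule ccontr)
    assume "\<not> 0 < g x"
    then obtain z where "l \<le> z" "z \<le> x" "g z = 0"
      using IVT2'[of g x 0 l] x(1,2) pos continuous_on_subset[OF cont, of "{l..x}"] by force
    then show False
      using x(2) x(3)[of z] by (auto simp: S_def)
  qed
  show ?thesis
  proof (cases "S = {}")
    case True
    then have "smallest_root G l g = \<infinity>"
      by (simp add: smallest_root_def S_def[symmetric] top_ereal_def)
    then show ?thesis
      using posI True by auto
  next
    case False
    have "S = {x \<in> {l..lmax G}. g x = 0}"
      by (auto simp: S_def)
    then have "closed S"
      using continuous_closed_preimage_constant[OF cont] by simp
    then have "compact ({l..lmax G} \<inter> S)"
      by (rule compact_Int_closed[OF compact_Icc])
    moreover have "{l..lmax G} \<inter> S = S"
      by (auto simp: S_def)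
    ultimately have "compact S"
      by simp
    then obtain y where y: "y \<in> S" "\<And>z. z \<in> S \<Longrightarrow> y \<le> z"
      using compact_attains_inf[OF _ False] by blast
    have "(INF x\<in>S. ereal x) = ereal y"
    proof (rule antisym)
      show "(INF x\<in>S. ereal x) \<le> ereal y"
        using y(1) by (rule INF_lower)
      show "ereal y \<le> (INF x\<in>S. ereal x)"
        using y(2) by (intro INF_greatest) simp
    qed
    then have "smallest_root G l g = ereal y"
      by (simp add: smallest_root_def S_def)
    moreover have "0 < g x" if "x \<in> {l..<y}" for x
    proof (rule posI)
      have "y \<le> lmax G"
        using y(1) by (simp add: S_def)
      then show "l \<le> x" "x \<le> lmax G"
        using that by auto
      show "x < z" if "z \<in> S" for z
        using y(2)[OF that] \<open>x \<in> {l..<y}\<close> by simp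
    qed
    moreover have "y \<in> {l<..lmax G}" "g y = 0"
      using y(1) pos by (auto simp: S_def less_le)
    ultimately show ?thesis
      by blast
  qed
qed

section \<open>Contraction\<close>

lemma contract_simps [simp]:
  "source (contract N U) = source N" "sink (contract N U) = sink N"
  "lmin (contract N U) = lmin N" "lmax (contract N U) = lmax N"
  "verts (contract N U) = insert (source N) (verts N - U)"
  "cap (contract N U) = merge N U (cap N)"
  by (simp_all add: contract_def)

lemma redirect_inner_iff:
  "x \<notin> insert (source N) U \<Longrightarrow> y \<notin> insert (source N) U \<Longrightarrow>
     redirect N U e = (x, y) \<longleftrightarrow> e = (x, y)"
  by (cases e) (auto simp: redirect_def Let_def split: if_splits)

lemma redirect_source_iff:
  "y \<notin> insert (source N) U \<Longrightarrow>
     redirect N U e = (source N, y) \<longleftrightarrow> fst e \<in> insert (source N) U \<and> snd e = y"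
  by (cases e) (auto simp: redirect_def Let_def split: if_splits)

lemma redirect_to_source_iff:
  "y \<notin> insert (source N) U \<Longrightarrow>
     redirect N U e = (y, source N) \<longleftrightarrow> fst e = y \<and> snd e \<in> insert (source N) U"
  by (cases e) (auto simp: redirect_def Let_def split: if_splits)

lemma edges_contract_inner:
  assumes "x \<notin> insert (source N) U" "y \<notin> insert (source N) U"
  shows "(x, y) \<in> edges (contract N U) \<longleftrightarrow> (x, y) \<in> edges N"
proof -
  have "(x, y) \<in> redirect N U ` edges N \<longleftrightarrow> (x, y) \<in> edges N"
    using redirect_inner_iff[OF assms] by (metis (no_types, opaque_lifting) imageE rev_image_eqI)
  then show ?thesis
    using assms by (simp add: contract_def)
qed

lemma edges_contract_subset:
  assumes "edges N \<subseteq> insert (source N) B \<times> insert (source N) B"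
  shows "edges (contract N U) \<subseteq> insert (source N) (B - U) \<times> insert (source N) (B - U)"
  using assms by (auto simp: contract_def redirect_def Let_def split: if_splits)

lemma merge_inner:
  assumes "x \<notin> insert (source N) U" "y \<notin> insert (source N) U"
  shows "merge N U g (x, y) z = (if (x, y) \<in> edges N then g (x, y) z else 0)"
proof -
  have "{e' \<in> edges N. redirect N U e' = (x, y)} = (if (x, y) \<in> edges N then {(x, y)} else {})"
    using redirect_inner_iff[OF assms] by auto
  then show ?thesis
    by (simp add: merge_def)
qed

lemma merge_source:
  assumes "y \<notin> insert (source N) U" "finite U"
  shows "merge N U g (source N, y) z =
     (\<Sum>a\<in>insert (source N) U. if (a, y) \<in> edges N then g (a, y) z else 0)"
proof -
  have "{e' \<in> edges N. redirect N U e' = (source N, y)} =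
      (\<lambda>a. (a, y)) ` {a \<in> insert (source N) U. (a, y) \<in> edges N}"
    unfolding redirect_source_iff[OF assms(1)] by force
  then show ?thesis
    using assms(2) by (simp only: merge_def)
      (subst sum.reindex, simp add: inj_on_def, simp only: o_def, rule sum.inter_filter, simp)
qed

lemma merge_to_source:
  assumes "y \<notin> insert (source N) U" "finite U"
  shows "merge N U g (y, source N) z =
     (\<Sum>a\<in>insert (source N) U. if (y, a) \<in> edges N then g (y, a) z else 0)"
proof -
  have "{e' \<in> edges N. redirect N U e' = (y, source N)} =
      (\<lambda>a. (y, a)) ` {a \<in> insert (source N) U. (y, a) \<in> edges N}"
    unfolding redirect_to_source_iff[OF assms(1)] by force
  then show ?thesis
    using assms(2) by (simp only: merge_def)
      (subst sum.reindex, simp add: inj_on_def, simp only: o_def, rule sum.inter_filter, simp)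
qed

text \<open>\<open>contract\<close> drops loops at the source from the edges, but
  \<open>merge\<close> still sums them; hence the exception for \<open>(source N, source N)\<close>,
  here and in \<open>cap_out\<close> and \<open>flow_out\<close>.\<close>

lemma merge_outside:
  assumes "e \<notin> edges (contract N U)" "e \<noteq> (source N, source N)"
  shows "merge N U g e z = 0"
proof -
  have "{e' \<in> edges N. redirect N U e' = e} = {}"
    using assms by (auto simp: contract_def)
  then show ?thesis
    by (simp only: merge_def sum.empty)
qed

section \<open>Cuts of a source-sink-monotone network\<close>

lemma at_param_simps [simp]:
  "verts (at_param G x) = verts G" "edges (at_param G x) = edges G"
  "cap (at_param G x) e = cap G e x" "source (at_param G x) = source G"
  "sink (at_param G x) = sink G"
  by (simp_all add: at_param_def)

locale pbfs =
  fixes G :: "'v pnetwork" and adj :: "'v \<Rightarrow> 'v list"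
  assumes params: "parametric_flow_network G"
    and monotone: "source_sink_monotone G"
    and adjacency: "adjacency_lists G adj"
begin

abbreviation "V \<equiv> verts G"
abbreviation "s \<equiv> source G"
abbreviation "t \<equiv> sink G"

text \<open>Extended by zero to all pairs, so that cuts become double sums over vertices.\<close>

definition c :: "'v \<Rightarrow> 'v \<Rightarrow> real \<Rightarrow> real" where
  "c u v x = (if (u, v) \<in> edges G then cap G (u, v) x else 0)"

definition cut :: "'v set \<Rightarrow> real \<Rightarrow> real" where
  "cut X x = (\<Sum>u\<in>X. \<Sum>v\<in>V - X. c u v x)"

definition good_cut :: "('v \<Rightarrow> ereal) \<Rightarrow> real \<Rightarrow> bool" where
  "good_cut \<beta> x \<longleftrightarrow> is_sink_minimal_min_cut (at_param G x)
     {v \<in> V. \<beta> v \<le> ereal x} {v \<in> V. \<beta> v > ereal x}"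

lemma lmin_nonneg: "0 \<le> lmin G" and lmin_le_lmax: "lmin G \<le> lmax G"
  and network: "x \<in> {lmin G..lmax G} \<Longrightarrow> flow_network (at_param G x)"
  using params by (auto simp: parametric_flow_network_def)

lemma finite_V: "finite V" and E_sub: "edges G \<subseteq> V \<times> V" and E_sym: "sym (edges G)"
  and s_V: "s \<in> V" and t_V: "t \<in> V" and s_neq_t: "s \<noteq> t"
  using network[of "lmin G"] lmin_le_lmax by (auto simp: flow_network_def)

lemma E_swap: "(u, v) \<in> edges G \<longleftrightarrow> (v, u) \<in> edges G"
  using E_sym by (auto dest: symD)

lemma c_nonneg: "x \<in> {lmin G..lmax G} \<Longrightarrow> 0 \<le> c u v x"
  using network[of x] by (auto simp: flow_network_def c_def)

lemma c_continuous: "continuous_on {lmin G..lmax G} (c u v)"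
  using params by (cases "(u, v) \<in> edges G") (auto simp: parametric_flow_network_def c_def)

text \<open>The condition includes the edge from the source to the sink, which is constant too.
  Therefore every edge not entering the sink is non-decreasing (\<open>c_mono\<close>), and every
  edge not leaving the source is non-increasing (\<open>c_antimono\<close>).\<close>

lemma c_const:
  assumes "\<not> (u = s \<and> v \<noteq> t)" "\<not> (v = t \<and> u \<noteq> s)" "x \<in> {lmin G..lmax G}" "y \<in> {lmin G..lmax G}"
  shows "c u v x = c u v y"
proof (cases "(u, v) \<in> edges G")
  case True
  then obtain k where "\<forall>l\<in>{lmin G..lmax G}. cap G (u, v) l = k"
    using monotone assms(1,2) unfolding source_sink_monotone_def by blast
  then show ?thesis
    using assms(3,4) by (simp add: c_def)
qed (simp add: c_def)

lemma c_mono: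
  assumes "v \<noteq> t" "x \<in> {lmin G..lmax G}" "y \<in> {lmin G..lmax G}" "x \<le> y"
  shows "c u v x \<le> c u v y"
proof (cases "u = s")
  case True
  then show ?thesis
    using monotone assms by (auto simp: c_def source_sink_monotone_def intro: mono_onD)
next
  case False
  then show ?thesis
    using c_const[of u v x y] assms by simp
qed

lemma c_antimono:
  assumes "u \<noteq> s" "x \<in> {lmin G..lmax G}" "y \<in> {lmin G..lmax G}" "x \<le> y"
  shows "c u v y \<le> c u v x"
proof (cases "v = t")
  case True
  then show ?thesis
    using monotone assms by (auto simp: c_def source_sink_monotone_def monotone_on_def)
next
  case False
  then show ?thesis
    using c_const[of u v x y] assms by simp
qed

lemma cut_cap_eq: "X \<subseteq> V \<Longrightarrow> cut_cap (at_param G x) X (V - X) = cut X x"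
  using finite_V finite_subset[of X V]
  by (simp add: cut_cap_def cut_def c_def sum_edges_between)

text \<open>Fixed index sets make cuts with different source sides comparable term by term.\<close>

lemma cut_indicator:
  assumes "X \<subseteq> V"
  shows "cut X x = (\<Sum>u\<in>V. \<Sum>v\<in>V. if u \<in> X \<and> v \<notin> X then c u v x else 0)"
proof -
  have "(\<Sum>u\<in>V. \<Sum>v\<in>V. if u \<in> X \<and> v \<notin> X then c u v x else 0) =
      (\<Sum>u\<in>V. if u \<in> X then \<Sum>v\<in>V. if v \<notin> X then c u v x else 0 else 0)"
    by (intro sum.cong refl) auto
  also have "\<dots> = (\<Sum>u\<in>{u \<in> V. u \<in> X}. \<Sum>v\<in>{v \<in> V. v \<notin> X}. c u v x)"
    by (simp only: sum.inter_filter[OF finite_V])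
  also have "{u \<in> V. u \<in> X} = X"
    using assms by auto
  also have "{v \<in> V. v \<notin> X} = V - X"
    by auto
  finally show ?thesis
    by (simp add: cut_def)
qed

text \<open>The two sides differ only in pairs between \<open>X - A\<close> and
  \<open>A - X\<close>, which count on the right alone.\<close>

lemma cut_submodular:
  assumes "X \<subseteq> V" "A \<subseteq> V" "x \<in> {lmin G..lmax G}"
  shows "cut (X \<union> A) x + cut (X \<inter> A) x \<le> cut X x + cut A x"
proof -
  have "(if u \<in> X \<union> A \<and> v \<notin> X \<union> A then c u v x else 0) + (if u \<in> X \<inter> A \<and> v \<notin> X \<inter> A then c u v x else 0)
      \<le> (if u \<in> X \<and> v \<notin> X then c u v x else 0) + (if u \<in> A \<and> v \<notin> A then c u v x else 0)" for u v
    using c_nonneg[OF assms(3), of u v] by auto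
  then have "(\<Sum>u\<in>V. \<Sum>v\<in>V. (if u \<in> X \<union> A \<and> v \<notin> X \<union> A then c u v x else 0) +
        (if u \<in> X \<inter> A \<and> v \<notin> X \<inter> A then c u v x else 0))
      \<le> (\<Sum>u\<in>V. \<Sum>v\<in>V. (if u \<in> X \<and> v \<notin> X then c u v x else 0) + (if u \<in> A \<and> v \<notin> A then c u v x else 0))"
    by (intro sum_mono)
  moreover have "X \<union> A \<subseteq> V" "X \<inter> A \<subseteq> V"
    using assms by auto
  ultimately show ?thesis
    using assms by (simp add: cut_indicator sum.distrib)
qed

text \<open>Pairs from \<open>X\<close> to the complement of \<open>A\<close> cancel. What remains
  is the capacity from \<open>X\<close> to \<open>A - X\<close>, which avoids the sink and cannot
  decrease, minus the capacity from \<open>A - X\<close> to the complement of \<open>A\<close>,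
  which avoids the source and cannot increase.\<close>

lemma cut_difference_mono:
  assumes "X \<subseteq> A" "A \<subseteq> V" "s \<in> X" "t \<notin> A"
    and xy: "x \<in> {lmin G..lmax G}" "y \<in> {lmin G..lmax G}" "x \<le> y"
  shows "cut X x - cut A x \<le> cut X y - cut A y"
proof -
  have "(if u \<in> X \<and> v \<notin> X then c u v x else 0) - (if u \<in> A \<and> v \<notin> A then c u v x else 0)
      \<le> (if u \<in> X \<and> v \<notin> X then c u v y else 0) - (if u \<in> A \<and> v \<notin> A then c u v y else 0)" for u v
    using c_mono[of v, OF _ xy] c_antimono[of u, OF _ xy] assms(1,3,4) by auto
  then have "(\<Sum>u\<in>V. \<Sum>v\<in>V. (if u \<in> X \<and> v \<notin> X then c u v x else 0) - (if u \<in> A \<and> v \<notin> A then c u v x else 0))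
      \<le> (\<Sum>u\<in>V. \<Sum>v\<in>V. (if u \<in> X \<and> v \<notin> X then c u v y else 0) - (if u \<in> A \<and> v \<notin> A then c u v y else 0))"
    by (intro sum_mono)
  moreover have "X \<subseteq> V"
    using assms by auto
  ultimately show ?thesis
    using assms(2) by (simp add: cut_indicator sum_subtractf)
qed

text \<open>By \<open>strict\<close>, every minimum source side lies in \<open>A\<close>, so
  \<open>V - A\<close> is contained in every minimum sink side; the claim on cardinalities
  follows.\<close>

lemma sink_minimal_min_cutI:
  assumes A: "A \<subseteq> V" "s \<in> A" "t \<notin> A"
    and min: "\<And>X. X \<subseteq> V \<Longrightarrow> s \<in> X \<Longrightarrow> t \<notin> X \<Longrightarrow> cut A x \<le> cut X x"
    and strict: "\<And>X. X \<subseteq> V \<Longrightarrow> s \<in> X \<Longrightarrow> t \<notin> X \<Longrightarrow> cut X x \<le> cut A x \<Longrightarrow> X \<subseteq> A"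
  shows "is_sink_minimal_min_cut (at_param G x) A (V - A)"
proof -
  have cutD: "X \<subseteq> V \<and> s \<in> X \<and> t \<notin> X \<and> Y = V - X" if "is_cut (at_param G x) X Y" for X Y
    using that by (auto simp: is_cut_def)
  have cutA: "is_cut (at_param G x) A (V - A)"
    using A t_V by (auto simp: is_cut_def)
  have "is_min_cut (at_param G x) A (V - A)"
    using cutA min by (auto simp: is_min_cut_def cut_cap_eq A dest!: cutD)
  moreover have "card (V - A) \<le> card Y" if XY: "is_min_cut (at_param G x) X Y" for X Y
  proof -
    have X: "X \<subseteq> V" "s \<in> X" "t \<notin> X" "Y = V - X"
      using cutD[of X Y] XY unfolding is_min_cut_def by blast+
    have "cut X x \<le> cut A x"
      using XY cutA X A by (force simp: is_min_cut_def cut_cap_eq)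
    then have "X \<subseteq> A"
      using strict X by blast
    then show ?thesis
      using X finite_V by (intro card_mono) auto
  qed
  ultimately show ?thesis
    by (auto simp: is_sink_minimal_min_cut_def)
qed

end

section \<open>The invariant\<close>

definition res :: "'v pbfs_state \<Rightarrow> 'v \<times> 'v \<Rightarrow> real \<Rightarrow> real" where
  "res \<sigma> e x = cap (net \<sigma>) e x - flow \<sigma> e x"

definition inflow :: "'v pbfs_state \<Rightarrow> 'v \<Rightarrow> real \<Rightarrow> real" where
  "inflow \<sigma> v x = (\<Sum>u\<in>insert (source (net \<sigma>)) (sink_side \<sigma>). flow \<sigma> (u, v) x)"

text \<open>The outcome of \<open>smallest_root_cases\<close>, phrased through residual capacities.
  It does not mention the parameter at which the root was computed, and so survives an increase of
  \<open>lam\<close> that stays below the limit.\<close>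

definition limit_correct :: "'v pbfs_state \<Rightarrow> 'v \<times> 'v \<Rightarrow> bool" where
  "limit_correct \<sigma> e \<longleftrightarrow>
     limit \<sigma> e = \<infinity> \<and> (\<forall>x\<in>{lam \<sigma>..lmax (net \<sigma>)}. 0 < res \<sigma> e x) \<or>
     (\<exists>y\<in>{lam \<sigma><..lmax (net \<sigma>)}. limit \<sigma> e = ereal y \<and> res \<sigma> e y = 0 \<and>
        (\<forall>x\<in>{lam \<sigma>..<y}. 0 < res \<sigma> e x))"

lemma residual_iff:
  "residual \<sigma> u v \<longleftrightarrow> v \<in> sink_side \<sigma> \<and> v \<noteq> u \<and> (u, v) \<in> edges (net \<sigma>) \<and> 0 < res \<sigma> (u, v) (lam \<sigma>)"
  by (simp add: residual_def res_def)

lemma sink_side_cong: "net \<sigma>' = net \<sigma> \<Longrightarrow> sink_side \<sigma>' = sink_side \<sigma>"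
  by (simp add: sink_side_def)

lemma limit_correct_cong:
  assumes "net \<sigma>' = net \<sigma>" "lam \<sigma>' = lam \<sigma>" "limit \<sigma>' e = limit \<sigma> e" "flow \<sigma>' e = flow \<sigma> e"
  shows "limit_correct \<sigma>' e = limit_correct \<sigma> e"
  by (simp add: limit_correct_def res_def assms)

text \<open>Stated for a change by \<open>D\<close>, since removing a tree edge and draining along
  one both have this form. The edge and its reversal change together, so inflow is shifted from
  \<open>v\<close> to \<open>u\<close>.\<close>

lemma sum_set_flow:
  fixes f :: "'v \<times> 'v \<Rightarrow> real \<Rightarrow> real"
  assumes "finite S" "u \<in> S" "v \<in> S" "u \<noteq> v" "f (v, u) x = - f (u, v) x"
  shows "(\<Sum>w\<in>S. set_flow f (u, v) (\<lambda>x. f (u, v) x - D x) (w, y) x) =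
     (\<Sum>w\<in>S. f (w, y) x) + (if y = u then D x else if y = v then - D x else 0)"
proof -
  let ?h = "\<lambda>w. (if w = v then if y = u then D x else 0 else 0) + (if w = u then if y = v then - D x else 0 else 0)"
  have "set_flow f (u, v) (\<lambda>x. f (u, v) x - D x) (w, y) x = f (w, y) x + ?h w" for w
    using assms(4,5) by (auto simp: set_flow_def)
  then have "(\<Sum>w\<in>S. set_flow f (u, v) (\<lambda>x. f (u, v) x - D x) (w, y) x) = (\<Sum>w\<in>S. f (w, y) x) + (\<Sum>w\<in>S. ?h w)"
    by (simp add: sum.distrib)
  also have "(\<Sum>w\<in>S. ?h w) = (if y = u then D x else if y = v then - D x else 0)"
    using assms(1-4) by (simp add: sum.distrib)
  finally show ?thesis .
qed

text \<open>
  \<open>F\<close> collects the tree edges that are about to be removed: they may already be saturated at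
  the current parameter.  Only the edges that neither leave the sink nor enter the source matter
  for cuts, so nothing is said about the residual capacities of the others.

  While orphans are being adopted, a contracted vertex may still have a residual edge to a
  vertex \<open>v\<close> of the sink side, but only if the label of \<open>v\<close> is at least the size of the sink side
  (\<open>source_res\<close>).  A tree without orphans has smaller labels, so then the edges of the cut are
  saturated.
\<close>

locale pbfs_inv = pbfs G adj for G :: "'v pnetwork" and adj :: "'v \<Rightarrow> 'v list" +
  fixes \<sigma> :: "'v pbfs_state" and F :: "('v \<times> 'v) set"
  assumes source_net: "source (net \<sigma>) = s"
    and sink_net: "sink (net \<sigma>) = t"
    and lmax_net: "lmax (net \<sigma>) = lmax G"
    and edges_net_sub: "edges (net \<sigma>) \<subseteq> insert s (sink_side \<sigma>) \<times> insert s (sink_side \<sigma>)"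
    and side_sub: "sink_side \<sigma> \<subseteq> V"
    and sink_in: "t \<in> sink_side \<sigma>"
    and edges_net: "u \<in> sink_side \<sigma> \<Longrightarrow> v \<in> sink_side \<sigma> \<Longrightarrow>
      (u, v) \<in> edges (net \<sigma>) \<longleftrightarrow> (u, v) \<in> edges G"
    and cap_inner: "u \<in> sink_side \<sigma> \<Longrightarrow> v \<in> sink_side \<sigma> \<Longrightarrow> cap (net \<sigma>) (u, v) x = c u v x"
    and cap_source: "v \<in> sink_side \<sigma> \<Longrightarrow> cap (net \<sigma>) (s, v) x = (\<Sum>a\<in>V - sink_side \<sigma>. c a v x)"
    and cap_out: "e \<notin> edges (net \<sigma>) \<Longrightarrow> e \<noteq> (s, s) \<Longrightarrow> cap (net \<sigma>) e x = 0"
    and flow_out: "e \<notin> edges (net \<sigma>) \<Longrightarrow> e \<noteq> (s, s) \<Longrightarrow> flow \<sigma> e x = 0"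
    and lam_ge: "lmin G \<le> lam \<sigma>"
    and lam_le: "lam \<sigma> \<le> lmax G"
    and flow_antisym: "u \<in> insert s (sink_side \<sigma>) \<Longrightarrow> v \<in> sink_side \<sigma> \<Longrightarrow> x \<in> {lam \<sigma>..lmax G} \<Longrightarrow>
      flow \<sigma> (v, u) x = - flow \<sigma> (u, v) x"
    and flow_cont: "u \<in> sink_side \<sigma> \<Longrightarrow> v \<in> sink_side \<sigma> \<Longrightarrow>
      continuous_on {lam \<sigma>..lmax G} (flow \<sigma> (u, v))"
    and excess_cont: "v \<in> sink_side \<sigma> \<Longrightarrow> continuous_on {lam \<sigma>..lmax G} (excess \<sigma> v)"
    and conservation: "v \<in> sink_side \<sigma> \<Longrightarrow> v \<noteq> t \<Longrightarrow> x \<in> {lam \<sigma>..lmax G} \<Longrightarrow>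
      inflow \<sigma> v x = excess \<sigma> v x"
    and excess_lam: "v \<in> sink_side \<sigma> \<Longrightarrow> v \<noteq> t \<Longrightarrow> excess \<sigma> v (lam \<sigma>) = 0"
    and excess_unmodified: "v \<in> sink_side \<sigma> \<Longrightarrow> v \<noteq> t \<Longrightarrow> v \<notin> modified \<sigma> \<Longrightarrow>
      x \<in> {lam \<sigma>..lmax G} \<Longrightarrow> excess \<sigma> v x = 0"
    and modified_sub: "modified \<sigma> \<subseteq> sink_side \<sigma>"
    and orphans_sub: "orphans \<sigma> \<subseteq> modified \<sigma> - {t}"
    and tree_sub: "tree \<sigma> \<subseteq> sink_side \<sigma> \<times> sink_side \<sigma>"
    and tree_edges: "tree \<sigma> \<subseteq> edges G"
    and tree_sv: "single_valued (tree \<sigma>)"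
    and tree_dom: "Domain (tree \<sigma>) = sink_side \<sigma> - {t} - orphans \<sigma>"
    and tree_label: "(u, v) \<in> tree \<sigma> \<Longrightarrow> label \<sigma> u = label \<sigma> v + 1"
    and tree_res: "e \<in> tree \<sigma> - F \<Longrightarrow> 0 < res \<sigma> e (lam \<sigma>)"
    and tree_limit: "e \<in> tree \<sigma> - F \<Longrightarrow> fst e \<notin> modified \<sigma> \<Longrightarrow> limit_correct \<sigma> e"
    and label_bound: "v \<in> sink_side \<sigma> \<Longrightarrow> label \<sigma> v < enat (card V)"
    and label_sink: "label \<sigma> t = 0"
    and feasible: "u \<in> insert s (sink_side \<sigma>) \<Longrightarrow> u \<noteq> t \<Longrightarrow> v \<in> sink_side \<sigma> \<Longrightarrow>
      0 \<le> res \<sigma> (u, v) (lam \<sigma>)"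
    and valid: "u \<in> sink_side \<sigma> \<Longrightarrow> u \<noteq> t \<Longrightarrow> v \<in> sink_side \<sigma> \<Longrightarrow> 0 < res \<sigma> (u, v) (lam \<sigma>) \<Longrightarrow>
      label \<sigma> u \<le> label \<sigma> v + 1"
    and nontree: "u \<in> insert s (sink_side \<sigma>) \<Longrightarrow> u \<noteq> t \<Longrightarrow> v \<in> sink_side \<sigma> \<Longrightarrow>
      (u, v) \<notin> tree \<sigma> \<Longrightarrow> (v, u) \<notin> tree \<sigma> \<Longrightarrow> x \<in> {lam \<sigma>..lmax G} \<Longrightarrow>
      res \<sigma> (u, v) x = res \<sigma> (u, v) (lam \<sigma>)"
    and nontree_sink: "u \<in> sink_side \<sigma> \<Longrightarrow> u \<noteq> t \<Longrightarrow> (u, t) \<notin> tree \<sigma> \<Longrightarrow>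
      x \<in> {lam \<sigma>..lmax G} \<Longrightarrow> res \<sigma> (u, t) x = 0"
    and source_res: "v \<in> sink_side \<sigma> \<Longrightarrow> 0 < res \<sigma> (s, v) (lam \<sigma>) \<Longrightarrow>
      enat (card (sink_side \<sigma>)) \<le> label \<sigma> v"
    and pointer: "u \<in> sink_side \<sigma> \<Longrightarrow> u \<noteq> t \<Longrightarrow> k < current \<sigma> u \<Longrightarrow> k < length (adj u) \<Longrightarrow>
      \<not> admissible \<sigma> u (adj u ! k)"
    and inflow_le_cut: "X \<subseteq> V \<Longrightarrow> s \<in> X \<Longrightarrow> t \<notin> X \<Longrightarrow> inflow \<sigma> t (lam \<sigma>) \<le> cut X (lam \<sigma>)"
    and bp_side: "v \<in> sink_side \<sigma> \<Longrightarrow> bp \<sigma> v = \<infinity>"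
    and bp_out: "v \<in> V - sink_side \<sigma> \<Longrightarrow> \<exists>r\<in>{lmin G..lam \<sigma>}. bp \<sigma> v = ereal r"
    and good_past: "lmin G \<le> x \<Longrightarrow> x < lam \<sigma> \<Longrightarrow> good_cut (bp \<sigma>) x"
    and F_sub: "F \<subseteq> tree \<sigma>"
    and F_sink: "(u, t) \<in> F \<Longrightarrow> res \<sigma> (u, t) (lam \<sigma>) = 0"
begin

abbreviation "B \<equiv> sink_side \<sigma>"
abbreviation "A \<equiv> V - B"
abbreviation "I \<equiv> {lam \<sigma>..lmax G}"

lemma source_notin: "s \<notin> B"
  using source_net by (auto simp: sink_side_def)

lemma finite_B: "finite B"
  using side_sub finite_V finite_subset by blast

lemma lam_I: "lam \<sigma> \<in> I"
  using lam_le by simp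

lemma I_sub: "x \<in> I \<Longrightarrow> x \<in> {lmin G..lmax G}"
  using lam_ge by auto

lemma inflow_eq: "inflow \<sigma> v x = (\<Sum>u\<in>insert s B. flow \<sigma> (u, v) x)"
  by (simp add: inflow_def source_net)

lemma res_out: "e \<notin> edges (net \<sigma>) \<Longrightarrow> e \<noteq> (s, s) \<Longrightarrow> res \<sigma> e x = 0"
  by (simp add: res_def cap_out flow_out)

lemma residual_iff_res:
  "residual \<sigma> u v \<longleftrightarrow> v \<in> B \<and> v \<noteq> u \<and> 0 < res \<sigma> (u, v) (lam \<sigma>)"
proof -
  have "(u, v) \<in> edges (net \<sigma>)" if "v \<in> B" "0 < res \<sigma> (u, v) (lam \<sigma>)"
    using res_out[of "(u, v)" "lam \<sigma>"] source_notin that by force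
  then show ?thesis
    by (auto simp: residual_iff)
qed

lemma tree_facts:
  assumes "(u, v) \<in> tree \<sigma>"
  shows "u \<in> B" "v \<in> B" "u \<noteq> t" "u \<notin> orphans \<sigma>" "u \<noteq> v" "(v, u) \<notin> tree \<sigma>" "(u, v) \<in> edges G"
proof -
  show "u \<in> B" "v \<in> B" "(u, v) \<in> edges G"
    using assms tree_sub tree_edges by auto
  show "u \<noteq> t" "u \<notin> orphans \<sigma>"
    using assms tree_dom by auto
  obtain k where "label \<sigma> v = enat k"
    using label_bound[OF \<open>v \<in> B\<close>] by (cases "label \<sigma> v") auto
  then show "u \<noteq> v" "(v, u) \<notin> tree \<sigma>"
    using tree_label[OF assms] tree_label[of v u] by (auto simp: one_enat_def)
qed

text \<open>Common core of tree-edge removal and draining. As \<open>D\<close> vanishes at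
  \<open>lam\<close>, the residual capacities there stay, and with them feasibility, validity of
  labels, pointers and the inflow of the sink; beyond \<open>lam\<close>, excess and inflow change
  by the same amount. The premise \<open>removed\<close> says that a deleted edge keeps its present
  residual capacity throughout \<open>I\<close>.\<close>

lemma push_preserves:
  assumes uv: "(u, v) \<in> tree \<sigma>"
    and D_cont: "continuous_on I D" and D_lam: "D (lam \<sigma>) = 0"
    and frame: "net \<sigma>' = net \<sigma>" "label \<sigma>' = label \<sigma>" "current \<sigma>' = current \<sigma>" "bp \<sigma>' = bp \<sigma>"
      "lam \<sigma>' = lam \<sigma>"
    and flow': "flow \<sigma>' = set_flow (flow \<sigma>) (u, v) (\<lambda>x. flow \<sigma> (u, v) x - D x)"
    and excess': "\<And>w x. w \<in> B \<Longrightarrow>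
      excess \<sigma>' w x = excess \<sigma> w x + (if w = u then D x else if w = v then - D x else 0)"
    and unmodified': "\<And>w x. w \<in> B \<Longrightarrow> w \<noteq> t \<Longrightarrow> w \<notin> modified \<sigma>' \<Longrightarrow> x \<in> I \<Longrightarrow> excess \<sigma>' w x = 0"
    and modified': "modified \<sigma>' \<subseteq> B" and orphans': "orphans \<sigma>' \<subseteq> modified \<sigma>' - {t}"
    and tree': "tree \<sigma>' \<subseteq> tree \<sigma>" "tree \<sigma> - {(u, v)} \<subseteq> tree \<sigma>'"
    and dom': "Domain (tree \<sigma>') = B - {t} - orphans \<sigma>'"
    and F': "F' \<subseteq> tree \<sigma>'" "F' \<subseteq> F" "tree \<sigma>' - F' \<subseteq> tree \<sigma> - F"
    and limit': "\<And>e. e \<in> tree \<sigma>' - F' \<Longrightarrow> fst e \<notin> modified \<sigma>' \<Longrightarrow> limit_correct \<sigma>' e"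
    and removed: "\<And>x. (u, v) \<notin> tree \<sigma>' \<Longrightarrow> x \<in> I \<Longrightarrow> D x = res \<sigma> (u, v) (lam \<sigma>) - res \<sigma> (u, v) x"
    and removed_sink: "(u, v) \<notin> tree \<sigma>' \<Longrightarrow> v = t \<Longrightarrow> res \<sigma> (u, v) (lam \<sigma>) = 0"
  shows "pbfs_inv G adj \<sigma>' F'"
proof -
  note t_uv = tree_facts[OF uv]
  have side: "sink_side \<sigma>' = B"
    by (rule sink_side_cong[OF frame(1)])
  have flow_eval: "flow \<sigma>' (a, b) x = (if a = u \<and> b = v then flow \<sigma> (u, v) x - D x
      else if a = v \<and> b = u then flow \<sigma> (v, u) x + D x else flow \<sigma> (a, b) x)" if "x \<in> I" for a b x
  proof -
    have anti: "flow \<sigma> (v, u) x = - flow \<sigma> (u, v) x"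
      using flow_antisym[of u v x] that t_uv(1,2) by simp
    show ?thesis
      unfolding anti using t_uv(5) by (simp add: flow' set_flow_def)
  qed
  have flow_lam: "flow \<sigma>' e (lam \<sigma>) = flow \<sigma> e (lam \<sigma>)" for e
    by (cases e) (simp add: flow_eval[OF lam_I] D_lam)
  have res_eval: "res \<sigma>' (a, b) x = (if a = u \<and> b = v then res \<sigma> (u, v) x + D x
      else if a = v \<and> b = u then res \<sigma> (v, u) x - D x else res \<sigma> (a, b) x)" if "x \<in> I" for a b x
    by (simp add: flow_eval[OF that] res_def frame)
  have res_lam: "res \<sigma>' e (lam \<sigma>) = res \<sigma> e (lam \<sigma>)" for e
    by (simp add: res_def frame flow_lam)
  have inflow_eval: "inflow \<sigma>' w x = inflow \<sigma> w x + (if w = u then D x else if w = v then - D x else 0)"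
    if "x \<in> I" for w x
  proof -
    have "flow \<sigma> (v, u) x = - flow \<sigma> (u, v) x"
      using flow_antisym[of u v x] that t_uv(1,2) by simp
    then show ?thesis
      unfolding inflow_def side frame(1) source_net flow'
      by (intro sum_set_flow) (use finite_B t_uv in auto)
  qed
  have cont: "continuous_on I (flow \<sigma> (a, b))" if "a \<in> B" "b \<in> B" for a b
    by (rule flow_cont[OF that])
  show ?thesis
  proof (unfold_locales, unfold side frame)
    fix a b x assume "a \<in> insert s B" "b \<in> B" "x \<in> I"
    then show "flow \<sigma>' (b, a) x = - flow \<sigma>' (a, b) x"
      using flow_antisym[of a b x] flow_antisym[of u v x] flow_eval t_uv by auto
  next
    fix a b assume ab: "a \<in> B" "b \<in> B"
    have eq: "(\<lambda>x. if a = u \<and> b = v then flow \<sigma> (u, v) x - D x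
      else if a = v \<and> b = u then flow \<sigma> (v, u) x + D x else flow \<sigma> (a, b) x) =
      (if a = u \<and> b = v then \<lambda>x. flow \<sigma> (u, v) x - D x
      else if a = v \<and> b = u then \<lambda>x. flow \<sigma> (v, u) x + D x else flow \<sigma> (a, b))" by auto
    have "continuous_on I (\<lambda>x. if a = u \<and> b = v then flow \<sigma> (u, v) x - D x
      else if a = v \<and> b = u then flow \<sigma> (v, u) x + D x else flow \<sigma> (a, b) x)"
      unfolding eq using ab D_cont t_uv by (simp add: continuous_on_diff continuous_on_add cont)
    then show "continuous_on I (flow \<sigma>' (a, b))"
      using flow_eval by (subst continuous_on_cong) auto
  next
    fix w assume w: "w \<in> B"
    have "continuous_on I (\<lambda>x. excess \<sigma> w x + (if w = u then D x else if w = v then - D x else 0))"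
      using excess_cont[OF w] D_cont
      by (cases "w = u"; cases "w = v") (simp_all add: continuous_on_add continuous_on_diff)
    then show "continuous_on I (excess \<sigma>' w)"
      using excess'[OF w] by (subst continuous_on_cong) auto
  next
    fix w x assume w: "w \<in> B" "w \<noteq> t" and x: "x \<in> I"
    show "inflow \<sigma>' w x = excess \<sigma>' w x"
      using conservation[OF w x] by (simp add: inflow_eval[OF x] excess' w)
  next
    fix w assume w: "w \<in> B" "w \<noteq> t"
    show "excess \<sigma>' w (lam \<sigma>) = 0"
      using excess_lam[OF w] by (simp add: D_lam excess' w)
  next
    fix e x assume e: "e \<notin> edges (net \<sigma>)" "e \<noteq> (s, s)"
    have "(u, v) \<in> edges (net \<sigma>)" "(v, u) \<in> edges (net \<sigma>)"
      using t_uv edges_net[of u v] edges_net[of v u] E_swap[of u v] by simp_all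
    then have "e \<noteq> (u, v)" "e \<noteq> (v, u)"
      using e(1) by metis+
    then show "flow \<sigma>' e x = 0"
      using flow_out[OF e, of x] by (simp add: flow' set_flow_def)
  next
    show "tree \<sigma>' \<subseteq> B \<times> B" "tree \<sigma>' \<subseteq> edges G" "single_valued (tree \<sigma>')"
      using tree' tree_sub tree_edges tree_sv single_valued_subset by blast+
  next
    fix a b x
    assume ab: "a \<in> insert s B" "a \<noteq> t" "b \<in> B" "(a, b) \<notin> tree \<sigma>'" "(b, a) \<notin> tree \<sigma>'" and x: "x \<in> I"
    consider "a = u" "b = v" | "a = v" "b = u" | "(a, b) \<noteq> (u, v)" "(b, a) \<noteq> (u, v)" by auto
    then show "res \<sigma>' (a, b) x = res \<sigma>' (a, b) (lam \<sigma>)"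
    proof cases
      case 1
      then show ?thesis
        using removed[of x] ab x by (simp add: res_lam res_eval[OF x])
    next
      case 2
      then have "v \<noteq> t" "(u, v) \<notin> tree \<sigma>'"
        using ab by auto
      \<comment> \<open>Neither direction leaves the source or enters the sink, so both capacities
        are constant, and freezing the residual capacity of one direction freezes that of the
        other.\<close>
      have const: "c u v x = c u v (lam \<sigma>)" "c v u x = c v u (lam \<sigma>)"
        using \<open>v \<noteq> t\<close> t_uv source_notin by (auto intro!: c_const[OF _ _ I_sub[OF x] I_sub[OF lam_I]])
      have "flow \<sigma> (v, u) x = - flow \<sigma> (u, v) x" "flow \<sigma> (v, u) (lam \<sigma>) = - flow \<sigma> (u, v) (lam \<sigma>)"
        using flow_antisym[of u v x] flow_antisym[of u v "lam \<sigma>"] t_uv x lam_I by simp_all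
      then show ?thesis
        using removed[OF \<open>(u, v) \<notin> tree \<sigma>'\<close> x] 2 t_uv(5) const
        by (simp add: res_lam res_eval[OF x]) (simp add: res_def cap_inner t_uv)
    next
      case 3
      then have "(a, b) \<notin> tree \<sigma>" "(b, a) \<notin> tree \<sigma>"
        using ab tree' by blast+
      moreover have "\<not> (a = u \<and> b = v)" "\<not> (a = v \<and> b = u)"
        using 3 by blast+
      then have "res \<sigma>' (a, b) x = res \<sigma> (a, b) x"
        by (simp only: res_eval[OF x] if_False)
      ultimately show ?thesis
        using nontree[of a b x] ab x by (simp add: res_lam)
    qed
  next
    fix a x assume a: "a \<in> B" "a \<noteq> t" "(a, t) \<notin> tree \<sigma>'" and x: "x \<in> I"
    show "res \<sigma>' (a, t) x = 0"
    proof (cases "(a, t) = (u, v)")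
      case True
      then have eq: "a = u" "v = t" and nt: "(u, v) \<notin> tree \<sigma>'"
        using a(3) by simp_all
      have "res \<sigma>' (u, v) x = res \<sigma> (u, v) x + D x"
        by (simp add: res_eval[OF x])
      also have "\<dots> = 0"
        using removed[OF nt x] removed_sink[OF nt eq(2)] by simp
      finally show ?thesis
        by (simp add: eq)
    next
      case False
      then have "\<not> (a = u \<and> t = v)" "\<not> (a = v \<and> t = u)"
        using t_uv by blast+
      then have "res \<sigma>' (a, t) x = res \<sigma> (a, t) x"
        by (simp only: res_eval[OF x] if_False)
      moreover have "(a, t) \<notin> tree \<sigma>"
        using a False tree' by blast
      ultimately show ?thesis
        using nontree_sink[of a x] a x by simp
    qed
  next
    fix a k assume "a \<in> B" "a \<noteq> t" "k < current \<sigma> a" "k < length (adj a)"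
    then show "\<not> admissible \<sigma>' a (adj a ! k)"
      using pointer[of a k] by (simp add: admissible_def residual_iff side frame res_lam)
  next
    fix X assume "X \<subseteq> V" "s \<in> X" "t \<notin> X"
    moreover have "inflow \<sigma>' t (lam \<sigma>) = inflow \<sigma> t (lam \<sigma>)"
      by (simp add: inflow_eval[OF lam_I] D_lam)
    ultimately show "inflow \<sigma>' t (lam \<sigma>) \<le> cut X (lam \<sigma>)"
      using inflow_le_cut by simp
  next
    fix a b assume "(a, b) \<in> tree \<sigma>'" then show "label \<sigma> a = label \<sigma> b + 1"
      using tree_label tree' by blast
  next
    fix e assume "e \<in> tree \<sigma>' - F'" then show "0 < res \<sigma>' e (lam \<sigma>)"
      using tree_res[of e] F' by (auto simp: res_lam)
  next
    fix a assume "(a, t) \<in> F'" then show "res \<sigma>' (a, t) (lam \<sigma>) = 0"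
      using F_sink[of a] F' by (auto simp: res_lam)
  next
    fix a b assume "a \<in> insert s B" "a \<noteq> t" "b \<in> B"
    then show "0 \<le> res \<sigma>' (a, b) (lam \<sigma>)"
      using feasible by (simp add: res_lam)
  next
    fix a b assume "a \<in> B" "a \<noteq> t" "b \<in> B" "0 < res \<sigma>' (a, b) (lam \<sigma>)"
    then show "label \<sigma> a \<le> label \<sigma> b + 1"
      using valid by (simp add: res_lam)
  next
    fix b assume "b \<in> B" "0 < res \<sigma>' (s, b) (lam \<sigma>)"
    then show "enat (card B) \<le> label \<sigma> b"
      using source_res by (simp add: res_lam)
  qed (fact source_net sink_net lmax_net edges_net_sub side_sub sink_in edges_net cap_inner cap_source
        cap_out lam_ge lam_le unmodified' modified' orphans' dom' limit' label_bound label_sink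
        bp_side bp_out good_past F')+
qed

text \<open>The new flow follows the capacity at a constant distance, so \<open>D\<close> is the
  loss of residual capacity since \<open>lam\<close>. An edge into the sink is saturated at that
  moment (\<open>F_sink\<close>), which gives \<open>nontree_sink\<close> afterwards.\<close>

lemma remove_tree_edge_preserves:
  assumes e: "e \<in> F"
  shows "pbfs_inv G adj (remove_tree_edge e \<sigma>) (F - {e})"
proof -
  obtain u v where uv: "e = (u, v)" by force
  have T: "(u, v) \<in> tree \<sigma>"
    using e uv F_sub by auto
  note t_uv = tree_facts[OF T]
  let ?\<sigma> = "remove_tree_edge (u, v) \<sigma>"
  define D where "D x = res \<sigma> (u, v) (lam \<sigma>) - res \<sigma> (u, v) x" for x
  have D: "D x = flow \<sigma> (u, v) x - (cap (net \<sigma>) (u, v) x + flow \<sigma> (u, v) (lam \<sigma>) - cap (net \<sigma>) (u, v) (lam \<sigma>))" for x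
    by (simp add: D_def res_def)
  have upd: "net ?\<sigma> = net \<sigma>" "label ?\<sigma> = label \<sigma>" "current ?\<sigma> = current \<sigma>" "bp ?\<sigma> = bp \<sigma>" "lam ?\<sigma> = lam \<sigma>"
    "modified ?\<sigma> = modified \<sigma> \<union> {u, v}" "tree ?\<sigma> = tree \<sigma> - {(u, v)}" "orphans ?\<sigma> = insert u (orphans \<sigma>)"
    "limit ?\<sigma> = (limit \<sigma>)((u, v) := \<infinity>)"
    by (simp_all add: remove_tree_edge_def Let_def)
  have flow': "flow ?\<sigma> = set_flow (flow \<sigma>) (u, v) (\<lambda>x. flow \<sigma> (u, v) x - D x)"
    by (simp add: remove_tree_edge_def Let_def D add_diff_eq)
  show ?thesis
    unfolding uv
  proof (rule push_preserves[OF T _ _ upd(1-5) flow'])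
    have "continuous_on I (c u v)"
      using c_continuous continuous_on_subset I_sub by blast
    then have "continuous_on I (cap (net \<sigma>) (u, v))"
      using cap_inner[OF t_uv(1,2)] by (subst continuous_on_cong[of I I _ "c u v"]) auto
    then show "continuous_on I D"
      using flow_cont[OF t_uv(1,2)] unfolding D by (intro continuous_intros)
    show "D (lam \<sigma>) = 0"
      by (simp add: D_def)
    show "excess ?\<sigma> w x = excess \<sigma> w x + (if w = u then D x else if w = v then - D x else 0)" for w x
      using t_uv(5) by (simp add: remove_tree_edge_def Let_def D)
    show "excess ?\<sigma> w x = 0" if "w \<in> B" "w \<noteq> t" "w \<notin> modified ?\<sigma>" "x \<in> I" for w x
      using that excess_unmodified[of w x] by (simp add: remove_tree_edge_def Let_def)
    show "Domain (tree ?\<sigma>) = B - {t} - orphans ?\<sigma>"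
    proof -
      have "Domain (tree \<sigma> - {(u, v)}) = Domain (tree \<sigma>) - {u}"
        using T tree_sv by (auto dest: single_valuedD)
      then show ?thesis
        using tree_dom by (auto simp: upd)
    qed
    show "limit_correct ?\<sigma> e'" if "e' \<in> tree ?\<sigma> - (F - {(u, v)})" "fst e' \<notin> modified ?\<sigma>" for e'
    proof -
      have "limit_correct \<sigma> e'"
        using that uv by (intro tree_limit) (auto simp: upd)
      moreover have "flow ?\<sigma> e' = flow \<sigma> e'"
        using that t_uv by (auto simp: upd flow' set_flow_def)
      ultimately show ?thesis
        using that uv limit_correct_cong[of ?\<sigma> \<sigma> e'] by (auto simp: upd)
    qed
    show "res \<sigma> (u, v) (lam \<sigma>) = 0" if "v = t"
      using F_sink[of u] e uv that by simp
  qed (use modified_sub orphans_sub t_uv F_sub uv e in \<open>auto simp: upd D_def\<close>)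
qed

text \<open>The excess is zero at \<open>lam\<close>, so the tree edge is still residual there and
  its new smallest root lies strictly later. As \<open>u\<close> leaves \<open>modified\<close>,
  this is the moment when the limit of its edge has to be correct.\<close>

lemma drain_edge_preserves:
  assumes T: "(u, v) \<in> tree \<sigma>" and u: "u \<in> modified \<sigma>" and F: "F = {}" and orphans: "orphans \<sigma> = {}"
  shows "pbfs_inv G adj (drain_edge u v \<sigma>) {}"
proof -
  note t_uv = tree_facts[OF T]
  let ?\<sigma> = "drain_edge u v \<sigma>"
  define D where "D x = - excess \<sigma> u x" for x
  have upd: "net ?\<sigma> = net \<sigma>" "label ?\<sigma> = label \<sigma>" "current ?\<sigma> = current \<sigma>" "bp ?\<sigma> = bp \<sigma>" "lam ?\<sigma> = lam \<sigma>"
    "modified ?\<sigma> = insert v (modified \<sigma> - {u})" "tree ?\<sigma> = tree \<sigma>" "orphans ?\<sigma> = orphans \<sigma>"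
    "limit ?\<sigma> = (limit \<sigma>)((u, v) :=
       smallest_root (net \<sigma>) (lam \<sigma>) (\<lambda>x. cap (net \<sigma>) (u, v) x - (flow \<sigma> (u, v) x - D x)))"
    by (simp_all add: drain_edge_def Let_def D_def)
  have flow': "flow ?\<sigma> = set_flow (flow \<sigma>) (u, v) (\<lambda>x. flow \<sigma> (u, v) x - D x)"
    by (simp add: drain_edge_def Let_def D_def)
  have D_cont: "continuous_on I D"
    using excess_cont[OF t_uv(1)] unfolding D_def by (intro continuous_intros)
  have D_lam: "D (lam \<sigma>) = 0"
    using excess_lam t_uv by (simp add: D_def)
  have excess': "excess ?\<sigma> w x = excess \<sigma> w x + (if w = u then D x else if w = v then - D x else 0)" for w x
    using t_uv(5) by (simp add: drain_edge_def Let_def D_def)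
  show ?thesis
  proof (rule push_preserves[OF T D_cont D_lam upd(1-5) flow' excess'])
    show "excess ?\<sigma> w x = 0" if "w \<in> B" "w \<noteq> t" "w \<notin> modified ?\<sigma>" "x \<in> I" for w x
      using that excess_unmodified[of w x] by (auto simp: excess' D_def upd)
    show "limit_correct ?\<sigma> e" if "e \<in> tree ?\<sigma> - {}" "fst e \<notin> modified ?\<sigma>" for e
    proof (cases "e = (u, v)")
      case True
      define g where "g x = cap (net \<sigma>) (u, v) x - (flow \<sigma> (u, v) x - D x)" for x
      have g: "res ?\<sigma> (u, v) = g"
        by (auto simp: res_def g_def flow' set_flow_def upd)
      have "continuous_on I (c u v)"
        using c_continuous continuous_on_subset I_sub by blast
      then have "continuous_on I (cap (net \<sigma>) (u, v))"
        using cap_inner[OF t_uv(1,2)] by (subst continuous_on_cong[of I I _ "c u v"]) auto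
      then have "continuous_on I g"
        using flow_cont[OF t_uv(1,2)] D_cont unfolding g_def by (intro continuous_intros)
      moreover have "0 < g (lam \<sigma>)"
        using tree_res[of "(u, v)"] T F D_lam by (simp add: g_def res_def)
      ultimately show ?thesis
        using smallest_root_cases[of "lam \<sigma>" "net \<sigma>" g] lam_le unfolding True limit_correct_def g
        by (simp add: upd lmax_net g_def[symmetric])
    next
      case False
      have "e \<noteq> (v, u)"
        using that t_uv by (auto simp: upd)
      then have "flow ?\<sigma> e = flow \<sigma> e"
        using False by (auto simp: flow' set_flow_def)
      moreover have "fst e \<noteq> u"
        using False T tree_sv that by (cases e) (auto simp: upd dest: single_valuedD)
      then have "limit_correct \<sigma> e"
        using that F by (intro tree_limit) (auto simp: upd)
      ultimately show ?thesis
        using False limit_correct_cong[of ?\<sigma> \<sigma> e] by (simp add: upd)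
    qed
    show "D x = res \<sigma> (u, v) (lam \<sigma>) - res \<sigma> (u, v) x" "res \<sigma> (u, v) (lam \<sigma>) = 0"
      if "(u, v) \<notin> tree ?\<sigma>" for x
      using that T by (simp_all add: upd)
  qed (use modified_sub orphans t_uv F T tree_dom in \<open>auto simp: upd\<close>)
qed

end

section \<open>Removing several tree edges in a row\<close>

context pbfs
begin

lemma remove_tree_edge_frame:
  "net (remove_tree_edge e \<sigma>) = net \<sigma>" "label (remove_tree_edge e \<sigma>) = label \<sigma>"
  "current (remove_tree_edge e \<sigma>) = current \<sigma>" "bp (remove_tree_edge e \<sigma>) = bp \<sigma>"
  "lam (remove_tree_edge e \<sigma>) = lam \<sigma>" "tree (remove_tree_edge e \<sigma>) = tree \<sigma> - {e}"
  "orphans (remove_tree_edge e \<sigma>) = insert (fst e) (orphans \<sigma>)"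
  by (simp_all add: remove_tree_edge_def Let_def)

text \<open>Edges leave the pending set one by one, and each intermediate state satisfies the
  invariant with what is still pending. The frame facts travel through the induction because the
  later arguments compare the state after the removals with the one before.\<close>

lemma fold_remove_tree_edge:
  assumes "pbfs_inv G adj \<sigma> F" "distinct es" "set es \<subseteq> F"
  defines "\<sigma>' \<equiv> fold remove_tree_edge es \<sigma>"
  shows "pbfs_inv G adj \<sigma>' (F - set es) \<and> net \<sigma>' = net \<sigma> \<and> label \<sigma>' = label \<sigma> \<and>
    current \<sigma>' = current \<sigma> \<and> bp \<sigma>' = bp \<sigma> \<and> lam \<sigma>' = lam \<sigma> \<and> tree \<sigma>' = tree \<sigma> - set es \<and>
    orphans \<sigma>' = orphans \<sigma> \<union> fst ` set es \<and> (\<forall>e. res \<sigma>' e (lam \<sigma>) = res \<sigma> e (lam \<sigma>))"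
  using assms(1-3) unfolding \<sigma>'_def
proof (induction es arbitrary: \<sigma> F)
  case Nil
  then show ?case by simp
next
  case (Cons e es)
  interpret pbfs_inv G adj \<sigma> F by fact
  let ?\<sigma> = "remove_tree_edge e \<sigma>"
  have "pbfs_inv G adj ?\<sigma> (F - {e})"
    using Cons.prems by (intro remove_tree_edge_preserves) simp
  moreover have "set es \<subseteq> F - {e}"
    using Cons.prems by auto
  moreover have "res ?\<sigma> e' (lam \<sigma>) = res \<sigma> e' (lam \<sigma>)" for e'
  proof -
    obtain u v where e: "e = (u, v)" by force
    then have "(u, v) \<in> tree \<sigma>"
      using Cons.prems F_sub by auto
    then have "u \<in> B" "v \<in> B"
      using tree_facts by blast+
    then have "flow \<sigma> (v, u) (lam \<sigma>) = - flow \<sigma> (u, v) (lam \<sigma>)"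
      using flow_antisym[of u v "lam \<sigma>"] lam_I by simp
    then have "flow ?\<sigma> e' (lam \<sigma>) = flow \<sigma> e' (lam \<sigma>)"
      by (simp add: remove_tree_edge_def Let_def set_flow_def e)
    then show ?thesis
      by (simp add: res_def remove_tree_edge_frame)
  qed
  ultimately show ?case
    using Cons.IH[of ?\<sigma> "F - {e}"] Cons.prems
    by (simp add: remove_tree_edge_frame Diff_insert2 [symmetric] Diff_insert [symmetric])
qed

end

context pbfs_inv
begin

lemma remove_tree_edges_preserves:
  assumes "remove_tree_edges F \<sigma> \<sigma>'"
  shows "pbfs_inv G adj \<sigma>' {}" "net \<sigma>' = net \<sigma>" "label \<sigma>' = label \<sigma>" "current \<sigma>' = current \<sigma>"
    "bp \<sigma>' = bp \<sigma>" "lam \<sigma>' = lam \<sigma>" "tree \<sigma>' = tree \<sigma> - F" "orphans \<sigma>' = orphans \<sigma> \<union> fst ` F"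
    "res \<sigma>' e (lam \<sigma>) = res \<sigma> e (lam \<sigma>)"
proof -
  obtain es where es: "distinct es" "set es = F" "\<sigma>' = fold remove_tree_edge es \<sigma>"
    using assms by (auto simp: remove_tree_edges_def)
  note * = fold_remove_tree_edge[OF pbfs_inv_axioms es(1) eq_refl[OF es(2)]]
  show "pbfs_inv G adj \<sigma>' {}" "net \<sigma>' = net \<sigma>" "label \<sigma>' = label \<sigma>" "current \<sigma>' = current \<sigma>"
    "bp \<sigma>' = bp \<sigma>" "lam \<sigma>' = lam \<sigma>" "tree \<sigma>' = tree \<sigma> - F" "orphans \<sigma>' = orphans \<sigma> \<union> fst ` F"
    "res \<sigma>' e (lam \<sigma>) = res \<sigma> e (lam \<sigma>)"
    using * unfolding es(2,3) Diff_cancel by blast+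
qed

lemma remove_tree_edges_exists: "\<exists>\<sigma>'. remove_tree_edges F \<sigma> \<sigma>'"
proof -
  have "F \<subseteq> B \<times> B"
    using F_sub tree_sub by blast
  then have "finite F"
    using finite_B finite_subset by blast
  then show ?thesis
    using finite_distinct_list[of F] by (auto simp: remove_tree_edges_def)
qed

text \<open>A larger pending set only weakens \<open>tree_res\<close> and \<open>tree_limit\<close>.
  This prepares the removal of all tree edges into an orphan, which is never the sink.\<close>

lemma pending_mono:
  assumes "F \<subseteq> F'" "F' \<subseteq> tree \<sigma>" "\<And>u. (u, t) \<notin> F'"
  shows "pbfs_inv G adj \<sigma> F'"
proof unfold_locales
  show "0 < res \<sigma> e (lam \<sigma>)" if "e \<in> tree \<sigma> - F'" for e
    using that assms(1) by (intro tree_res) auto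
  show "limit_correct \<sigma> e" if "e \<in> tree \<sigma> - F'" "fst e \<notin> modified \<sigma>" for e
    using that assms(1) by (intro tree_limit) auto
  show "F' \<subseteq> tree \<sigma>"
    by fact
  show "res \<sigma> (u, t) (lam \<sigma>) = 0" if "(u, t) \<in> F'" for u
    using that assms(3) by simp
qed (fact source_net sink_net lmax_net edges_net_sub side_sub sink_in edges_net cap_inner cap_source
      cap_out flow_out lam_ge lam_le flow_antisym flow_cont excess_cont conservation excess_lam
      excess_unmodified modified_sub orphans_sub tree_sub tree_edges tree_sv tree_dom tree_label
      label_bound label_sink feasible valid nontree nontree_sink source_res
      pointer inflow_le_cut bp_side bp_out good_past)+

section \<open>Adopting, relabeling and contracting an orphan\<close>

lemma admissible_iff:
  "admissible \<sigma> u v \<longleftrightarrow> v \<in> B \<and> v \<noteq> u \<and> 0 < res \<sigma> (u, v) (lam \<sigma>) \<and> label \<sigma> u = label \<sigma> v + 1"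
  by (auto simp: admissible_def residual_iff_res)

text \<open>Serves both \<open>adopt\<close>, where \<open>label'\<close> changes nothing because
  the edge is admissible, and \<open>relabel\<close>. By \<open>into\<close>, the labels of children
  of \<open>u\<close> stay right: either \<open>u\<close> keeps its label or it has no
  children.\<close>

lemma attach_preserves:
  assumes u: "u \<in> orphans \<sigma>" and F: "F = {}" and w: "residual \<sigma> u w"
    and frame: "net \<sigma>' = net \<sigma>" "flow \<sigma>' = flow \<sigma>" "excess \<sigma>' = excess \<sigma>" "modified \<sigma>' = modified \<sigma>"
      "limit \<sigma>' = limit \<sigma>" "bp \<sigma>' = bp \<sigma>" "lam \<sigma>' = lam \<sigma>"
    and tree': "tree \<sigma>' = insert (u, w) (tree \<sigma>)" and orphans': "orphans \<sigma>' = orphans \<sigma> - {u}"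
    and label': "label \<sigma>' = (label \<sigma>)(u := label \<sigma> w + 1)"
    and bound: "label \<sigma> w + 1 < enat (card V)" and inc: "label \<sigma> u \<le> label \<sigma> w + 1"
    and min: "\<And>v. residual \<sigma> u v \<Longrightarrow> label \<sigma> w \<le> label \<sigma> v"
    and into: "\<And>v. (v, u) \<in> tree \<sigma> \<Longrightarrow> label \<sigma> u = label \<sigma> w + 1"
    and pointer': "\<And>a k. a \<in> B \<Longrightarrow> a \<noteq> t \<Longrightarrow> k < current \<sigma>' a \<Longrightarrow> k < length (adj a) \<Longrightarrow>
      \<not> admissible \<sigma>' a (adj a ! k)"
  shows "pbfs_inv G adj \<sigma>' {}"
proof -
  have u_facts: "u \<in> B" "u \<noteq> t" "u \<in> modified \<sigma>"
    using u orphans_sub modified_sub by auto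
  have u_tree: "(u, v) \<notin> tree \<sigma>" for v
    using tree_facts(4) u by blast
  have w_facts: "w \<in> B" "w \<noteq> u" "0 < res \<sigma> (u, w) (lam \<sigma>)"
    using w by (auto simp: residual_iff_res)
  have side: "sink_side \<sigma>' = B"
    by (rule sink_side_cong[OF frame(1)])
  have res: "res \<sigma>' = res \<sigma>"
    by (auto simp: res_def frame fun_eq_iff)
  have inflow: "inflow \<sigma>' = inflow \<sigma>"
    by (auto simp: inflow_def frame side fun_eq_iff)
  have uw_edge: "(u, w) \<in> edges G"
    using w edges_net[of u w] u_facts w_facts by (auto simp: residual_def)
  have label_w: "label \<sigma> w + 1 \<noteq> 0"
    by (cases "label \<sigma> w") (auto simp: one_enat_def zero_enat_def)
  show ?thesis
  proof (unfold_locales, unfold side frame res inflow)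
    show "tree \<sigma>' \<subseteq> B \<times> B" "tree \<sigma>' \<subseteq> edges G"
      using tree_sub tree_edges u_facts w_facts uw_edge by (auto simp: tree')
    show "single_valued (tree \<sigma>')"
      using tree_sv u_tree by (auto simp: tree' single_valued_def)
    show "orphans \<sigma>' \<subseteq> modified \<sigma> - {t}"
      using orphans_sub by (auto simp: orphans')
    show "Domain (tree \<sigma>') = B - {t} - orphans \<sigma>'"
      using tree_dom u u_facts by (auto simp: tree' orphans')
  next
    fix a b assume ab: "(a, b) \<in> tree \<sigma>'"
    show "label \<sigma>' a = label \<sigma>' b + 1"
    proof (cases "(a, b) = (u, w)")
      case True
      then show ?thesis using w_facts by (simp add: label')
    next
      case False
      then have "(a, b) \<in> tree \<sigma>" "a \<noteq> u"
        using ab u_tree by (auto simp: tree')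
      then show ?thesis
        using tree_label[of a b] into[of a] by (auto simp: label')
    qed
  next
    fix e assume "e \<in> tree \<sigma>' - {}"
    then show "0 < res \<sigma> e (lam \<sigma>)"
      using tree_res[of e] w_facts by (auto simp: tree' F)
  next
    fix e assume e: "e \<in> tree \<sigma>' - {}" "fst e \<notin> modified \<sigma>"
    \<comment> \<open>The limit of the new edge is not computed yet, but its tail \<open>u\<close>
      is modified; so \<open>e\<close> is an old edge.\<close>
    then have "limit_correct \<sigma> e"
      using tree_limit[of e] u_facts by (auto simp: tree' F)
    then show "limit_correct \<sigma>' e"
      using limit_correct_cong[of \<sigma>' \<sigma> e] by (simp add: frame)
  next
    fix v assume "v \<in> B" then show "label \<sigma>' v < enat (card V)"
      using label_bound bound by (simp add: label')
  next
    show "label \<sigma>' t = 0"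
      using label_sink u_facts by (simp add: label')
  next
    fix a b assume ab: "a \<in> B" "a \<noteq> t" "b \<in> B" "0 < res \<sigma> (a, b) (lam \<sigma>)"
    show "label \<sigma>' a \<le> label \<sigma>' b + 1"
    proof (cases "a = u")
      case True
      show ?thesis
      proof (cases "b = u")
        case False
        then have "label \<sigma> w \<le> label \<sigma> b"
          using ab True by (intro min) (simp add: residual_iff_res)
        then show ?thesis
          using False True by (simp add: label' add_right_mono)
      qed (use True in simp)
    next
      case False
      then show ?thesis
        using valid[OF ab] inc by (cases "b = u") (auto simp: label' intro: order_trans add_right_mono)
    qed
  next
    fix a b x assume "a \<in> insert s B" "a \<noteq> t" "b \<in> B" "(a, b) \<notin> tree \<sigma>'" "(b, a) \<notin> tree \<sigma>'" "x \<in> I"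
    then show "res \<sigma> (a, b) x = res \<sigma> (a, b) (lam \<sigma>)"
      using nontree[of a b x] by (simp add: tree')
  next
    fix a x assume "a \<in> B" "a \<noteq> t" "(a, t) \<notin> tree \<sigma>'" "x \<in> I"
    then show "res \<sigma> (a, t) x = 0"
      using nontree_sink[of a x] by (simp add: tree')
  next
    fix v assume v: "v \<in> B" "0 < res \<sigma> (s, v) (lam \<sigma>)"
    then show "enat (card B) \<le> label \<sigma>' v"
      using source_res[OF v] inc by (auto simp: label' intro: order_trans)
  next
    show "{} \<subseteq> tree \<sigma>'" by simp
  next
    show "res \<sigma> (a, t) (lam \<sigma>) = 0" if "(a, t) \<in> {}" for a
      using that by simp
  qed (fact source_net sink_net lmax_net edges_net_sub side_sub sink_in edges_net cap_inner cap_source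
      cap_out flow_out lam_ge lam_le flow_antisym flow_cont excess_cont conservation excess_lam
      excess_unmodified modified_sub feasible pointer' inflow_le_cut bp_side bp_out good_past)+
qed

text \<open>The residual capacity from the source to \<open>b\<close> gains that from
  \<open>u\<close>, which by \<open>far\<close> is positive only at labels of at least
  \<open>card B - 1\<close>, the size of the new sink side; this yields \<open>source_res\<close>.
  As \<open>u\<close> has no tree edges left, merged residual capacities are sums of two
  constants.\<close>

lemma contract_preserves:
  assumes u: "u \<in> orphans \<sigma>" and F: "F = {}" and into: "\<And>v. (v, u) \<notin> tree \<sigma>"
    and far: "\<And>v. residual \<sigma> u v \<Longrightarrow> enat (card B - 1) \<le> label \<sigma> v"
  shows "pbfs_inv G adj (contract_vertex u \<sigma>) {}"
    and "sink_side (contract_vertex u \<sigma>) = B - {u}"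
    and "a \<in> B - {u} \<Longrightarrow> admissible (contract_vertex u \<sigma>) a b \<Longrightarrow> admissible \<sigma> a b"
proof -
  let ?\<sigma> = "contract_vertex u \<sigma>"
  have u_facts: "u \<in> B" "u \<noteq> t" "u \<noteq> s"
    using u orphans_sub modified_sub source_notin by auto
  have u_tree: "(u, v) \<notin> tree \<sigma>" for v
    using tree_facts(4) u by blast
  have upd: "net ?\<sigma> = contract (net \<sigma>) {u}" "flow ?\<sigma> = merge (net \<sigma>) {u} (flow \<sigma>)"
    "excess ?\<sigma> = excess \<sigma>" "modified ?\<sigma> = modified \<sigma> - {u}" "tree ?\<sigma> = tree \<sigma>" "label ?\<sigma> = label \<sigma>"
    "current ?\<sigma> = current \<sigma>" "limit ?\<sigma> = limit \<sigma>" "bp ?\<sigma> = (bp \<sigma>)(u := ereal (lam \<sigma>))"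
    "orphans ?\<sigma> = orphans \<sigma> - {u}" "lam ?\<sigma> = lam \<sigma>"
    by (simp_all add: contract_vertex_def)
  show side: "sink_side ?\<sigma> = B - {u}"
    using source_net by (auto simp: sink_side_def upd)
  have card_side: "card (B - {u}) = card B - 1"
    using u_facts by simp
  have outside: "a \<notin> insert (source (net \<sigma>)) {u}" if "a \<in> B - {u}" for a
    using that source_notin source_net by auto
  have flow_in: "flow ?\<sigma> (a, b) x = flow \<sigma> (a, b) x" if "a \<in> B - {u}" "b \<in> B - {u}" for a b x
    using merge_inner[OF outside[OF that(1)] outside[OF that(2)]] flow_out[of "(a, b)" x] that source_notin
    by (auto simp: upd)
  have cap_in: "cap (net ?\<sigma>) (a, b) x = cap (net \<sigma>) (a, b) x" if "a \<in> B - {u}" "b \<in> B - {u}" for a b x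
    using merge_inner[OF outside[OF that(1)] outside[OF that(2)]] cap_out[of "(a, b)" x] that source_notin
    by (auto simp: upd)
  have source_sum: "merge (net \<sigma>) {u} g (s, b) x = g (s, b) x + g (u, b) x"
    if "b \<in> B - {u}" "\<And>e. e \<notin> edges (net \<sigma>) \<Longrightarrow> e \<noteq> (s, s) \<Longrightarrow> g e x = 0" for g b x
    using merge_source[OF outside[OF that(1)], of g x] that u_facts source_notin
    by (auto simp: source_net)
  have to_source_sum: "merge (net \<sigma>) {u} g (b, s) x = g (b, s) x + g (b, u) x"
    if "b \<in> B - {u}" "\<And>e. e \<notin> edges (net \<sigma>) \<Longrightarrow> e \<noteq> (s, s) \<Longrightarrow> g e x = 0" for g b x
    using merge_to_source[OF outside[OF that(1)], of g x] that u_facts source_notin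
    by (auto simp: source_net)
  have flow_s: "flow ?\<sigma> (s, b) x = flow \<sigma> (s, b) x + flow \<sigma> (u, b) x"
    and flow_to_s: "flow ?\<sigma> (b, s) x = flow \<sigma> (b, s) x + flow \<sigma> (b, u) x"
    and cap_s: "cap (net ?\<sigma>) (s, b) x = cap (net \<sigma>) (s, b) x + cap (net \<sigma>) (u, b) x"
    if "b \<in> B - {u}" for b x
    using source_sum[OF that, of "flow \<sigma>" x] to_source_sum[OF that, of "flow \<sigma>" x]
      source_sum[OF that, of "cap (net \<sigma>)" x]
    by (simp_all add: upd flow_out cap_out)
  have res_in: "res ?\<sigma> (a, b) x = res \<sigma> (a, b) x" if "a \<in> B - {u}" "b \<in> B - {u}" for a b x
    by (simp add: res_def flow_in[OF that] cap_in[OF that])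
  have res_s: "res ?\<sigma> (s, b) x = res \<sigma> (s, b) x + res \<sigma> (u, b) x" if "b \<in> B - {u}" for b x
    by (simp add: res_def flow_s[OF that] cap_s[OF that])
  have inflow: "inflow ?\<sigma> b x = inflow \<sigma> b x" if "b \<in> B - {u}" for b x
  proof -
    have "inflow ?\<sigma> b x = flow ?\<sigma> (s, b) x + (\<Sum>a\<in>B - {u}. flow ?\<sigma> (a, b) x)"
      using finite_B source_notin by (simp add: inflow_def side upd(1) source_net)
    also have "(\<Sum>a\<in>B - {u}. flow ?\<sigma> (a, b) x) = (\<Sum>a\<in>B - {u}. flow \<sigma> (a, b) x)"
      by (intro sum.cong refl flow_in that)
    also have "flow ?\<sigma> (s, b) x + \<dots> = flow \<sigma> (s, b) x + (\<Sum>a\<in>B. flow \<sigma> (a, b) x)"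
      using sum.remove[OF finite_B u_facts(1), of "\<lambda>a. flow \<sigma> (a, b) x"] by (simp add: flow_s[OF that])
    also have "\<dots> = inflow \<sigma> b x"
      using finite_B source_notin by (simp add: inflow_eq)
    finally show ?thesis .
  qed
  have tree_in: "a \<in> B - {u}" "b \<in> B - {u}" if "(a, b) \<in> tree \<sigma>" for a b
    using tree_facts(1,2)[OF that] that into u_tree by auto
  have u_res: "enat (card B - 1) \<le> label \<sigma> b" if "b \<in> B - {u}" "0 < res \<sigma> (u, b) (lam \<sigma>)" for b
    using that by (intro far) (simp add: residual_iff_res)
  have residual': "residual ?\<sigma> a b \<longleftrightarrow> b \<in> B - {u} \<and> b \<noteq> a \<and> 0 < res \<sigma> (a, b) (lam \<sigma>)"
    if "a \<in> B - {u}" for a b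
  proof (cases "b \<in> B - {u}")
    case True
    then have "(a, b) \<in> edges (net \<sigma>)" if "0 < res \<sigma> (a, b) (lam \<sigma>)"
      using that res_out[of "(a, b)" "lam \<sigma>"] source_notin by force
    then show ?thesis
      using edges_contract_inner[OF outside[OF \<open>a \<in> B - {u}\<close>] outside[OF True]] True that
      by (auto simp: residual_iff side res_in upd(1,11))
  qed (auto simp: residual_iff side)
  have admissible': "admissible ?\<sigma> a b \<Longrightarrow> admissible \<sigma> a b" if "a \<in> B - {u}" for a b
    using that by (auto simp: admissible_def residual' residual_iff_res upd)
  then show "a \<in> B - {u} \<Longrightarrow> admissible ?\<sigma> a b \<Longrightarrow> admissible \<sigma> a b" .
  have V_diff: "V - (B - {u}) = insert u A"
    using u_facts side_sub by auto
  show "pbfs_inv G adj ?\<sigma> {}"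
  proof (unfold_locales, unfold side upd(3-))
    show "source (net ?\<sigma>) = s" "sink (net ?\<sigma>) = t" "lmax (net ?\<sigma>) = lmax G"
      by (simp_all add: upd source_net sink_net lmax_net)
    show "edges (net ?\<sigma>) \<subseteq> insert s (B - {u}) \<times> insert s (B - {u})"
      using edges_contract_subset[of "net \<sigma>" B "{u}"] edges_net_sub by (simp add: upd(1) source_net)
    show "B - {u} \<subseteq> V" "t \<in> B - {u}"
      using side_sub sink_in u_facts by auto
  next
    fix a b assume "a \<in> B - {u}" "b \<in> B - {u}"
    then show "(a, b) \<in> edges (net ?\<sigma>) \<longleftrightarrow> (a, b) \<in> edges G"
      using edges_contract_inner[OF outside outside] edges_net by (simp add: upd(1))
  next
    fix a b x assume "a \<in> B - {u}" "b \<in> B - {u}"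
    then show "cap (net ?\<sigma>) (a, b) x = c a b x"
      by (simp add: cap_in cap_inner)
  next
    fix b x assume b: "b \<in> B - {u}"
    then show "cap (net ?\<sigma>) (s, b) x = (\<Sum>a\<in>V - (B - {u}). c a b x)"
      using u_facts finite_V by (simp add: cap_s[OF b] V_diff cap_source cap_inner)
  next
    fix e x assume "e \<notin> edges (net ?\<sigma>)" "e \<noteq> (s, s)"
    then show "cap (net ?\<sigma>) e x = 0" "flow ?\<sigma> e x = 0"
      using merge_outside[of e "net \<sigma>" "{u}"] by (simp_all add: upd(1,2) source_net)
  next
    fix a b x assume a: "a \<in> insert s (B - {u})" and b: "b \<in> B - {u}" and x: "x \<in> I"
    show "flow ?\<sigma> (b, a) x = - flow ?\<sigma> (a, b) x"
      using a flow_antisym[of a b x] flow_antisym[of u b x] flow_antisym[of s b x] b x u_facts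
      by (cases "a = s") (simp_all add: flow_s flow_to_s flow_in)
  next
    fix a b assume ab: "a \<in> B - {u}" "b \<in> B - {u}"
    then have "flow ?\<sigma> (a, b) = flow \<sigma> (a, b)"
      using flow_in by blast
    then show "continuous_on I (flow ?\<sigma> (a, b))"
      using flow_cont ab by simp
  next
    fix a x assume "a \<in> B - {u}" "a \<noteq> t" "x \<in> I"
    then show "inflow ?\<sigma> a x = excess \<sigma> a x"
      using conservation by (simp add: inflow)
  next
    fix e assume e: "e \<in> tree \<sigma> - {}"
    then show "0 < res ?\<sigma> e (lam \<sigma>)"
      using tree_res[of e] tree_in by (cases e) (auto simp: res_in F)
  next
    fix e assume e: "e \<in> tree \<sigma> - {}" "fst e \<notin> modified \<sigma> - {u}"
    obtain a b where ab: "e = (a, b)" by force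
    then have "a \<in> B - {u}" "b \<in> B - {u}"
      using tree_in e by auto
    then have "limit_correct \<sigma> e" "res ?\<sigma> e = res \<sigma> e"
      using tree_limit[of e] e res_in by (auto simp: ab F)
    then show "limit_correct ?\<sigma> e"
      by (simp add: limit_correct_def upd)
  next
    fix a b assume a: "a \<in> insert s (B - {u})" "a \<noteq> t" and b: "b \<in> B - {u}"
    show "0 \<le> res ?\<sigma> (a, b) (lam \<sigma>)"
      using a feasible[of a b] feasible[of s b] feasible[of u b] u_facts s_neq_t b
      by (cases "a = s") (auto simp: res_s res_in)
  next
    fix a b x assume a: "a \<in> insert s (B - {u})" "a \<noteq> t" and b: "b \<in> B - {u}"
      and nt: "(a, b) \<notin> tree \<sigma>" "(b, a) \<notin> tree \<sigma>" and x: "x \<in> I"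
    have "(s, b) \<notin> tree \<sigma>" "(b, s) \<notin> tree \<sigma>"
      using tree_sub source_notin by auto
    then show "res ?\<sigma> (a, b) x = res ?\<sigma> (a, b) (lam \<sigma>)"
      using a nt nontree[of a b x] nontree[of s b x] nontree[of u b x] u_facts s_neq_t b x u_tree into
      by (cases "a = s") (auto simp: res_s res_in)
  next
    fix a x assume "a \<in> B - {u}" "a \<noteq> t" "(a, t) \<notin> tree \<sigma>" "x \<in> I"
    then show "res ?\<sigma> (a, t) x = 0"
      using nontree_sink[of a x] sink_in u_facts by (simp add: res_in)
  next
    fix b assume b: "b \<in> B - {u}" "0 < res ?\<sigma> (s, b) (lam \<sigma>)"
    then have "0 < res \<sigma> (s, b) (lam \<sigma>) \<or> 0 < res \<sigma> (u, b) (lam \<sigma>)"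
      by (simp add: res_s) linarith
    moreover have "enat (card B - 1) \<le> enat (card B)"
      by simp
    ultimately have "enat (card B - 1) \<le> label \<sigma> b"
      using source_res[of b] u_res[of b] b order_trans by blast
    then show "enat (card (B - {u})) \<le> label \<sigma> b"
      by (simp only: card_side)
  next
    fix X assume "X \<subseteq> V" "s \<in> X" "t \<notin> X"
    then show "inflow ?\<sigma> t (lam \<sigma>) \<le> cut X (lam \<sigma>)"
      using inflow_le_cut sink_in u_facts by (simp add: inflow)
  next
    fix v assume "v \<in> B - {u}"
    then show "((bp \<sigma>)(u := ereal (lam \<sigma>))) v = \<infinity>"
      using bp_side by simp
  next
    fix v assume "v \<in> V - (B - {u})"
    then show "\<exists>r\<in>{lmin G..lam \<sigma>}. ((bp \<sigma>)(u := ereal (lam \<sigma>))) v = ereal r"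
      using bp_out lam_ge by (cases "v = u") auto
  next
    fix x assume x: "lmin G \<le> x" "x < lam \<sigma>"
    \<comment> \<open>The breakpoint of \<open>u\<close> changes from infinity to
      \<open>lam\<close>, and both exceed \<open>x\<close>.\<close>
    have "{v \<in> V. ((bp \<sigma>)(u := ereal (lam \<sigma>))) v \<le> ereal x} = {v \<in> V. bp \<sigma> v \<le> ereal x}"
      "{v \<in> V. ereal x < ((bp \<sigma>)(u := ereal (lam \<sigma>))) v} = {v \<in> V. ereal x < bp \<sigma> v}"
      using x bp_side[OF u_facts(1)] by auto
    then show "good_cut ((bp \<sigma>)(u := ereal (lam \<sigma>))) x"
      using good_past[OF x] by (simp only: good_cut_def)
  next
    fix a k assume "a \<in> B - {u}" "a \<noteq> t" "k < current \<sigma> a" "k < length (adj a)"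
    then show "\<not> admissible ?\<sigma> a (adj a ! k)"
      using pointer[of a k] admissible' by blast
  next
    fix a b assume "a \<in> B - {u}" "a \<noteq> t" "b \<in> B - {u}" "0 < res ?\<sigma> (a, b) (lam \<sigma>)"
    then show "label \<sigma> a \<le> label \<sigma> b + 1"
      using valid by (simp add: res_in)
  next
    show "tree \<sigma> \<subseteq> (B - {u}) \<times> (B - {u})"
      using tree_in by auto
    show "Domain (tree \<sigma>) = B - {u} - {t} - (orphans \<sigma> - {u})"
      using tree_dom u by auto
    show "modified \<sigma> - {u} \<subseteq> B - {u}" "orphans \<sigma> - {u} \<subseteq> modified \<sigma> - {u} - {t}"
      using modified_sub orphans_sub by auto
    show "{} \<subseteq> tree \<sigma>" by simp
    show "res ?\<sigma> (a, t) (lam \<sigma>) = 0" if "(a, t) \<in> {}" for a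
      using that by simp
    show "continuous_on I (excess \<sigma> v)" if "v \<in> B - {u}" for v
      using excess_cont that by simp
    show "excess \<sigma> v (lam \<sigma>) = 0" if "v \<in> B - {u}" "v \<noteq> t" for v
      using excess_lam that by simp
    show "excess \<sigma> v x = 0" if "v \<in> B - {u}" "v \<noteq> t" "v \<notin> modified \<sigma> - {u}" "x \<in> I" for v x
      using excess_unmodified[of v x] that by simp
    show "label \<sigma> v < enat (card V)" if "v \<in> B - {u}" for v
      using label_bound that by simp
  qed (fact lam_ge lam_le tree_edges tree_sv tree_label label_sink)+
qed

end

section \<open>Between two breakpoints\<close>

locale pbfs_adopted = pbfs_inv G adj \<sigma> "{}"
  for G :: "'v pnetwork" and adj :: "'v \<Rightarrow> 'v list" and \<sigma> :: "'v pbfs_state" +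
  assumes no_orphans: "orphans \<sigma> = {}"
begin

lemma parent:
  assumes "u \<in> B" "u \<noteq> t"
  obtains v where "(u, v) \<in> tree \<sigma>" "v \<in> B" "label \<sigma> u = label \<sigma> v + 1"
proof -
  have "u \<in> Domain (tree \<sigma>)"
    using assms by (simp add: tree_dom no_orphans)
  then obtain v where "(u, v) \<in> tree \<sigma>"
    by auto
  then show ?thesis
    using that tree_facts tree_label by blast
qed

text \<open>Sharper than \<open>label_bound\<close>: the bound is the size of the current sink side,
  which is exactly the threshold in \<open>source_res\<close>.\<close>

lemma label_less_card:
  assumes "v \<in> B"
  shows "label \<sigma> v < enat (card B)"
proof (rule label_chain_bound[where t = t])
  show "finite B" "label \<sigma> t = 0" "v \<in> B"
    using finite_B label_sink assms by auto
  show "label \<sigma> v \<noteq> \<infinity>" if "v \<in> B" for v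
    using label_bound[OF that] by (cases "label \<sigma> v") auto
  show "\<exists>w\<in>B. label \<sigma> v = label \<sigma> w + 1" if "v \<in> B - {t}" for v
    using parent[of v] that by blast
qed

text \<open>Saturation at \<open>lam\<close> extends to all of \<open>I\<close>: no tree edge meets
  the source, so the residual capacities of its edges are constant.\<close>

lemma source_saturated:
  assumes v: "v \<in> B" and x: "x \<in> I"
  shows "res \<sigma> (s, v) x = 0"
proof -
  have "\<not> 0 < res \<sigma> (s, v) (lam \<sigma>)"
    using source_res[OF v] label_less_card[OF v] by auto
  moreover have "0 \<le> res \<sigma> (s, v) (lam \<sigma>)"
    using feasible v s_neq_t by blast
  moreover have "res \<sigma> (s, v) x = res \<sigma> (s, v) (lam \<sigma>)"
    using tree_sub source_notin s_neq_t v x by (intro nontree) auto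
  ultimately show ?thesis
    by simp
qed

end

section \<open>Monotone flows, residual capacities and cuts after draining\<close>

locale pbfs_drained = pbfs_adopted G adj \<sigma>
  for G :: "'v pnetwork" and adj :: "'v \<Rightarrow> 'v list" and \<sigma> :: "'v pbfs_state" +
  assumes drained: "modified \<sigma> \<subseteq> {t}"
begin

lemma inflow_zero: "v \<in> B \<Longrightarrow> v \<noteq> t \<Longrightarrow> x \<in> I \<Longrightarrow> inflow \<sigma> v x = 0"
  using conservation[of v x] excess_unmodified[of v x] drained by auto

lemma limit_correct_tree: "e \<in> tree \<sigma> \<Longrightarrow> limit_correct \<sigma> e"
  using tree_limit[of e] tree_facts(3) drained by (cases e) auto

lemma limit_gt_lam: "e \<in> tree \<sigma> \<Longrightarrow> ereal (lam \<sigma>) < limit \<sigma> e"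
  using limit_correct_tree[of e] by (auto simp: limit_correct_def)

lemma tree_res_pos:
  assumes "e \<in> tree \<sigma>" "x \<in> I" "ereal x < limit \<sigma> e"
  shows "0 < res \<sigma> e x"
  using limit_correct_tree[OF assms(1)] assms(2,3) by (auto simp: limit_correct_def lmax_net)

lemma tree_res_limit:
  assumes "e \<in> tree \<sigma>" "limit \<sigma> e = ereal x"
  shows "res \<sigma> e x = 0"
  using limit_correct_tree[OF assms(1)] assms(2) by (auto simp: limit_correct_def)

lemma tree_flow_mono:
  assumes "(u, v) \<in> tree \<sigma>" "x \<in> I" "y \<in> I" "x \<le> y"
  shows "flow \<sigma> (u, v) x \<le> flow \<sigma> (u, v) y"
  using assms(1)
\<comment> \<open>Children carry larger labels, and labels are below \<open>card V\<close>, so this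
  number decreases towards the leaves.\<close>
proof (induction "card V - the_enat (label \<sigma> u)" arbitrary: u v rule: less_induct)
  case less
  note uv = tree_facts[OF less.prems]
  have flow_sum: "flow \<sigma> (u, v) z = (\<Sum>w\<in>insert s B - {v}. flow \<sigma> (w, u) z)" if z: "z \<in> I" for z
  proof -
    have "(\<Sum>w\<in>insert s B. flow \<sigma> (w, u) z) = 0"
      using inflow_zero[OF uv(1,3) z] by (simp add: inflow_eq)
    moreover have "(\<Sum>w\<in>insert s B. flow \<sigma> (w, u) z) =
        flow \<sigma> (v, u) z + (\<Sum>w\<in>insert s B - {v}. flow \<sigma> (w, u) z)"
      using uv finite_B by (intro sum.remove) auto
    moreover have "flow \<sigma> (v, u) z = - flow \<sigma> (u, v) z"
      using flow_antisym[of u v z] uv z by simp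
    ultimately show ?thesis by simp
  qed
  have "flow \<sigma> (w, u) x \<le> flow \<sigma> (w, u) y" if w: "w \<in> insert s B - {v}" for w
  proof -
    \<comment> \<open>Inflow from the source follows non-decreasing capacities, inflow from children
      is covered by induction, inflow from the sink is the negative of a saturated non-increasing
      capacity, and all other inflow is constant.\<close>
    consider (source) "w = s" | (child) "(w, u) \<in> tree \<sigma>" | (sink) "w = t"
      | (other) "w \<in> B" "w \<noteq> t" "(w, u) \<notin> tree \<sigma>"
      using w by auto
    then show ?thesis
    proof cases
      case source
      have "(\<Sum>a\<in>A. c a u x) \<le> (\<Sum>a\<in>A. c a u y)"
        using uv assms(2-4) by (intro sum_mono c_mono I_sub) auto
      then show ?thesis
        using source_saturated[OF uv(1) assms(2)] source_saturated[OF uv(1) assms(3)]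
        by (simp add: res_def source cap_source[OF uv(1)])
    next
      case child
      obtain k where k: "label \<sigma> u = enat k" "k < card V"
        using label_bound[OF uv(1)] by (cases "label \<sigma> u") auto
      then have "label \<sigma> w = enat (Suc k)"
        using tree_label[OF child] by (simp add: one_enat_def)
      then show ?thesis
        using k by (intro less.hyps child) simp
    next
      case sink
      have "(u, t) \<notin> tree \<sigma>"
        using less.prems w sink tree_sv by (auto dest: single_valuedD)
      then have "flow \<sigma> (u, t) z = c u t z" if "z \<in> I" for z
        using nontree_sink[OF uv(1,3) _ that] by (simp add: res_def cap_inner uv(1) sink_in)
      moreover have "c u t y \<le> c u t x"
        using c_antimono[of u x y t] assms(2-4) uv(1) source_notin I_sub by blast
      moreover have "flow \<sigma> (t, u) z = - flow \<sigma> (u, t) z" if "z \<in> I" for z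
        using flow_antisym[of u t z] that uv(1) sink_in by simp
      ultimately show ?thesis
        using assms(2,3) by (simp add: sink)
    next
      case other
      have "(u, w) \<notin> tree \<sigma>"
        using less.prems w tree_sv by (auto dest: single_valuedD)
      then have "res \<sigma> (w, u) x = res \<sigma> (w, u) (lam \<sigma>)" "res \<sigma> (w, u) y = res \<sigma> (w, u) (lam \<sigma>)"
        using nontree[of w u] other uv(1) assms(2,3) by blast+
      moreover have "c w u x = c w u y"
        using c_const[of w u x y] other source_notin uv(3) I_sub[OF assms(2)] I_sub[OF assms(3)] by blast
      ultimately show ?thesis
        using other(1) uv(1) by (simp add: res_def cap_inner)
    qed
  qed
  then show ?case
    unfolding flow_sum[OF assms(2)] flow_sum[OF assms(3)] by (rule sum_mono)
qed

text \<open>The flow on the reversal falls as the tree edge fills up, while its capacity is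
  constant, as it neither leaves the source nor enters the sink.\<close>

lemma reverse_tree_res_mono:
  assumes "(b, a) \<in> tree \<sigma>" "x \<in> I" "a \<noteq> t"
  shows "res \<sigma> (a, b) (lam \<sigma>) \<le> res \<sigma> (a, b) x"
proof -
  note ba = tree_facts[OF assms(1)]
  have "flow \<sigma> (b, a) (lam \<sigma>) \<le> flow \<sigma> (b, a) x"
    using tree_flow_mono[OF assms(1) lam_I assms(2)] assms(2) by simp
  moreover have "flow \<sigma> (a, b) z = - flow \<sigma> (b, a) z" if "z \<in> I" for z
    using flow_antisym[of b a z] ba that by simp
  moreover have "c a b x = c a b (lam \<sigma>)"
    using c_const[of a b x "lam \<sigma>"] ba source_notin I_sub[OF assms(2)] I_sub[OF lam_I] by blast
  ultimately show ?thesis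
    using assms(2) lam_I by (simp add: res_def cap_inner ba)
qed

text \<open>Within \<open>B\<close> and away from the sink, only the reversal of a tree edge can
  become residual as the parameter grows. Such a reversal leads to a larger label, so it is never
  admissible and respects \<open>valid\<close>.\<close>

lemma residual_shrinks:
  assumes "a \<in> B" "a \<noteq> t" "b \<in> B" "x \<in> I" "0 < res \<sigma> (a, b) x" "(b, a) \<notin> tree \<sigma>"
  shows "0 < res \<sigma> (a, b) (lam \<sigma>)"
  using nontree[of a b x] tree_res[of "(a, b)"] assms by (cases "(a, b) \<in> tree \<sigma>") auto

lemma feasible_at:
  assumes x: "x \<in> I" and below: "\<And>e. e \<in> tree \<sigma> \<Longrightarrow> ereal x \<le> limit \<sigma> e"
    and ab: "a \<in> insert s B" "a \<noteq> t" "b \<in> B"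
  shows "0 \<le> res \<sigma> (a, b) x"
proof -
  consider "(a, b) \<in> tree \<sigma>" | "(b, a) \<in> tree \<sigma>" | "(a, b) \<notin> tree \<sigma>" "(b, a) \<notin> tree \<sigma>"
    by auto
  then show ?thesis
  proof cases
    case 1
    then show ?thesis
      using below[OF 1] tree_res_pos[OF 1 x] tree_res_limit[OF 1, of x]
      by (cases "ereal x = limit \<sigma> (a, b)") (auto simp: less_le)
  next
    case 2
    then show ?thesis
      using reverse_tree_res_mono[OF 2 x ab(2)] feasible[OF ab] by simp
  next
    case 3
    then show ?thesis
      using nontree[OF ab 3 x] feasible[OF ab] by simp
  qed
qed

text \<open>For source sides containing \<open>A\<close>, the contracted network sees the whole cut:
  merged capacities out of the source add up to those out of \<open>A\<close>. The gap between
  capacity and flow value is then the residual capacity across the cut.\<close>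

lemma cut_minus_inflow:
  assumes x: "x \<in> I" and X: "X \<subseteq> V" "A \<subseteq> X" "t \<notin> X"
  shows "cut X x - inflow \<sigma> t x = (\<Sum>a\<in>insert s (B \<inter> X). \<Sum>b\<in>V - X. res \<sigma> (a, b) x)"
proof -
  have YB: "V - X \<subseteq> B"
    using X by auto
  have un: "insert s (B \<inter> X) \<union> (V - X) = insert s B"
    using X side_sub by auto
  have flow_cut: "(\<Sum>a\<in>insert s (B \<inter> X). \<Sum>b\<in>V - X. flow \<sigma> (a, b) x) =
      (\<Sum>a\<in>insert s (B \<inter> X) \<union> (V - X). flow \<sigma> (a, t) x)"
  proof (rule sum_cut_antisymmetric)
    show "insert s (B \<inter> X) \<inter> (V - X) = {}"
      using YB source_notin by auto
    show "flow \<sigma> (v, u) x = - flow \<sigma> (u, v) x" if "u \<in> V - X" "v \<in> V - X" for u v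
      using flow_antisym[of u v x] that YB x by blast
    show "(\<Sum>u\<in>insert s (B \<inter> X) \<union> (V - X). flow \<sigma> (u, v) x) = 0" if "v \<in> V - X - {t}" for v
      unfolding un inflow_eq[symmetric] using inflow_zero[of v x] that YB x by blast
  qed (use finite_B finite_V t_V X in auto)
  have cap_b: "(\<Sum>a\<in>insert s (B \<inter> X). cap (net \<sigma>) (a, b) x) = (\<Sum>a\<in>X. c a b x)" if b: "b \<in> V - X" for b
  proof -
    have "b \<in> B"
      using YB b by auto
    have "(\<Sum>a\<in>insert s (B \<inter> X). cap (net \<sigma>) (a, b) x) =
        (\<Sum>a\<in>A. c a b x) + (\<Sum>a\<in>B \<inter> X. cap (net \<sigma>) (a, b) x)"
      using finite_B source_notin \<open>b \<in> B\<close> by (simp add: cap_source)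
    also have "(\<Sum>a\<in>B \<inter> X. cap (net \<sigma>) (a, b) x) = (\<Sum>a\<in>B \<inter> X. c a b x)"
      using \<open>b \<in> B\<close> by (intro sum.cong) (auto simp: cap_inner)
    also have "(\<Sum>a\<in>A. c a b x) + \<dots> = (\<Sum>a\<in>A \<union> (B \<inter> X). c a b x)"
      using finite_B finite_V by (intro sum.union_disjoint[symmetric]) auto
    also have "A \<union> (B \<inter> X) = X"
      using X by auto
    finally show ?thesis .
  qed
  have "(\<Sum>a\<in>insert s (B \<inter> X). \<Sum>b\<in>V - X. cap (net \<sigma>) (a, b) x) =
      (\<Sum>b\<in>V - X. \<Sum>a\<in>insert s (B \<inter> X). cap (net \<sigma>) (a, b) x)"
    by (rule sum.swap)
  also have "\<dots> = (\<Sum>b\<in>V - X. \<Sum>a\<in>X. c a b x)"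
    by (intro sum.cong refl cap_b)
  also have "\<dots> = cut X x"
    unfolding cut_def by (rule sum.swap)
  finally have "(\<Sum>a\<in>insert s (B \<inter> X). \<Sum>b\<in>V - X. cap (net \<sigma>) (a, b) x) = cut X x" .
  then show ?thesis
    using flow_cut by (simp only: res_def sum_subtractf un inflow_eq)
qed

lemma cut_A: "x \<in> I \<Longrightarrow> cut A x = inflow \<sigma> t x"
proof -
  assume x: "x \<in> I"
  have "cut A x - inflow \<sigma> t x = (\<Sum>a\<in>insert s (B \<inter> A). \<Sum>b\<in>V - A. res \<sigma> (a, b) x)"
    using sink_in by (intro cut_minus_inflow x) auto
  also have "\<dots> = (\<Sum>b\<in>V - A. res \<sigma> (s, b) x)"
    by simp
  also have "\<dots> = 0"
    using source_saturated x by (intro sum.neutral) auto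
  finally show ?thesis by simp
qed

lemma inflow_le_cut_above:
  assumes "x \<in> I" "\<And>e. e \<in> tree \<sigma> \<Longrightarrow> ereal x \<le> limit \<sigma> e" "X \<subseteq> V" "A \<subseteq> X" "t \<notin> X"
  shows "inflow \<sigma> t x \<le> cut X x"
proof -
  have "0 \<le> (\<Sum>a\<in>insert s (B \<inter> X). \<Sum>b\<in>V - X. res \<sigma> (a, b) x)"
    using assms s_neq_t by (intro sum_nonneg feasible_at) auto
  then show ?thesis
    using cut_minus_inflow[OF assms(1,3-5)] by simp
qed

text \<open>A source side inside \<open>A\<close> consists of contracted vertices, between which
  flow is no longer recorded. What is kept about it is \<open>inflow_le_cut\<close> at
  \<open>lam\<close>, and \<open>cut_difference_mono\<close> carries that to
  \<open>x\<close>.\<close>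

lemma cut_union_le:
  assumes x: "x \<in> I" and X: "X \<subseteq> V" "s \<in> X" "t \<notin> X"
  shows "cut (X \<union> A) x \<le> cut X x"
proof -
  have "inflow \<sigma> t (lam \<sigma>) \<le> cut (X \<inter> A) (lam \<sigma>)"
    using X s_V source_notin by (intro inflow_le_cut) auto
  moreover have "cut (X \<inter> A) (lam \<sigma>) - cut A (lam \<sigma>) \<le> cut (X \<inter> A) x - cut A x"
    using X x s_V source_notin sink_in I_sub[OF x] I_sub[OF lam_I]
    by (intro cut_difference_mono) auto
  moreover have "cut (X \<union> A) x + cut (X \<inter> A) x \<le> cut X x + cut A x"
    using X I_sub[OF x] by (intro cut_submodular) auto
  ultimately show ?thesis
    using cut_A[OF lam_I] by simp
qed

lemma inflow_le_cut_at:
  assumes "x \<in> I" "\<And>e. e \<in> tree \<sigma> \<Longrightarrow> ereal x \<le> limit \<sigma> e" "X \<subseteq> V" "s \<in> X" "t \<notin> X"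
  shows "inflow \<sigma> t x \<le> cut X x"
proof -
  have "inflow \<sigma> t x \<le> cut (X \<union> A) x"
    using assms sink_in by (intro inflow_le_cut_above) auto
  then show ?thesis
    using cut_union_le[OF assms(1,3-5)] by simp
qed

lemma inflow_less_cut:
  assumes x: "x \<in> I" and below: "\<And>e. e \<in> tree \<sigma> \<Longrightarrow> ereal x < limit \<sigma> e"
    and X: "X \<subseteq> V" "s \<in> X" "t \<notin> X" "\<not> X \<subseteq> A"
  shows "inflow \<sigma> t x < cut X x"
proof -
  \<comment> \<open>A vertex of \<open>X\<close> outside \<open>A\<close> with least label: its
    parent has a smaller label, hence lies outside \<open>X\<close>, and its tree edge crosses the
    cut with positive residual capacity.\<close>
  obtain u where u: "u \<in> B \<inter> X" "\<And>w. w \<in> B \<inter> X \<Longrightarrow> label \<sigma> u \<le> label \<sigma> w"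
  proof -
    have "label \<sigma> ` (B \<inter> X) \<noteq> {}"
      using X by auto
    then obtain k where "k \<in> label \<sigma> ` (B \<inter> X)" "\<And>j. j \<in> label \<sigma> ` (B \<inter> X) \<Longrightarrow> k \<le> j"
      by (metis Inf_lower ex_in_conv wellorder_InfI)
    then show ?thesis
      using that by blast
  qed
  have "u \<noteq> t"
    using u(1) X by auto
  then obtain v where v: "(u, v) \<in> tree \<sigma>" "v \<in> B" "label \<sigma> u = label \<sigma> v + 1"
    using parent u(1) by blast
  obtain k where "label \<sigma> v = enat k"
    using label_bound[OF v(2)] by (cases "label \<sigma> v") auto
  then have "\<not> label \<sigma> u \<le> label \<sigma> v"
    using v(3) by (simp add: one_enat_def)
  then have "v \<notin> X"
    using u(2) v(2) by blast
  have le: "ereal x \<le> limit \<sigma> e" if "e \<in> tree \<sigma>" for e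
    using below[OF that] by simp
  have nonneg: "0 \<le> res \<sigma> (a, b) x" if "a \<in> insert s (B \<inter> (X \<union> A))" "b \<in> V - (X \<union> A)" for a b
    using feasible_at[OF x le, of a b] that s_neq_t X by auto
  have "0 < res \<sigma> (u, v) x"
    using tree_res_pos[OF v(1) x below[OF v(1)]] .
  moreover have "v \<in> V - (X \<union> A)"
    using v(2) \<open>v \<notin> X\<close> side_sub by auto
  ultimately have "0 < (\<Sum>b\<in>V - (X \<union> A). res \<sigma> (u, b) x)"
    using nonneg u(1) finite_V by (intro sum_pos2[of _ v]) auto
  then have "0 < (\<Sum>a\<in>insert s (B \<inter> (X \<union> A)). \<Sum>b\<in>V - (X \<union> A). res \<sigma> (a, b) x)"
    using nonneg u(1) finite_B by (intro sum_pos2[of _ u, OF _ _ _ sum_nonneg]) auto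
  moreover have "cut (X \<union> A) x - inflow \<sigma> t x =
      (\<Sum>a\<in>insert s (B \<inter> (X \<union> A)). \<Sum>b\<in>V - (X \<union> A). res \<sigma> (a, b) x)"
    using X sink_in by (intro cut_minus_inflow x) auto
  ultimately show ?thesis
    using cut_union_le[OF x X(1-3)] by simp
qed

lemma good_cut_at:
  assumes x: "x \<in> I" and below: "\<And>e. e \<in> tree \<sigma> \<Longrightarrow> ereal x < limit \<sigma> e"
  shows "good_cut (bp \<sigma>) x"
proof -
  have "{v \<in> V. bp \<sigma> v \<le> ereal x} = A" "{v \<in> V. bp \<sigma> v > ereal x} = V - A"
  proof -
    have "bp \<sigma> v \<le> ereal x \<longleftrightarrow> v \<notin> B" if "v \<in> V" for v
      using bp_side[of v] bp_out[of v] that x by (cases "v \<in> B") auto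
    then show "{v \<in> V. bp \<sigma> v \<le> ereal x} = A" "{v \<in> V. bp \<sigma> v > ereal x} = V - A"
      by (auto simp: not_le[symmetric])
  qed
  moreover have "is_sink_minimal_min_cut (at_param G x) A (V - A)"
  proof (rule sink_minimal_min_cutI)
    show "A \<subseteq> V" "s \<in> A" "t \<notin> A"
      using s_V source_notin sink_in by auto
    show "cut A x \<le> cut X x" if "X \<subseteq> V" "s \<in> X" "t \<notin> X" for X
      using inflow_le_cut_at[OF x less_imp_le[OF below] that] cut_A[OF x] by simp
    show "X \<subseteq> A" if "X \<subseteq> V" "s \<in> X" "t \<notin> X" "cut X x \<le> cut A x" for X
      using inflow_less_cut[OF x below that(1-3)] that(4) cut_A[OF x] by force
  qed
  ultimately show ?thesis
    by (simp add: good_cut_def)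
qed

text \<open>The tree edges that reach their limit form the pending set; they are saturated at
  \<open>l\<close>, as \<open>F_sink\<close> asks of those into the sink. The other two claims drive
  termination: no edge becomes admissible, and every pending edge ceases to be.\<close>

lemma advance_preserves:
  assumes l: "l \<le> lmax G" and attained: "\<exists>e\<in>tree \<sigma>. limit \<sigma> e = ereal l"
    and below: "\<And>e. e \<in> tree \<sigma> \<Longrightarrow> ereal l \<le> limit \<sigma> e"
  defines "\<sigma>' \<equiv> \<sigma>\<lparr>lam := l, modified := {}\<rparr>"
  shows "pbfs_inv G adj \<sigma>' {e \<in> tree \<sigma>. limit \<sigma> e = ereal l}"
    and "a \<in> B \<Longrightarrow> a \<noteq> t \<Longrightarrow> admissible \<sigma>' a b \<Longrightarrow> admissible \<sigma> a b"
    and "(u, v) \<in> tree \<sigma> \<Longrightarrow> limit \<sigma> (u, v) = ereal l \<Longrightarrow> admissible \<sigma> u v \<and> \<not> admissible \<sigma>' u v"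
proof -
  let ?F = "{e \<in> tree \<sigma>. limit \<sigma> e = ereal l}"
  have lam_l: "lam \<sigma> < l"
    using attained limit_gt_lam by fastforce
  then have sub: "x \<in> I" if "x \<in> {l..lmax G}" for x
    using that by auto
  have lI: "l \<in> I"
    using l lam_l by simp
  have upd: "net \<sigma>' = net \<sigma>" "flow \<sigma>' = flow \<sigma>" "excess \<sigma>' = excess \<sigma>" "modified \<sigma>' = {}" "tree \<sigma>' = tree \<sigma>"
    "label \<sigma>' = label \<sigma>" "current \<sigma>' = current \<sigma>" "limit \<sigma>' = limit \<sigma>" "bp \<sigma>' = bp \<sigma>"
    "orphans \<sigma>' = {}" "lam \<sigma>' = l"
    by (simp_all add: \<sigma>'_def no_orphans)
  have side: "sink_side \<sigma>' = B"
    by (rule sink_side_cong[OF upd(1)])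
  have res: "res \<sigma>' = res \<sigma>"
    by (auto simp: res_def upd fun_eq_iff)
  have inflow: "inflow \<sigma>' = inflow \<sigma>"
    by (auto simp: inflow_def upd side fun_eq_iff)
  have above: "ereal l < limit \<sigma> e" if "e \<in> tree \<sigma> - ?F" for e
    using below[of e] that by (auto simp: less_le)
  have admissible': "admissible \<sigma>' a b \<Longrightarrow> admissible \<sigma> a b" if "a \<in> B" "a \<noteq> t" for a b
  proof -
    assume adm: "admissible \<sigma>' a b"
    then have b: "b \<in> B" "b \<noteq> a" "0 < res \<sigma> (a, b) l" "label \<sigma> a = label \<sigma> b + 1"
      by (auto simp: admissible_def residual_iff side res upd)
    \<comment> \<open>The reversal of a tree edge goes up in the labels, an admissible edge goes
      down; so \<open>residual_shrinks\<close> applies.\<close>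
    have "(b, a) \<notin> tree \<sigma>"
      using tree_label[of b a] b(4) label_bound[OF that(1)] by (cases "label \<sigma> a"; cases "label \<sigma> b") (auto simp: one_enat_def)
    then show "admissible \<sigma> a b"
      using residual_shrinks[OF that b(1) lI b(3)] b by (simp add: admissible_iff)
  qed
  then show "a \<in> B \<Longrightarrow> a \<noteq> t \<Longrightarrow> admissible \<sigma>' a b \<Longrightarrow> admissible \<sigma> a b" .
  show "admissible \<sigma> u v \<and> \<not> admissible \<sigma>' u v" if "(u, v) \<in> tree \<sigma>" "limit \<sigma> (u, v) = ereal l"
    using tree_res_limit[OF that] tree_facts[OF that(1)] tree_label[OF that(1)] tree_res[of "(u, v)"] that(1)
    by (simp add: admissible_iff) (simp add: admissible_def residual_iff res upd)
  show "pbfs_inv G adj \<sigma>' ?F"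
  proof (unfold_locales, unfold side res inflow upd)
    show "lmin G \<le> l"
      using lam_ge lam_l by simp
    show "flow \<sigma> (v, u) x = - flow \<sigma> (u, v) x" if "u \<in> insert s B" "v \<in> B" "x \<in> {l..lmax G}" for u v x
      using flow_antisym that sub by blast
    show "continuous_on {l..lmax G} (flow \<sigma> (u, v))" if "u \<in> B" "v \<in> B" for u v
      using flow_cont[OF that] sub by (rule continuous_on_subset[OF _ subsetI])
    show "continuous_on {l..lmax G} (excess \<sigma> v)" if "v \<in> B" for v
      using excess_cont[OF that] sub by (rule continuous_on_subset[OF _ subsetI])
    show "inflow \<sigma> v x = excess \<sigma> v x" if "v \<in> B" "v \<noteq> t" "x \<in> {l..lmax G}" for v x
      using conservation that sub by blast
    show "excess \<sigma> v x = 0" if "v \<in> B" "v \<noteq> t" "v \<notin> {}" "x \<in> {l..lmax G}" for v x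
      using excess_unmodified[of v x] drained that sub by blast
    show "excess \<sigma> v l = 0" if "v \<in> B" "v \<noteq> t" for v
      using excess_unmodified[of v l] drained that lI by blast
    show "{} \<subseteq> B" "{} \<subseteq> {} - {t}"
      by simp_all
    show "Domain (tree \<sigma>) = B - {t} - {}"
      using tree_dom no_orphans by simp
    show "0 < res \<sigma> e l" if "e \<in> tree \<sigma> - ?F" for e
      using tree_res_pos[of e l] above[OF that] that lI by blast
    show "limit_correct \<sigma>' e" if "e \<in> tree \<sigma> - ?F" "fst e \<notin> {}" for e
      using limit_correct_tree[of e] above[OF that(1)] that(1) lam_l l unfolding limit_correct_def upd res
      by auto
    show "0 \<le> res \<sigma> (u, v) l" if "u \<in> insert s B" "u \<noteq> t" "v \<in> B" for u v
      using feasible_at[OF lI below that] .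
    show "label \<sigma> u \<le> label \<sigma> v + 1" if uv: "u \<in> B" "u \<noteq> t" "v \<in> B" "0 < res \<sigma> (u, v) l" for u v
    proof (cases "(v, u) \<in> tree \<sigma>")
      case True
      then show ?thesis
        using tree_label[OF True] label_bound[OF uv(1)] by (cases "label \<sigma> u") (auto simp: one_enat_def)
    next
      case False
      then show ?thesis
        using residual_shrinks[OF uv(1-3) lI uv(4)] valid uv by blast
    qed
    show "res \<sigma> (u, v) x = res \<sigma> (u, v) l"
      if "u \<in> insert s B" "u \<noteq> t" "v \<in> B" "(u, v) \<notin> tree \<sigma>" "(v, u) \<notin> tree \<sigma>" "x \<in> {l..lmax G}" for u v x
      using nontree[OF that(1-5) sub[OF that(6)]] nontree[OF that(1-5) lI] by simp
    show "res \<sigma> (u, t) x = 0" if "u \<in> B" "u \<noteq> t" "(u, t) \<notin> tree \<sigma>" "x \<in> {l..lmax G}" for u x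
      using nontree_sink that sub by blast
    show "enat (card B) \<le> label \<sigma> v" if "v \<in> B" "0 < res \<sigma> (s, v) l" for v
      using source_saturated[OF that(1) lI] that(2) by simp
    show "\<not> admissible \<sigma>' u (adj u ! k)" if "u \<in> B" "u \<noteq> t" "k < current \<sigma> u" "k < length (adj u)" for u k
      using pointer[OF that] admissible' that by blast
    show "inflow \<sigma> t l \<le> cut X l" if "X \<subseteq> V" "s \<in> X" "t \<notin> X" for X
      using inflow_le_cut_at[OF lI below that] .
    show "\<exists>r\<in>{lmin G..l}. bp \<sigma> v = ereal r" if "v \<in> V - B" for v
      using bp_out[OF that] lam_l by force
    \<comment> \<open>Strictly below \<open>l\<close> all tree edges are still residual, so the
      present cut is the right one. At \<open>l\<close> some are saturated, and the cut is settled
      only after adoption; this is why \<open>good_past\<close> stops short of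
      \<open>lam\<close>.\<close>
    show "good_cut (bp \<sigma>) x" if "lmin G \<le> x" "x < l" for x
    proof (cases "x < lam \<sigma>")
      case True
      then show ?thesis using good_past that by blast
    next
      case False
      have "ereal x < limit \<sigma> e" if "e \<in> tree \<sigma>" for e
      proof -
        have "ereal x < ereal l"
          using \<open>x < l\<close> by simp
        then show ?thesis
          using below[OF that] by (rule less_le_trans)
      qed
      then show ?thesis
        using False that l by (intro good_cut_at) auto
    qed
    show "?F \<subseteq> tree \<sigma>"
      by auto
    show "res \<sigma> (u, t) l = 0" if "(u, t) \<in> ?F" for u
      using tree_res_limit that by blast
  qed (fact source_net sink_net lmax_net edges_net_sub side_sub sink_in edges_net cap_inner cap_source
      cap_out flow_out l tree_sub tree_edges tree_sv tree_label label_bound label_sink bp_side)+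
qed

end

section \<open>Initialization\<close>

context pbfs
begin

text \<open>No residual edge leads from \<open>U\<close> into \<open>Vt\<close>, so all merged edges
  out of the source are saturated at \<open>lmin G\<close> and receive their capacity as flow
  function; their residual capacity is identically zero. The excesses account exactly for the
  deviation from the constant maximum flow, which is conserved.\<close>

lemma init_preserves:
  assumes max: "is_max_flow (at_param G (lmin G)) f0"
    and tree: "shortest_path_in_tree (residual_edges (at_param G (lmin G)) f0) t T"
  shows "pbfs_inv G adj (init_state G f0 T) {}" and "orphans (init_state G f0 T) = {}"
proof -
  let ?\<sigma> = "init_state G f0 T"
  define R where "R = residual_edges (at_param G (lmin G)) f0"
  define Vt where "Vt = {v. (v, t) \<in> R\<^sup>*}"
  define U where "U = V - Vt"
  define N where "N = contract G U"
  define f1 where "f1 = merge G U (\<lambda>e x. f0 e)"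
  define S where "S = {e \<in> edges N. (fst e = s \<or> snd e = t) \<and> f1 e (lmin G) = cap N e (lmin G)}"
  define f2 where "f2 e = (if e \<in> S then cap N e
      else if prod.swap e \<in> S then (\<lambda>x. - cap N (prod.swap e) x) else f1 e)" for e
  have "?\<sigma> = \<lparr>net = N, flow = f2,
      excess = (\<lambda>v x. (if (s, v) \<in> S then cap N (s, v) x - f1 (s, v) x else 0)
        - (if (v, t) \<in> S then cap N (v, t) x - f1 (v, t) x else 0)),
      modified = {v \<in> Vt. (s, v) \<in> S \<or> (v, t) \<in> S}, tree = T, label = bfs_dist R t,
      current = (\<lambda>u. 0),
      limit = (\<lambda>e. if e \<in> T then smallest_root G (lmin G) (\<lambda>x. cap N e x - f2 e x) else \<infinity>),
      bp = (\<lambda>v. if v \<in> Vt then \<infinity> else ereal (lmin G)), orphans = {}, lam = lmin G\<rparr>"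
    by (simp only: init_state_def Let_def f2_def[abs_def] S_def f1_def N_def U_def Vt_def R_def)
  then have init: "net ?\<sigma> = N" "flow ?\<sigma> = f2"
    "excess ?\<sigma> = (\<lambda>v x. (if (s, v) \<in> S then cap N (s, v) x - f1 (s, v) x else 0)
        - (if (v, t) \<in> S then cap N (v, t) x - f1 (v, t) x else 0))"
    "modified ?\<sigma> = {v \<in> Vt. (s, v) \<in> S \<or> (v, t) \<in> S}" "tree ?\<sigma> = T" "label ?\<sigma> = bfs_dist R t"
    "current ?\<sigma> = (\<lambda>u. 0)"
    "limit ?\<sigma> = (\<lambda>e. if e \<in> T then smallest_root G (lmin G) (\<lambda>x. cap N e x - f2 e x) else \<infinity>)"
    "bp ?\<sigma> = (\<lambda>v. if v \<in> Vt then \<infinity> else ereal (lmin G))" "orphans ?\<sigma> = {}" "lam ?\<sigma> = lmin G"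
    by simp_all
  show "orphans ?\<sigma> = {}"
    by (rule init)
  note [simp] = lmin_le_lmax
  have I_lmin: "lmin G \<in> {lmin G..lmax G}"
    by simp
  have net0: "flow_network (at_param G (lmin G))"
    by (rule network) simp
  have f0: "is_flow (at_param G (lmin G)) f0"
    using max by (simp add: is_max_flow_def)
  have RE: "R \<subseteq> edges G"
    by (auto simp: R_def residual_edges_def)
  have Vt_V: "Vt \<subseteq> V"
  proof
    fix v assume "v \<in> Vt"
    then have "(v, t) \<in> R\<^sup>*"
      by (simp add: Vt_def)
    then show "v \<in> V"
      by (cases rule: converse_rtranclE) (use RE E_sub t_V in auto)
  qed
  have t_Vt: "t \<in> Vt"
    by (simp add: Vt_def)
  have s_Vt: "s \<notin> Vt"
    using max_flow_no_augmenting_walk[OF net0 max] by (simp add: Vt_def R_def)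
  then have s_U: "insert s U = U"
    using s_V by (auto simp: U_def)
  have fin: "finite Vt" "finite U"
    using Vt_V finite_V finite_subset by (auto simp: U_def)
  have V_split: "V = U \<union> Vt" "U \<inter> Vt = {}"
    using Vt_V by (auto simp: U_def)
  have out: "a \<notin> insert (source G) U" if "a \<in> Vt" for a
    using that s_U V_split by auto
  have side: "sink_side ?\<sigma> = Vt"
    using s_Vt Vt_V by (auto simp: sink_side_def init N_def U_def)
  define g where "g a b = (if (a, b) \<in> edges G then f0 (a, b) else 0)" for a b
  have g_anti: "g b a = - g a b" for a b
    using f0 E_swap[of a b] by (auto simp: g_def is_flow_def)
  have g_le: "g a b \<le> c a b (lmin G)" for a b
    using f0 by (auto simp: g_def c_def is_flow_def)
  have g_R: "g a b < c a b (lmin G) \<longleftrightarrow> (a, b) \<in> R" for a b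
    by (auto simp: g_def c_def R_def residual_edges_def)
  \<comment> \<open>A residual edge into \<open>Vt\<close> would put its tail into
    \<open>Vt\<close>.\<close>
  have g_sat: "g a b = c a b (lmin G)" if "a \<in> U" "b \<in> Vt" for a b
  proof -
    have "(a, b) \<notin> R"
      using that by (auto simp: U_def Vt_def dest: converse_rtrancl_into_rtrancl)
    then show ?thesis
      using g_le[of a b] g_R[of a b] by simp
  qed
  have g_cons: "(\<Sum>a\<in>V. g a b) = 0" if "b \<in> V" "b \<noteq> s" "b \<noteq> t" for b
    using f0 that sum_edges_into[OF finite_V E_sub, of f0 b] by (auto simp: is_flow_def g_def)
  have cap_in: "cap N (a, b) x = c a b x" and f1_in: "f1 (a, b) x = g a b" if "a \<in> Vt" "b \<in> Vt" for a b x
    using merge_inner[OF out[OF that(1)] out[OF that(2)]] by (auto simp: N_def f1_def c_def g_def)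
  have edges_in: "(a, b) \<in> edges N \<longleftrightarrow> (a, b) \<in> edges G" if "a \<in> Vt" "b \<in> Vt" for a b
    using edges_contract_inner[OF out[OF that(1)] out[OF that(2)]] by (simp add: N_def)
  have cap_s: "cap N (s, b) x = (\<Sum>a\<in>U. c a b x)" and f1_s: "f1 (s, b) x = (\<Sum>a\<in>U. g a b)"
    and f1_to_s: "f1 (b, s) x = (\<Sum>a\<in>U. g b a)" if "b \<in> Vt" for b x
    using merge_source[OF out[OF that] fin(2)] merge_to_source[OF out[OF that] fin(2)]
    by (simp_all add: N_def f1_def c_def g_def s_U)
  have f1_s_sat: "f1 (s, b) x = cap N (s, b) (lmin G)" if "b \<in> Vt" for b x
    using g_sat that by (simp add: f1_s cap_s)
  have S_s: "(s, b) \<in> S \<longleftrightarrow> (s, b) \<in> edges N" if "b \<in> Vt" for b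
    using that by (simp add: S_def f1_s_sat)
  have S_to_s: "(b, s) \<notin> S" if "b \<in> Vt" for b
    using that s_Vt s_neq_t by (auto simp: S_def)
  have S_in: "(a, b) \<in> S \<longleftrightarrow> b = t \<and> (a, t) \<in> edges G \<and> g a t = c a t (lmin G)"
    if "a \<in> Vt" "b \<in> Vt" for a b
    using that s_Vt by (auto simp: S_def edges_in cap_in f1_in)
  have zero_out: "cap N e x = 0" "f1 e x = 0" if "e \<notin> edges N" "e \<noteq> (s, s)" for e x
    using merge_outside[of e G U] that by (simp_all add: N_def f1_def)
  have zero_s: "cap N (s, b) x = 0" "f1 (s, b) x = 0" if "b \<in> Vt" "(s, b) \<notin> edges N" for b x
    using zero_out[OF that(2)] that(1) s_Vt by blast+
  have f2_s: "f2 (s, b) x = cap N (s, b) x" if "b \<in> Vt" for b x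
    using S_s[OF that] S_to_s[OF that] zero_s[OF that, of x] by (auto simp: f2_def)
  have f2_to_s: "f2 (b, s) x = - cap N (s, b) x" if "b \<in> Vt" for b x
  proof (cases "(s, b) \<in> edges N")
    case True
    then show ?thesis
      using S_s[OF that] S_to_s[OF that] by (simp add: f2_def)
  next
    case False
    have "f1 (b, s) x = - f1 (s, b) x"
      unfolding f1_s[OF that] f1_to_s[OF that] sum_negf[symmetric] by (intro sum.cong refl g_anti)
    then show ?thesis
      using S_s[OF that] S_to_s[OF that] zero_s[OF that False] False by (auto simp: f2_def)
  qed
  \<comment> \<open>A pair that is not an edge counts as saturated, since both sides are
    zero.\<close>
  define sat where "sat a \<longleftrightarrow> g a t = c a t (lmin G)" for a
  have f2_sink: "f2 (a, t) x = (if sat a then c a t x else g a t)" if "a \<in> Vt" for a x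
  proof (cases "(a, t) \<in> edges G")
    case True
    then show ?thesis
      using that t_Vt S_in[of a t] S_in[of t a] by (auto simp: f2_def sat_def cap_in f1_in)
  next
    case False
    then have "(t, a) \<notin> edges G"
      using E_swap by blast
    then show ?thesis
      using False that t_Vt S_in[of a t] S_in[of t a] by (auto simp: f2_def f1_in c_def g_def)
  qed
  have f2_from_sink: "f2 (t, b) x = (if sat b then - c b t x else g t b)" if "b \<in> Vt" "b \<noteq> t" for b x
  proof (cases "(b, t) \<in> edges G")
    case True
    then show ?thesis
      using that t_Vt S_in[of b t] S_in[of t b] by (auto simp: f2_def sat_def cap_in f1_in)
  next
    case False
    then have "(t, b) \<notin> edges G"
      using E_swap by blast
    then show ?thesis
      using False that t_Vt S_in[of b t] S_in[of t b] by (auto simp: f2_def f1_in c_def g_def)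
  qed
  have f2_in: "f2 (a, b) x = g a b" if "a \<in> Vt" "b \<in> Vt" "a \<noteq> t" "b \<noteq> t" for a b x
    using that S_in[of a b] S_in[of b a] by (simp add: f2_def f1_in)
  \<comment> \<open>Antisymmetry makes the flow on a loop at the sink zero. If the loop counts as
    saturated, its capacity is zero at \<open>lmin G\<close> and, being nonnegative and
    non-increasing, remains zero.\<close>
  have f2_tt: "f2 (t, t) x = 0" if x: "x \<in> {lmin G..lmax G}" for x
  proof -
    have "g t t = 0"
      using g_anti[of t t] by simp
    moreover have "c t t x = 0" if "sat t"
      using c_nonneg[OF x, of t t] c_antimono[of t "lmin G" x t] x s_neq_t that \<open>g t t = 0\<close>
      by (auto simp: sat_def)
    ultimately show ?thesis
      using f2_sink[OF t_Vt, of x] by simp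
  qed
  have f2_lmin: "f2 (a, b) (lmin G) = g a b" if "a \<in> Vt" "b \<in> Vt" for a b
  proof (cases "b = t")
    case True
    then show ?thesis
      using that f2_sink by (simp add: sat_def)
  next
    case False
    then show ?thesis
      using that f2_from_sink[of b] f2_in[of a b] g_anti[of b t] by (cases "a = t") (auto simp: sat_def)
  qed
  have res_s: "res ?\<sigma> (s, b) x = 0" if "b \<in> Vt" for b x
    using f2_s[OF that] by (simp add: res_def init)
  have res_lmin: "res ?\<sigma> (a, b) (lmin G) = c a b (lmin G) - g a b" if "a \<in> Vt" "b \<in> Vt" for a b
    using that by (simp add: res_def init cap_in f2_lmin)
  have res_R: "0 < res ?\<sigma> (a, b) (lmin G) \<longleftrightarrow> (a, b) \<in> R" if "a \<in> Vt" "b \<in> Vt" for a b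
    using g_R[of a b] that by (simp add: res_lmin)
  have T: "T \<subseteq> R" "single_valued T" "Domain T = Vt - {t}"
      "\<And>v n. bfs_dist R t v = enat n \<Longrightarrow> (v, t) \<in> T ^^ n"
    using tree by (auto simp: shortest_path_in_tree_def R_def Vt_def)
  have T_step: "v \<in> Vt" "bfs_dist R t u = bfs_dist R t v + 1" if "(u, v) \<in> T" for u v
    using shortest_path_in_tree_step[OF tree that] by (auto simp: R_def Vt_def)
  have T_Vt: "T \<subseteq> Vt \<times> Vt"
    using T(3) T_step(1) by auto
  \<comment> \<open>An unsaturated edge into the sink would put \<open>a\<close> at distance 1, and
    a shortest-path tree must then contain that very edge.\<close>
  have sat_nontree: "sat a" if a: "a \<in> Vt" "a \<noteq> t" "(a, t) \<notin> T" for a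
  proof (rule ccontr)
    assume "\<not> sat a"
    then have "(a, t) \<in> R"
      using g_R[of a t] g_le[of a t] by (simp add: sat_def)
    then have "bfs_dist R t a \<le> enat 1"
      by (intro bfs_dist_le) simp
    moreover obtain n where n: "bfs_dist R t a = enat n"
      using a by (auto simp: Vt_def elim: bfs_dist_finite)
    moreover have "n \<noteq> 0"
      using bfs_dist_witness[OF n] a by (intro notI) simp
    ultimately have "bfs_dist R t a = enat 1"
      by simp
    then show False
      using T(4)[of a 1] a by simp
  qed
  have f2_cont: "continuous_on {lmin G..lmax G} (f2 (a, b))" if "a \<in> Vt" "b \<in> Vt" for a b
  proof -
    have "f2 (a, b) = c a t \<or> f2 (a, b) = (\<lambda>x. - c b t x) \<or> (\<exists>k. f2 (a, b) = (\<lambda>x. k))"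
    proof (cases "b = t")
      case True
      then show ?thesis
        using f2_sink[OF that(1)] by (cases "sat a") auto
    next
      case False
      show ?thesis
      proof (cases "a = t")
        case True
        then show ?thesis
          using f2_from_sink[OF that(2) False] by (cases "sat b") auto
      next
        case a: False
        then have "f2 (a, b) = (\<lambda>x. g a b)"
          using f2_in[OF that a False] by blast
        then show ?thesis
          by blast
      qed
    qed
    then show ?thesis
      using c_continuous[of a t] continuous_on_minus[OF c_continuous[of b t]] by auto
  qed
  have cap_s_cont: "continuous_on {lmin G..lmax G} (cap N (s, b))" if "b \<in> Vt" for b
  proof -
    have "cap N (s, b) = (\<lambda>x. \<Sum>a\<in>U. c a b x)"
      using cap_s[OF that] by blast
    then show ?thesis
      using c_continuous by (simp add: continuous_on_sum)
  qed
  have excess: "excess ?\<sigma> v x = cap N (s, v) x - cap N (s, v) (lmin G)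
      - (if sat v then c v t x - c v t (lmin G) else 0)" if "v \<in> Vt" for v x
  proof -
    have "(if (s, v) \<in> S then cap N (s, v) x - f1 (s, v) x else 0) = cap N (s, v) x - cap N (s, v) (lmin G)"
      using S_s[OF that] zero_s[OF that] that by (auto simp: f1_s_sat)
    moreover have "(if (v, t) \<in> S then cap N (v, t) x - f1 (v, t) x else 0) =
        (if sat v then c v t x - c v t (lmin G) else 0)"
      using S_in[OF that t_Vt] that t_Vt by (auto simp: cap_in f1_in sat_def c_def)
    ultimately show ?thesis
      by (simp add: init)
  qed
  have inflow: "inflow ?\<sigma> v x = (\<Sum>a\<in>Vt. f2 (a, v) x) + cap N (s, v) x" if "v \<in> Vt" for v x
  proof -
    have "source N = s"
      by (simp add: N_def)
    then show ?thesis
      using fin s_Vt by (simp add: inflow_def side init f2_s[OF that])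
  qed
  have inflow_excess: "inflow ?\<sigma> v x = excess ?\<sigma> v x" if v: "v \<in> Vt" "v \<noteq> t" for v x
  proof -
    \<comment> \<open>Among the edges into \<open>v\<close> from inside \<open>Vt\<close>, only the
      one from the sink can deviate from the maximum flow.\<close>
    have "f2 (a, v) x = g a v + (if a = t then if sat v then - (c v t x - c v t (lmin G)) else 0 else 0)"
      if "a \<in> Vt" for a
      using that v f2_from_sink[OF v] f2_in[of a v] g_anti[of v t] by (auto simp: sat_def)
    then have "(\<Sum>a\<in>Vt. f2 (a, v) x) =
        (\<Sum>a\<in>Vt. g a v) + (if sat v then - (c v t x - c v t (lmin G)) else 0)"
      using t_Vt fin by (simp add: sum.distrib)
    moreover have "(\<Sum>a\<in>U. g a v) + (\<Sum>a\<in>Vt. g a v) = 0"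
      using g_cons[of v] v Vt_V s_Vt V_split fin by (auto simp: sum.union_disjoint[symmetric])
    ultimately show ?thesis
      using f1_s_sat[of v x] v by (simp add: inflow excess f1_s)
  qed
  show "pbfs_inv G adj ?\<sigma> {}"
  proof (unfold_locales, unfold side)
    show "source (net ?\<sigma>) = s" "sink (net ?\<sigma>) = t" "lmax (net ?\<sigma>) = lmax G"
      by (simp_all add: init N_def)
    have "V - U = Vt"
      using V_split by auto
    then show "edges (net ?\<sigma>) \<subseteq> insert s Vt \<times> insert s Vt"
      using edges_contract_subset[of G V U] E_sub s_V by (auto simp: init N_def insert_absorb)
    show "Vt \<subseteq> V" "t \<in> Vt"
      by fact+
    show "(u, v) \<in> edges (net ?\<sigma>) \<longleftrightarrow> (u, v) \<in> edges G" if "u \<in> Vt" "v \<in> Vt" for u v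
      using edges_in that by (simp add: init)
    show "cap (net ?\<sigma>) (u, v) x = c u v x" if "u \<in> Vt" "v \<in> Vt" for u v x
      using cap_in that by (simp add: init)
    show "cap (net ?\<sigma>) (s, v) x = (\<Sum>a\<in>V - Vt. c a v x)" if "v \<in> Vt" for v x
      using cap_s that by (simp add: init U_def)
    show "cap (net ?\<sigma>) e x = 0" if "e \<notin> edges (net ?\<sigma>)" "e \<noteq> (s, s)" for e x
      using zero_out that by (simp add: init)
    show "flow ?\<sigma> e x = 0" if e: "e \<notin> edges (net ?\<sigma>)" "e \<noteq> (s, s)" for e x
    proof -
      obtain a b where ab: "e = (a, b)" by force
      have "prod.swap e \<notin> S"
      proof
        assume "prod.swap e \<in> S"
        then have ba: "(b, a) \<in> edges N" "b = s \<or> a = t"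
          by (auto simp: S_def ab)
        have N_sub: "edges N \<subseteq> insert s Vt \<times> insert s Vt"
          using edges_contract_subset[of G V U] E_sub s_V \<open>V - U = Vt\<close> by (auto simp: N_def insert_absorb)
        then have "a \<in> Vt \<or> a = s" "b \<in> Vt \<or> b = s"
          using ba(1) by auto
        moreover have "(x, y) \<in> redirect G U ` edges G" if "(y, x) \<in> redirect G U ` edges G" for x y
          using that E_swap by (force simp: redirect_def Let_def image_iff)
        then have "(a, b) \<in> edges N" if "(a, b) \<noteq> (s, s)"
          using ba(1) that by (simp add: N_def contract_def)
        ultimately show False
          using e by (auto simp: init ab)
      qed
      moreover have "e \<notin> S"
        using e by (auto simp: S_def init)
      ultimately show ?thesis
        using zero_out e by (simp add: init f2_def)
    qed
    show "lmin G \<le> lam ?\<sigma>" "lam ?\<sigma> \<le> lmax G"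
      by (simp_all add: init)
    show "flow ?\<sigma> (v, u) x = - flow ?\<sigma> (u, v) x"
      if u: "u \<in> insert s Vt" and v: "v \<in> Vt" and "x \<in> {lam ?\<sigma>..lmax G}" for u v x
    proof (cases "u = s")
      case True
      then show ?thesis
        using v by (simp add: init f2_s f2_to_s)
    next
      case False
      have x: "x \<in> {lmin G..lmax G}"
        using that by (simp add: init)
      have "u \<in> Vt"
        using u False by simp
      then show ?thesis
        using f2_tt[OF x] f2_sink[of u x] f2_sink[of v x] f2_from_sink[of u x] f2_from_sink[of v x]
          f2_in[of u v x] f2_in[of v u x] g_anti[of u v] v
        by (cases "u = t"; cases "v = t") (simp_all add: init)
    qed
    show "continuous_on {lam ?\<sigma>..lmax G} (flow ?\<sigma> (u, v))" if "u \<in> Vt" "v \<in> Vt" for u v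
      using f2_cont that by (simp add: init)
    show "continuous_on {lam ?\<sigma>..lmax G} (excess ?\<sigma> v)" if "v \<in> Vt" for v
    proof -
      have eq: "excess ?\<sigma> v = (\<lambda>x. cap N (s, v) x - cap N (s, v) (lmin G)
          - (if sat v then c v t x - c v t (lmin G) else 0))"
        using excess[OF that] by blast
      show ?thesis
        using cap_s_cont[OF that] c_continuous[of v t] unfolding eq init(11)
        by (cases "sat v") (simp_all add: continuous_on_diff)
    qed
    show "inflow ?\<sigma> v x = excess ?\<sigma> v x" if "v \<in> Vt" "v \<noteq> t" "x \<in> {lam ?\<sigma>..lmax G}" for v x
      by (rule inflow_excess[OF that(1,2)])
    show "excess ?\<sigma> v (lam ?\<sigma>) = 0" if "v \<in> Vt" "v \<noteq> t" for v
      using that by (simp add: excess init(11))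
    show "excess ?\<sigma> v x = 0" if "v \<in> Vt" "v \<noteq> t" "v \<notin> modified ?\<sigma>" "x \<in> {lam ?\<sigma>..lmax G}" for v x
      using that by (simp add: init)
    show "modified ?\<sigma> \<subseteq> Vt" "orphans ?\<sigma> \<subseteq> modified ?\<sigma> - {t}"
      by (auto simp: init)
    show "tree ?\<sigma> \<subseteq> Vt \<times> Vt" "tree ?\<sigma> \<subseteq> edges G" "single_valued (tree ?\<sigma>)"
      "Domain (tree ?\<sigma>) = Vt - {t} - orphans ?\<sigma>"
      using T T_Vt RE by (simp_all add: init)
    show "label ?\<sigma> u = label ?\<sigma> v + 1" if "(u, v) \<in> tree ?\<sigma>" for u v
      using T_step that by (simp add: init)
    show res_pos: "0 < res ?\<sigma> e (lam ?\<sigma>)" if "e \<in> tree ?\<sigma> - {}" for e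
      using that T_Vt T(1) res_R by (cases e) (auto simp: init(5,11))
    show "limit_correct ?\<sigma> e" if e: "e \<in> tree ?\<sigma> - {}" "fst e \<notin> modified ?\<sigma>" for e
    proof -
      obtain a b where ab: "e = (a, b)" by force
      have abVt: "a \<in> Vt" "b \<in> Vt"
        using e T_Vt by (auto simp: init ab)
      have "cap N e = c a b"
        using cap_in[OF abVt] by (auto simp: ab)
      then have "continuous_on {lmin G..lmax G} (\<lambda>x. cap N e x - f2 e x)"
        using c_continuous[of a b] f2_cont[OF abVt] by (simp add: ab continuous_on_diff)
      moreover have "0 < cap N e (lmin G) - f2 e (lmin G)"
        using res_pos[OF e(1)] by (simp add: res_def init)
      moreover have "limit ?\<sigma> e = smallest_root G (lmin G) (\<lambda>x. cap N e x - f2 e x)"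
        using e by (simp add: init)
      ultimately show ?thesis
        using smallest_root_cases[of "lmin G" G "\<lambda>x. cap N e x - f2 e x"]
        unfolding limit_correct_def res_def by (simp add: init(1,2,11) N_def)
    qed
    show "label ?\<sigma> v < enat (card V)" if "v \<in> Vt" for v
    proof -
      have "bfs_dist R t v < enat (card Vt)"
      proof (rule label_chain_bound[where t = t])
        show "bfs_dist R t v \<noteq> \<infinity>" if "v \<in> Vt" for v
          using that by (auto simp: Vt_def elim: bfs_dist_finite)
        show "\<exists>w\<in>Vt. bfs_dist R t v = bfs_dist R t w + 1" if "v \<in> Vt - {t}" for v
          using that T(3) T_step by (metis DomainE)
      qed (use fin that in auto)
      also have "enat (card Vt) \<le> enat (card V)"
        using Vt_V finite_V by (simp add: card_mono)
      finally show ?thesis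
        by (simp add: init)
    qed
    show "label ?\<sigma> t = 0"
      by (simp add: init)
    show "0 \<le> res ?\<sigma> (u, v) (lam ?\<sigma>)" if "u \<in> insert s Vt" "u \<noteq> t" "v \<in> Vt" for u v
      using that res_s[of v] res_lmin[of u v] g_le[of u v] by (cases "u = s") (auto simp: init(11))
    show "label ?\<sigma> u \<le> label ?\<sigma> v + 1"
      if "u \<in> Vt" "u \<noteq> t" "v \<in> Vt" "0 < res ?\<sigma> (u, v) (lam ?\<sigma>)" for u v
      using that res_R[of u v] bfs_dist_edge[of u v R t] by (simp add: init(6,11))
    have sink_res: "res ?\<sigma> (u, t) x = 0" if "u \<in> Vt" "u \<noteq> t" "(u, t) \<notin> tree ?\<sigma>" for u x
      using that sat_nontree[of u] f2_sink[of u x] by (simp add: res_def init cap_in t_Vt)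
    then show "res ?\<sigma> (u, t) x = 0"
      if "u \<in> Vt" "u \<noteq> t" "(u, t) \<notin> tree ?\<sigma>" "x \<in> {lam ?\<sigma>..lmax G}" for u x
      using that by blast
    show "res ?\<sigma> (u, v) x = res ?\<sigma> (u, v) (lam ?\<sigma>)"
      if uv: "u \<in> insert s Vt" "u \<noteq> t" "v \<in> Vt" "(u, v) \<notin> tree ?\<sigma>" "(v, u) \<notin> tree ?\<sigma>"
        and x: "x \<in> {lam ?\<sigma>..lmax G}" for u v x
    proof -
      consider "u = s" | "u \<in> Vt" "v = t" | "u \<in> Vt" "u \<noteq> s" "v \<noteq> t"
        using uv(1) s_Vt by auto
      then show ?thesis
      proof cases
        case 1
        then show ?thesis using res_s uv(3) by simp
      next
        case 2
        then show ?thesis using sink_res uv(2,4) by simp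
      next
        case 3
        have "c u v x = c u v (lmin G)"
          using c_const[of u v x "lmin G"] 3 x by (simp add: init(11))
        then show ?thesis
          using 3 uv(2,3) by (simp add: res_def init cap_in f2_in)
      qed
    qed
    show "enat (card Vt) \<le> label ?\<sigma> v" if "v \<in> Vt" "0 < res ?\<sigma> (s, v) (lam ?\<sigma>)" for v
      using that res_s by simp
    show "\<not> admissible ?\<sigma> u (adj u ! k)"
      if "u \<in> Vt" "u \<noteq> t" "k < current ?\<sigma> u" "k < length (adj u)" for u k
      using that by (simp add: init)
    show "inflow ?\<sigma> t (lam ?\<sigma>) \<le> cut X (lam ?\<sigma>)" if X: "X \<subseteq> V" "s \<in> X" "t \<notin> X" for X
    proof -
      \<comment> \<open>At \<open>lmin G\<close> the inflow of the sink is the value of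
        \<open>f0\<close>, so weak duality bounds it by every cut.\<close>
      have "inflow ?\<sigma> t (lmin G) = (\<Sum>a\<in>Vt. g a t) + (\<Sum>a\<in>U. g a t)"
        using f1_s_sat[OF t_Vt] f1_s[OF t_Vt] f2_lmin t_Vt by (simp add: inflow)
      also have "\<dots> = (\<Sum>a\<in>V. g a t)"
        using V_split fin by (simp add: sum.union_disjoint)
      also have "\<dots> = flow_value (at_param G (lmin G)) f0"
        by (simp add: flow_value_def g_def sum_edges_into[OF finite_V E_sub])
      also have "\<dots> \<le> cut_cap (at_param G (lmin G)) X (V - X)"
        using X t_V by (intro flow_value_le_cut_cap[OF net0 f0]) (auto simp: is_cut_def)
      also have "\<dots> = cut X (lmin G)"
        by (rule cut_cap_eq[OF X(1)])
      finally show ?thesis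
        by (simp add: init(11))
    qed
    show "bp ?\<sigma> v = \<infinity>" if "v \<in> Vt" for v
      using that by (simp add: init)
    show "\<exists>r\<in>{lmin G..lam ?\<sigma>}. bp ?\<sigma> v = ereal r" if "v \<in> V - Vt" for v
      using that by (simp add: init)
    show "good_cut (bp ?\<sigma>) x" if "lmin G \<le> x" "x < lam ?\<sigma>" for x
      using that by (simp add: init)
    show "{} \<subseteq> tree ?\<sigma>"
      by simp
    show "res ?\<sigma> (u, t) (lam ?\<sigma>) = 0" if "(u, t) \<in> {}" for u
      using that by simp
  qed
qed

end

section \<open>Termination and correctness\<close>

lemma admissible_cong:
  assumes "net \<sigma>' = net \<sigma>" "label \<sigma>' = label \<sigma>" "lam \<sigma>' = lam \<sigma>"
    and "\<And>e. res \<sigma>' e (lam \<sigma>) = res \<sigma> e (lam \<sigma>)"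
  shows "admissible \<sigma>' = admissible \<sigma>"
  by (simp add: fun_eq_iff admissible_def residual_iff sink_side_cong[OF assms(1)] assms)

definition measure_less :: "((nat \<times> nat \<times> nat) \<times> (nat \<times> nat \<times> nat)) set" where
  "measure_less = less_than <*lex*> less_than <*lex*> less_than"

lemma wf_measure_less: "wf measure_less"
  by (auto simp: measure_less_def)

lemma measure_less_iff:
  "((a, b, c), (a', b', c')) \<in> measure_less \<longleftrightarrow> a < a' \<or> a = a' \<and> (b < b' \<or> b = b' \<and> c < c')"
  by (auto simp: measure_less_def)

context pbfs
begin

text \<open>
  An edge that stops being admissible becomes admissible again only after its tail is relabeled.
  One relabeling outweighs all the edges that become admissible by it.
\<close>

definition vertex_potential :: "'v pbfs_state \<Rightarrow> 'v \<Rightarrow> nat" where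
  "vertex_potential \<sigma> u =
     (card V - the_enat (label \<sigma> u)) * (card V + 1) + card {v. admissible \<sigma> u v}"

definition potential :: "'v pbfs_state \<Rightarrow> nat" where
  "potential \<sigma> = (\<Sum>u\<in>sink_side \<sigma> - {t}. vertex_potential \<sigma> u)"

primrec config_inv :: "'v config \<Rightarrow> bool" where
  "config_inv Start = True"
| "config_inv (Drain \<sigma>) = pbfs_adopted G adj \<sigma>"
| "config_inv (Loop \<sigma>) = pbfs_drained G adj \<sigma>"
| "config_inv (Adopt \<sigma>) = pbfs_inv G adj \<sigma> {}"
| "config_inv (Return \<beta>) = breakpoint_function G \<beta>"

text \<open>Within a round the phases count down from 3 to 1, and \<open>Loop\<close> returns to
  \<open>Adopt\<close> only with a smaller \<open>potential\<close>. Relabeling and contracting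
  lower \<open>potential\<close> as well, adopting removes an orphan, and draining passes excess to
  a vertex of smaller label. The value of \<open>Start\<close> is arbitrary, since no step leads
  back to it.\<close>

primrec config_measure :: "'v config \<Rightarrow> nat \<times> nat \<times> nat" where
  "config_measure Start = (0, 0, 0)"
| "config_measure (Drain \<sigma>) = (potential \<sigma>, 2, \<Sum>u\<in>modified \<sigma> - {t}. 2 ^ the_enat (label \<sigma> u))"
| "config_measure (Loop \<sigma>) = (potential \<sigma>, 1, 0)"
| "config_measure (Adopt \<sigma>) = (potential \<sigma>, 3, card (orphans \<sigma>))"
| "config_measure (Return \<beta>) = (0, 0, 0)"

lemma potential_cong:
  assumes "net \<sigma>' = net \<sigma>" "label \<sigma>' = label \<sigma>" "admissible \<sigma>' = admissible \<sigma>"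
  shows "potential \<sigma>' = potential \<sigma>"
  by (simp add: potential_def vertex_potential_def sink_side_cong[OF assms(1)] assms)

lemma set_adj: "u \<in> V \<Longrightarrow> set (adj u) = {v. (u, v) \<in> edges G}"
  using adjacency by (auto simp: adjacency_lists_def)

end

context pbfs_inv
begin

lemma finite_admissible: "finite {v. admissible \<sigma> u v}" "card {v. admissible \<sigma> u v} \<le> card V"
proof -
  have sub: "{v. admissible \<sigma> u v} \<subseteq> V"
    using side_sub by (auto simp: admissible_iff)
  show "finite {v. admissible \<sigma> u v}"
    by (rule finite_subset[OF sub finite_V])
  show "card {v. admissible \<sigma> u v} \<le> card V"
    by (rule card_mono[OF finite_V sub])
qed

lemma label_enat:
  assumes "v \<in> B"
  obtains k where "label \<sigma> v = enat k" "k < card V"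
  using label_bound[OF assms] by (cases "label \<sigma> v") auto

lemma vertex_potential_mono:
  assumes "label \<sigma>' u = label \<sigma> u" "\<And>v. admissible \<sigma>' u v \<Longrightarrow> admissible \<sigma> u v"
  shows "vertex_potential \<sigma>' u \<le> vertex_potential \<sigma> u"
proof -
  have "card {v. admissible \<sigma>' u v} \<le> card {v. admissible \<sigma> u v}"
    using assms(2) finite_admissible by (intro card_mono) auto
  then show ?thesis
    by (simp add: vertex_potential_def assms(1))
qed

text \<open>The scan covers the adjacency list from the pointer on, and the invariant
  \<open>pointer\<close> covers the part before it.\<close>

lemma no_admissible:
  assumes u: "u \<in> B" "u \<noteq> t"
    and scan: "\<forall>k. current \<sigma> u \<le> k \<and> k < length (adj u) \<longrightarrow> \<not> admissible \<sigma> u (adj u ! k)"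
  shows "\<not> admissible \<sigma> u v"
proof
  assume adm: "admissible \<sigma> u v"
  then have "(u, v) \<in> edges G"
    using edges_net[OF u(1), of v] by (auto simp: admissible_def residual_def)
  then have "v \<in> set (adj u)"
    using set_adj u(1) side_sub by blast
  then obtain k where "k < length (adj u)" "adj u ! k = v"
    by (auto simp: in_set_conv_nth)
  then show False
    using adm scan pointer[OF u, of k] by (cases "current \<sigma> u \<le> k") auto
qed

lemma finite_tree: "finite (tree \<sigma>)"
  using tree_sub finite_B by (meson finite_SigmaI finite_subset)

lemma limit_attained:
  assumes "(INF e\<in>tree \<sigma>. limit \<sigma> e) \<noteq> \<infinity>"
  shows "\<exists>e\<in>tree \<sigma>. limit \<sigma> e = (INF e\<in>tree \<sigma>. limit \<sigma> e)"
proof -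
  have ne: "limit \<sigma> ` tree \<sigma> \<noteq> {}"
    using assms by (auto simp: top_ereal_def)
  then have "(INF e\<in>tree \<sigma>. limit \<sigma> e) = Min (limit \<sigma> ` tree \<sigma>)"
    using finite_tree by (simp add: Min_Inf)
  also have "\<dots> \<in> limit \<sigma> ` tree \<sigma>"
    using finite_tree ne by (intro Min_in) auto
  finally show ?thesis
    by force
qed

end

section \<open>Effect of single steps on the invariant and the measure\<close>

context pbfs_adopted
begin

text \<open>The flow changes by an excess that is zero at \<open>lam\<close>, so admissibility and
  \<open>potential\<close> stay. The weight of \<open>u\<close> is replaced by at most that of its
  parent, which is half as large.\<close>

lemma drain_step:
  assumes T: "(u, v) \<in> tree \<sigma>" and u: "u \<in> modified \<sigma>"
  shows "pbfs_adopted G adj (drain_edge u v \<sigma>)"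
    and "(config_measure (Drain (drain_edge u v \<sigma>)), config_measure (Drain \<sigma>)) \<in> measure_less"
proof -
  let ?\<sigma> = "drain_edge u v \<sigma>"
  note uv = tree_facts[OF T]
  have upd: "net ?\<sigma> = net \<sigma>" "label ?\<sigma> = label \<sigma>" "lam ?\<sigma> = lam \<sigma>" "orphans ?\<sigma> = orphans \<sigma>"
    "modified ?\<sigma> = insert v (modified \<sigma> - {u})"
    by (simp_all add: drain_edge_def Let_def)
  have "pbfs_inv G adj ?\<sigma> {}"
    by (rule drain_edge_preserves[OF T u refl no_orphans])
  then show "pbfs_adopted G adj ?\<sigma>"
    by (simp add: pbfs_adopted_def pbfs_adopted_axioms_def upd no_orphans)
  have anti: "flow \<sigma> (v, u) (lam \<sigma>) = - flow \<sigma> (u, v) (lam \<sigma>)"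
    using flow_antisym[of u v "lam \<sigma>"] uv(1,2) lam_I by simp
  have "flow ?\<sigma> e (lam \<sigma>) = flow \<sigma> e (lam \<sigma>)" for e
    by (simp add: drain_edge_def Let_def set_flow_def anti excess_lam[OF uv(1,3)])
  then have "admissible ?\<sigma> = admissible \<sigma>"
    by (intro admissible_cong upd(1-3)) (simp add: upd(1) res_def)
  then have pot: "potential ?\<sigma> = potential \<sigma>"
    by (rule potential_cong[OF upd(1,2)])
  let ?w = "\<lambda>u. 2 ^ the_enat (label \<sigma> u) :: nat"
  have fin: "finite (modified \<sigma>)"
    using modified_sub finite_B finite_subset by blast
  have "(\<Sum>a\<in>modified ?\<sigma> - {t}. ?w a) \<le> (\<Sum>a\<in>insert v (modified \<sigma> - {u} - {t}). ?w a)"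
    using fin by (intro sum_mono2) (auto simp: upd)
  also have "\<dots> \<le> ?w v + (\<Sum>a\<in>modified \<sigma> - {u} - {t}. ?w a)"
    using fin by (cases "v \<in> modified \<sigma> - {u} - {t}") (simp_all add: insert_absorb)
  also have "\<dots> < ?w u + (\<Sum>a\<in>modified \<sigma> - {u} - {t}. ?w a)"
  proof -
    obtain k where "label \<sigma> v = enat k"
      using label_enat[OF uv(2)] .
    then show ?thesis
      using tree_label[OF T] by (simp add: one_enat_def)
  qed
  also have "\<dots> = (\<Sum>a\<in>modified \<sigma> - {t}. ?w a)"
  proof -
    have "modified \<sigma> - {u} - {t} = modified \<sigma> - {t} - {u}"
      by blast
    then show ?thesis
      using sum.remove[of "modified \<sigma> - {t}" u ?w] fin u uv(3) by simp
  qed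
  finally show "(config_measure (Drain ?\<sigma>), config_measure (Drain \<sigma>)) \<in> measure_less"
    by (simp add: measure_less_iff pot upd(2))
qed

end

context pbfs_drained
begin

lemma all_good:
  assumes "lam \<sigma> \<le> x" "x \<le> lmax G" "\<And>e. e \<in> tree \<sigma> \<Longrightarrow> ereal x < limit \<sigma> e"
    and y: "y \<in> {lmin G..x}"
  shows "good_cut (bp \<sigma>) y"
proof (cases "y < lam \<sigma>")
  case True
  then show ?thesis
    using good_past y by simp
next
  case False
  have "ereal y < limit \<sigma> e" if "e \<in> tree \<sigma>" for e
  proof -
    have "ereal y \<le> ereal x"
      using y by simp
    then show ?thesis
      using assms(3)[OF that] by (rule le_less_trans)
  qed
  then show ?thesis
    using False y assms(2) by (intro good_cut_at) auto
qed

lemma breakpoint_functionI: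
  assumes "\<And>e. e \<in> tree \<sigma> \<Longrightarrow> ereal (lmax G) < limit \<sigma> e"
  shows "breakpoint_function G (bp \<sigma>)"
proof -
  have "0 \<le> bp \<sigma> v" if "v \<in> V" for v
    using bp_side[of v] bp_out[of v] that lmin_nonneg by (cases "v \<in> B") auto
  then show ?thesis
    using all_good[OF lam_le order_refl assms] by (simp add: breakpoint_function_def good_cut_def)
qed

text \<open>Labels stay, so losing an admissible edge at the tail of a pending edge decides; the
  subsequent removals leave residual capacities at \<open>l\<close> alone.\<close>

lemma next_breakpoint_step:
  assumes l: "(INF e\<in>tree \<sigma>. limit \<sigma> e) = ereal l" "l \<le> lmax G"
    and rem: "remove_tree_edges {e \<in> tree \<sigma>. limit \<sigma> e = ereal l} (\<sigma>\<lparr>lam := l, modified := {}\<rparr>) \<sigma>'"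
  shows "pbfs_inv G adj \<sigma>' {}" and "potential \<sigma>' < potential \<sigma>"
proof -
  let ?\<sigma> = "\<sigma>\<lparr>lam := l, modified := {}\<rparr>"
  have attained: "\<exists>e\<in>tree \<sigma>. limit \<sigma> e = ereal l"
    using limit_attained l(1) by simp
  have below: "ereal l \<le> limit \<sigma> e" if "e \<in> tree \<sigma>" for e
    using INF_lower[OF that, of "limit \<sigma>"] l(1) by simp
  have shrinks: "admissible \<sigma> a b" if "a \<in> B" "a \<noteq> t" "admissible ?\<sigma> a b" for a b
    using that by (intro advance_preserves(2)[OF l(2) attained below])
  have vanishes: "admissible \<sigma> u v \<and> \<not> admissible ?\<sigma> u v"
    if "(u, v) \<in> tree \<sigma>" "limit \<sigma> (u, v) = ereal l" for u v
    using that by (intro advance_preserves(3)[OF l(2) attained below])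
  interpret adv: pbfs_inv G adj ?\<sigma> "{e \<in> tree \<sigma>. limit \<sigma> e = ereal l}"
    by (rule advance_preserves(1)[OF l(2) attained below])
  note removed = adv.remove_tree_edges_preserves[OF rem]
  show "pbfs_inv G adj \<sigma>' {}"
    by (rule removed(1))
  have side: "sink_side ?\<sigma> = B"
    by (rule sink_side_cong) simp
  have "admissible \<sigma>' = admissible ?\<sigma>"
    using removed by (intro admissible_cong) auto
  then have "potential \<sigma>' = potential ?\<sigma>"
    using removed by (intro potential_cong) auto
  also have "potential ?\<sigma> < potential \<sigma>"
    unfolding potential_def side
  proof (rule sum_strict_mono_ex1)
    show "finite (B - {t})"
      using finite_B by simp
    show "\<forall>u\<in>B - {t}. vertex_potential ?\<sigma> u \<le> vertex_potential \<sigma> u"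
      using shrinks by (intro ballI vertex_potential_mono) auto
    obtain u v where uv: "(u, v) \<in> tree \<sigma>" "limit \<sigma> (u, v) = ereal l"
      using attained by auto
    note t_uv = tree_facts[OF uv(1)]
    have "{v. admissible ?\<sigma> u v} \<subset> {v. admissible \<sigma> u v}"
      using shrinks[OF t_uv(1,3)] vanishes[OF uv] by blast
    then have "card {v. admissible ?\<sigma> u v} < card {v. admissible \<sigma> u v}"
      by (intro psubset_card_mono finite_admissible)
    then have "vertex_potential ?\<sigma> u < vertex_potential \<sigma> u"
      by (simp add: vertex_potential_def)
    then show "\<exists>u\<in>B - {t}. vertex_potential ?\<sigma> u < vertex_potential \<sigma> u"
      using t_uv by auto
  qed
  finally show "potential \<sigma>' < potential \<sigma>" .
qed

lemma next_breakpoint_exists: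
  assumes "\<not> ereal (lmax G) < (INF e\<in>tree \<sigma>. limit \<sigma> e)"
  obtains l \<sigma>' where "(INF e\<in>tree \<sigma>. limit \<sigma> e) = ereal l" "l \<le> lmax G"
    "remove_tree_edges {e \<in> tree \<sigma>. limit \<sigma> e = ereal l} (\<sigma>\<lparr>lam := l, modified := {}\<rparr>) \<sigma>'"
proof -
  have "(INF e\<in>tree \<sigma>. limit \<sigma> e) \<noteq> \<infinity>"
    using assms by auto
  then obtain e where e: "e \<in> tree \<sigma>" "limit \<sigma> e = (INF e\<in>tree \<sigma>. limit \<sigma> e)"
    using limit_attained by blast
  \<comment> \<open>By \<open>limit_correct\<close>, a limit that is not infinite is a real number
    up to \<open>lmax G\<close>.\<close>
  then obtain l where l: "(INF e\<in>tree \<sigma>. limit \<sigma> e) = ereal l" "l \<le> lmax G"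
    using limit_correct_tree[OF e(1)] \<open>_ \<noteq> \<infinity>\<close> by (auto simp: limit_correct_def lmax_net)
  have "\<exists>e\<in>tree \<sigma>. limit \<sigma> e = ereal l"
    using e l by auto
  moreover have "ereal l \<le> limit \<sigma> e" if "e \<in> tree \<sigma>" for e
    using INF_lower[OF that, of "limit \<sigma>"] l(1) by simp
  ultimately interpret adv: pbfs_inv G adj "\<sigma>\<lparr>lam := l, modified := {}\<rparr>" "{e \<in> tree \<sigma>. limit \<sigma> e = ereal l}"
    by (intro advance_preserves l)
  show ?thesis
    using adv.remove_tree_edges_exists that l by blast
qed

end

context pbfs
begin

lemma adopt_step:
  assumes inv: "pbfs_inv G adj \<sigma> {}" and u: "u \<in> orphans \<sigma>" and j: "current \<sigma> u \<le> j" "j < length (adj u)"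
    and adm: "admissible \<sigma> u (adj u ! j)"
    and scan: "\<forall>k. current \<sigma> u \<le> k \<and> k < j \<longrightarrow> \<not> admissible \<sigma> u (adj u ! k)"
  defines "\<sigma>' \<equiv> \<sigma>\<lparr>current := (current \<sigma>)(u := j), tree := insert (u, adj u ! j) (tree \<sigma>),
      orphans := orphans \<sigma> - {u}\<rparr>"
  shows "pbfs_inv G adj \<sigma>' {}" and "potential \<sigma>' = potential \<sigma>" and "card (orphans \<sigma>') < card (orphans \<sigma>)"
proof -
  interpret pbfs_inv G adj \<sigma> "{}" by fact
  let ?w = "adj u ! j"
  have w: "residual \<sigma> u ?w" "label \<sigma> u = label \<sigma> ?w + 1"
    using adm by (auto simp: admissible_def)
  have uB: "u \<in> B" "u \<noteq> t"
    using u orphans_sub modified_sub by auto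
  have adm': "admissible \<sigma>' = admissible \<sigma>"
    by (rule admissible_cong) (simp_all add: \<sigma>'_def res_def)
  show "potential \<sigma>' = potential \<sigma>"
    by (rule potential_cong[OF _ _ adm']) (simp_all add: \<sigma>'_def)
  have "finite (orphans \<sigma>)"
    using orphans_sub modified_sub finite_B by (meson Diff_subset finite_subset)
  moreover have "orphans \<sigma>' = orphans \<sigma> - {u}"
    by (simp add: \<sigma>'_def)
  ultimately show "card (orphans \<sigma>') < card (orphans \<sigma>)"
    using card_Diff1_less[OF _ u] by metis
  show "pbfs_inv G adj \<sigma>' {}"
  proof (rule attach_preserves[OF u refl w(1)])
    show "label \<sigma>' = (label \<sigma>)(u := label \<sigma> ?w + 1)"
      using w(2) by (simp add: \<sigma>'_def fun_eq_iff)
    show "label \<sigma> ?w + 1 < enat (card V)" "label \<sigma> u \<le> label \<sigma> ?w + 1"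
      using label_bound[OF uB(1)] w(2) by simp_all
    \<comment> \<open>The label of \<open>u\<close> exceeds that of \<open>?w\<close> by exactly
      one, so validity of labels makes \<open>?w\<close> a residual neighbour of least
      label.\<close>
    show "label \<sigma> ?w \<le> label \<sigma> v" if "residual \<sigma> u v" for v
    proof -
      have "label \<sigma> ?w + 1 \<le> label \<sigma> v + 1"
        using valid[of u v] that uB w(2) by (simp add: residual_iff_res)
      then show ?thesis
        by (cases "label \<sigma> ?w"; cases "label \<sigma> v") (auto simp: one_enat_def)
    qed
    \<comment> \<open>The pointer moves to \<open>j\<close> and not beyond: the edges passed are
      inadmissible, the one at \<open>j\<close> is admissible.\<close>
    have "current \<sigma>' = (current \<sigma>)(u := j)"
      by (simp add: \<sigma>'_def)
    then show "\<not> admissible \<sigma>' a (adj a ! k)"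
      if "a \<in> B" "a \<noteq> t" "k < current \<sigma>' a" "k < length (adj a)" for a k
      using that pointer[of a k] scan unfolding adm' by (cases "a = u"; cases "current \<sigma> u \<le> k") auto
  qed (use w in \<open>simp_all add: \<sigma>'_def\<close>)
qed

text \<open>Removals do not touch residual capacities at \<open>lam\<close>, so the outcome of the
  scan remains valid once no tree edge enters \<open>u\<close>.\<close>

lemma scan_removal:
  assumes inv: "pbfs_inv G adj \<sigma> {}" and u: "u \<in> orphans \<sigma>"
    and scan: "\<forall>k. current \<sigma> u \<le> k \<and> k < length (adj u) \<longrightarrow> \<not> admissible \<sigma> u (adj u ! k)"
    and rem: "remove_tree_edges {e \<in> tree \<sigma>. snd e = u} \<sigma> \<sigma>'"
  shows "pbfs_inv G adj \<sigma>' {}" "admissible \<sigma>' = admissible \<sigma>" "potential \<sigma>' = potential \<sigma>"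
    "u \<in> orphans \<sigma>'" "\<And>v. (v, u) \<notin> tree \<sigma>'" "\<And>v. \<not> admissible \<sigma>' u v"
    "current \<sigma>' = current \<sigma>" "sink_side \<sigma>' = sink_side \<sigma>"
proof -
  interpret pbfs_inv G adj \<sigma> "{}" by fact
  have uB: "u \<in> B" "u \<noteq> t"
    using u orphans_sub modified_sub by auto
  interpret rm: pbfs_inv G adj \<sigma> "{e \<in> tree \<sigma>. snd e = u}"
    by (rule pending_mono) (use uB in auto)
  note removed = rm.remove_tree_edges_preserves[OF rem]
  show "pbfs_inv G adj \<sigma>' {}" "u \<in> orphans \<sigma>'" "\<And>v. (v, u) \<notin> tree \<sigma>'" "current \<sigma>' = current \<sigma>"
    using removed u by auto
  show "sink_side \<sigma>' = sink_side \<sigma>"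
    by (rule sink_side_cong[OF removed(2)])
  show adm: "admissible \<sigma>' = admissible \<sigma>"
    by (rule admissible_cong[OF removed(2,3,6,9)])
  show "potential \<sigma>' = potential \<sigma>"
    by (rule potential_cong[OF removed(2,3) adm])
  show "\<not> admissible \<sigma>' u v" for v
    using no_admissible[OF uB scan] by (simp add: adm)
qed

lemma relabel_step:
  assumes inv: "pbfs_inv G adj \<sigma> {}" and u: "u \<in> orphans \<sigma>"
    and into: "\<And>v. (v, u) \<notin> tree \<sigma>" and no_adm: "\<And>v. \<not> admissible \<sigma> u v"
    and w: "relabel_target \<sigma> u w"
  defines "\<sigma>' \<equiv> \<sigma>\<lparr>label := (label \<sigma>)(u := label \<sigma> w + 1), tree := insert (u, w) (tree \<sigma>),
      current := (current \<sigma>)(u := 0), orphans := orphans \<sigma> - {u}\<rparr>"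
  shows "pbfs_inv G adj \<sigma>' {}" and "potential \<sigma>' < potential \<sigma>"
proof -
  interpret pbfs_inv G adj \<sigma> "{}" by fact
  have uB: "u \<in> B" "u \<noteq> t"
    using u orphans_sub modified_sub by auto
  have res_w: "residual \<sigma> u w" and min: "\<And>v. residual \<sigma> u v \<Longrightarrow> label \<sigma> w \<le> label \<sigma> v"
    and small: "label \<sigma> w < enat (card B - 1)"
    using w by (auto simp: relabel_target_def)
  obtain k where k: "label \<sigma> w = enat k" "k + 1 < card B"
    using small by (cases "label \<sigma> w") auto
  have card_B: "card B \<le> card V"
    by (rule card_mono[OF finite_V side_sub])
  obtain d where d: "label \<sigma> u = enat d" "d < card V"
    using label_enat[OF uB(1)] .
  \<comment> \<open>Validity bounds the old label by the new one, and equality would make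
    \<open>(u, w)\<close> admissible; so the label grows strictly.\<close>
  have "label \<sigma> u \<le> label \<sigma> w + 1"
    using valid[of u w] uB res_w by (simp add: residual_iff_res)
  moreover have "label \<sigma> u \<noteq> label \<sigma> w + 1"
    using no_adm[of w] res_w by (auto simp: admissible_def)
  ultimately have dk: "d < k + 1"
    using k d by (auto simp: one_enat_def)
  have upd: "net \<sigma>' = net \<sigma>" "label \<sigma>' = (label \<sigma>)(u := label \<sigma> w + 1)" "lam \<sigma>' = lam \<sigma>" "flow \<sigma>' = flow \<sigma>"
    "current \<sigma>' = (current \<sigma>)(u := 0)"
    by (simp_all add: \<sigma>'_def)
  have side: "sink_side \<sigma>' = B"
    by (rule sink_side_cong[OF upd(1)])
  have adm': "admissible \<sigma> a b" if "a \<in> B" "a \<noteq> t" "a \<noteq> u" "admissible \<sigma>' a b" for a b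
  proof (cases "b = u")
    case True
    \<comment> \<open>An edge into \<open>u\<close> that is admissible under the new label would
      descend by at least two under the old one, contrary to \<open>valid\<close>.\<close>
    then have "label \<sigma> a = enat (k + 2)" "0 < res \<sigma> (a, u) (lam \<sigma>)"
      using that k by (auto simp: admissible_def residual_iff side upd res_def one_enat_def)
    then show ?thesis
      using valid[of a u] that uB d dk by (simp add: one_enat_def)
  next
    case False
    then show ?thesis
      using that by (auto simp: admissible_def residual_iff side upd res_def)
  qed
  show inv': "pbfs_inv G adj \<sigma>' {}"
  proof (rule attach_preserves[OF u refl res_w])
    show "label \<sigma> w + 1 < enat (card V)" "label \<sigma> u \<le> label \<sigma> w + 1"
      using k d dk card_B by (simp_all add: one_enat_def)
    show "label \<sigma> u = label \<sigma> w + 1" if "(v, u) \<in> tree \<sigma>" for v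
      using into that by blast
    show "\<not> admissible \<sigma>' a (adj a ! i)"
      if "a \<in> B" "a \<noteq> t" "i < current \<sigma>' a" "i < length (adj a)" for a i
      using that pointer[of a i] adm'[of a] by (cases "a = u") (auto simp: upd)
  qed (use min in \<open>simp_all add: \<sigma>'_def\<close>)
  interpret new: pbfs_inv G adj \<sigma>' "{}" by fact
  have "vertex_potential \<sigma>' u < vertex_potential \<sigma> u"
  proof -
    have "the_enat (label \<sigma>' u) = k + 1"
      using k by (simp add: upd one_enat_def)
    then have "vertex_potential \<sigma>' u \<le> (card V - (k + 1)) * (card V + 1) + card V"
      using new.finite_admissible(2)[of u] by (simp add: vertex_potential_def)
    also have "\<dots> < (card V - (k + 1) + 1) * (card V + 1)"
      by simp
    also have "\<dots> \<le> (card V - d) * (card V + 1)"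
      using d dk k card_B by (intro mult_right_mono) auto
    also have "\<dots> \<le> vertex_potential \<sigma> u"
      using d by (simp add: vertex_potential_def)
    finally show ?thesis .
  qed
  moreover have "vertex_potential \<sigma>' a \<le> vertex_potential \<sigma> a" if "a \<in> B - {t}" "a \<noteq> u" for a
    using that adm' by (intro vertex_potential_mono) (auto simp: upd)
  ultimately have "\<forall>a\<in>B - {t}. vertex_potential \<sigma>' a \<le> vertex_potential \<sigma> a"
    by (metis less_imp_le)
  then show "potential \<sigma>' < potential \<sigma>"
    unfolding potential_def side
    using uB finite_B \<open>vertex_potential \<sigma>' u < vertex_potential \<sigma> u\<close>
    by (intro sum_strict_mono_ex1) auto
qed

lemma contract_step:
  assumes inv: "pbfs_inv G adj \<sigma> {}" and u: "u \<in> orphans \<sigma>"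
    and into: "\<And>v. (v, u) \<notin> tree \<sigma>" and no_target: "\<nexists>w. relabel_target \<sigma> u w"
  shows "pbfs_inv G adj (contract_vertex u \<sigma>) {}" and "potential (contract_vertex u \<sigma>) < potential \<sigma>"
proof -
  interpret pbfs_inv G adj \<sigma> "{}" by fact
  have uB: "u \<in> B" "u \<noteq> t"
    using u orphans_sub modified_sub by auto
  have far: "enat (card B - 1) \<le> label \<sigma> v" if v: "residual \<sigma> u v" for v
  proof -
    let ?L = "label \<sigma> ` {w. residual \<sigma> u w}"
    \<comment> \<open>Given one residual edge out of \<open>u\<close>, there is one to a vertex of
      least label; as it is no relabel target, its label must be too large.\<close>
    have "label \<sigma> v \<in> ?L"
      using v by blast
    then have "Inf ?L \<in> ?L"
      by (rule wellorder_InfI)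
    then obtain w where w: "residual \<sigma> u w" "Inf ?L = label \<sigma> w"
      by auto
    have min: "label \<sigma> w \<le> label \<sigma> w'" if "residual \<sigma> u w'" for w'
      unfolding w(2)[symmetric] using that by (intro Inf_lower) blast
    then have "\<not> label \<sigma> w < enat (card B - 1)"
      using no_target w(1) by (auto simp: relabel_target_def)
    then show ?thesis
      using min[OF v] by (meson not_less order_trans)
  qed
  show "pbfs_inv G adj (contract_vertex u \<sigma>) {}"
    by (rule contract_preserves(1)[OF u refl into far])
  have side: "sink_side (contract_vertex u \<sigma>) = B - {u}"
    by (rule contract_preserves(2)[OF u refl into far])
  have shrinks: "admissible \<sigma> a b" if "a \<in> B - {u}" "admissible (contract_vertex u \<sigma>) a b" for a b
    using that by (intro contract_preserves(3)[OF u refl into far])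
  obtain d where d: "label \<sigma> u = enat d" "d < card V"
    using label_enat[OF uB(1)] .
  then have pos: "0 < vertex_potential \<sigma> u"
    by (simp add: vertex_potential_def)
  have "B - {u} - {t} = B - {t} - {u}"
    by auto
  moreover have "vertex_potential (contract_vertex u \<sigma>) a \<le> vertex_potential \<sigma> a" if "a \<in> B - {u}" for a
    using shrinks[OF that] by (intro vertex_potential_mono) (simp_all add: contract_vertex_def)
  ultimately have "potential (contract_vertex u \<sigma>) \<le> (\<Sum>a\<in>B - {t} - {u}. vertex_potential \<sigma> a)"
    unfolding potential_def side by (auto intro!: sum_mono)
  also have "\<dots> < potential \<sigma>"
    using pos sum.remove[of "B - {t}" u "vertex_potential \<sigma>"] uB finite_B by (simp add: potential_def)
  finally show "potential (contract_vertex u \<sigma>) < potential \<sigma>" .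
qed

lemma step_invariant:
  assumes step: "pbfs_step G adj C C'" and inv: "config_inv C"
  shows "config_inv C' \<and> C' \<noteq> Start \<and>
    (C \<noteq> Start \<longrightarrow> (config_measure C', config_measure C) \<in> measure_less)"
  using step
proof cases
  case (init f0 T)
  then show ?thesis
    using init_preserves[OF init(3,4)] by (simp add: pbfs_adopted_def pbfs_adopted_axioms_def)
next
  case (drain u \<sigma> v)
  interpret pbfs_adopted G adj \<sigma>
    using inv drain by simp
  have "u \<in> modified \<sigma>"
    using drain by simp
  then show ?thesis
    unfolding drain(1,2) using drain_step[OF drain(5)] by (simp only: config_inv.simps config.distinct simp_thms)
next
  case (drained \<sigma>)
  then show ?thesis
    using inv by (simp add: pbfs_drained_def pbfs_drained_axioms_def measure_less_iff)
next
  case (loop_end \<sigma>)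
  interpret pbfs_drained G adj \<sigma>
    using inv loop_end by simp
  \<comment> \<open>With \<open>lam\<close> at \<open>lmax G\<close>, \<open>limit_gt_lam\<close>
    supplies what \<open>breakpoint_functionI\<close> asks for.\<close>
  have "lam \<sigma> = lmax G"
    using loop_end lam_le by simp
  then show ?thesis
    using loop_end breakpoint_functionI limit_gt_lam by (auto simp: measure_less_iff)
next
  case (no_breakpoint \<sigma>)
  interpret pbfs_drained G adj \<sigma>
    using inv no_breakpoint by simp
  have "ereal (lmax G) < limit \<sigma> e" if "e \<in> tree \<sigma>" for e
    using no_breakpoint(4) INF_lower[OF that, of "limit \<sigma>"] by (rule less_le_trans)
  then show ?thesis
    using no_breakpoint breakpoint_functionI by (auto simp: measure_less_iff)
next
  case (next_breakpoint \<sigma> l \<sigma>')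
  interpret pbfs_drained G adj \<sigma>
    using inv next_breakpoint by simp
  show ?thesis
    using next_breakpoint_step[OF next_breakpoint(4-6)] next_breakpoint(1,2) by (auto simp: measure_less_iff)
next
  case (adopted \<sigma>)
  then show ?thesis
    using inv by (simp add: pbfs_adopted_def pbfs_adopted_axioms_def measure_less_iff)
next
  case (adopt u \<sigma> j)
  have "pbfs_inv G adj \<sigma> {}"
    using inv adopt(1) by simp
  then show ?thesis
    unfolding adopt(1,2) using adopt_step[OF _ adopt(3-7)] by (simp add: measure_less_iff)
next
  case (relabel u \<sigma> \<sigma>' w)
  have "pbfs_inv G adj \<sigma> {}"
    using inv relabel(1) by simp
  note rm = scan_removal[OF this relabel(3-5)]
  show ?thesis
    unfolding relabel(1,2) using relabel_step[OF rm(1,4,5,6) relabel(6)] rm(3) by (simp add: measure_less_iff)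
next
  case (contract u \<sigma> \<sigma>')
  have "pbfs_inv G adj \<sigma> {}"
    using inv contract(1) by simp
  note rm = scan_removal[OF this contract(3-5)]
  show ?thesis
    unfolding contract(1,2) using contract_step[OF rm(1,4,5) contract(6)] rm(3) by (simp add: measure_less_iff)
qed

text \<open>\<open>halts_in\<close> admits any configuration without a successor, so being stuck
  before \<open>Return\<close> has to be excluded. The invariant supplies what the rules ask for,
  such as a parent for draining or a finite set of edges to remove.\<close>

lemma progress:
  assumes inv: "config_inv C" and stuck: "\<nexists>C'. pbfs_step G adj C C'"
  shows "\<exists>\<beta>. C = Return \<beta>"
proof (cases C)
  case Start
  have "flow_network (at_param G (lmin G))"
    using lmin_le_lmax by (intro network) simp
  then show ?thesis
    using max_flow_exists shortest_path_in_tree_exists pbfs_step.init stuck Start by metis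
next
  case (Drain \<sigma>)
  interpret pbfs_adopted G adj \<sigma>
    using inv Drain by simp
  have ne: "modified \<sigma> - {t} \<noteq> {}"
    using stuck pbfs_step.drained[of \<sigma> G adj] Drain by blast
  moreover have fin: "finite (modified \<sigma> - {t})"
    using modified_sub finite_B finite_subset by blast
  ultimately have "Max (label \<sigma> ` (modified \<sigma> - {t})) \<in> label \<sigma> ` (modified \<sigma> - {t})"
    by (intro Max_in) auto
  then obtain u where u: "u \<in> modified \<sigma> - {t}" "label \<sigma> u = Max (label \<sigma> ` (modified \<sigma> - {t}))"
    by (metis (no_types, lifting) imageE)
  have "\<forall>w\<in>modified \<sigma> - {t}. label \<sigma> w \<le> label \<sigma> u"
    using u(2) fin by simp
  moreover obtain v where "(u, v) \<in> tree \<sigma>"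
    using parent[of u] u(1) modified_sub by blast
  ultimately show ?thesis
    using pbfs_step.drain[OF u(1)] stuck Drain by blast
next
  case (Loop \<sigma>)
  interpret pbfs_drained G adj \<sigma>
    using inv Loop by simp
  have less: "lam \<sigma> < lmax G"
    using stuck pbfs_step.loop_end[of \<sigma> G adj] Loop by blast
  have "\<not> ereal (lmax G) < (INF e\<in>tree \<sigma>. limit \<sigma> e)"
    using stuck pbfs_step.no_breakpoint[OF less] Loop by blast
  then show ?thesis
  proof (rule next_breakpoint_exists)
    fix l \<sigma>'
    assume "(INF e\<in>tree \<sigma>. limit \<sigma> e) = ereal l" "l \<le> lmax G"
      "remove_tree_edges {e \<in> tree \<sigma>. limit \<sigma> e = ereal l} (\<sigma>\<lparr>lam := l, modified := {}\<rparr>) \<sigma>'"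
    from pbfs_step.next_breakpoint[OF less this] show ?thesis
      using stuck Loop by blast
  qed
next
  case (Adopt \<sigma>)
  interpret pbfs_inv G adj \<sigma> "{}"
    using inv Adopt by simp
  have "orphans \<sigma> \<noteq> {}"
    using stuck pbfs_step.adopted[of \<sigma> G adj] Adopt by blast
  then obtain u where u: "u \<in> orphans \<sigma>"
    by blast
  then have ut: "u \<noteq> t"
    using orphans_sub by auto
  show ?thesis
  proof (cases "\<exists>k. current \<sigma> u \<le> k \<and> k < length (adj u) \<and> admissible \<sigma> u (adj u ! k)")
    case True
    define j where "j = (LEAST k. current \<sigma> u \<le> k \<and> k < length (adj u) \<and> admissible \<sigma> u (adj u ! k))"
    have j: "current \<sigma> u \<le> j" "j < length (adj u)" "admissible \<sigma> u (adj u ! j)"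
      using LeastI_ex[OF True] by (auto simp: j_def)
    have "\<not> (current \<sigma> u \<le> k \<and> k < length (adj u) \<and> admissible \<sigma> u (adj u ! k))" if "k < j" for k
      using that unfolding j_def by (rule not_less_Least)
    then have "\<forall>k. current \<sigma> u \<le> k \<and> k < j \<longrightarrow> \<not> admissible \<sigma> u (adj u ! k)"
      using j(2) by (meson less_trans)
    then show ?thesis
      using pbfs_step.adopt[where adj = adj, OF u j] stuck Adopt by blast
  next
    case False
    then have scan: "\<forall>k. current \<sigma> u \<le> k \<and> k < length (adj u) \<longrightarrow> \<not> admissible \<sigma> u (adj u ! k)"
      by blast
    interpret rm: pbfs_inv G adj \<sigma> "{e \<in> tree \<sigma>. snd e = u}"
      by (rule pending_mono) (use ut in auto)
    obtain \<sigma>' where rem: "remove_tree_edges {e \<in> tree \<sigma>. snd e = u} \<sigma> \<sigma>'"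
      using rm.remove_tree_edges_exists by blast
    then show ?thesis
      using pbfs_step.relabel[where adj = adj, OF u scan rem] pbfs_step.contract[where adj = adj, OF u scan rem] stuck Adopt by blast
  qed
qed simp

lemma reachable_inv:
  assumes "(pbfs_step G adj)\<^sup>*\<^sup>* Start C"
  shows "config_inv C"
  using assms by (induction rule: rtranclp_induct) (use step_invariant in auto)

lemma terminates: "terminates_from (pbfs_step G adj) Start"
  unfolding terminates_from_def
proof
  assume "\<exists>run. run 0 = Start \<and> (\<forall>i. pbfs_step G adj (run i) (run (Suc i)))"
  then obtain run where run: "run 0 = Start" "\<And>i. pbfs_step G adj (run i) (run (Suc i))"
    by blast
  have inv: "config_inv (run i)" for i
    by (induction i) (use run step_invariant in auto)
  have "run (Suc i) \<noteq> Start" for i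
    using step_invariant[OF run(2) inv] by blast
  \<comment> \<open>The measure of \<open>Start\<close> is zero, so the descending chain begins one
    step later.\<close>
  then have "(config_measure (run (Suc (Suc i))), config_measure (run (Suc i))) \<in> measure_less" for i
    using step_invariant[OF run(2) inv, of "Suc i"] by blast
  then have "\<exists>f. \<forall>i. (f (Suc i), f i) \<in> measure_less"
    by (intro exI[of _ "\<lambda>i. config_measure (run (Suc i))"]) blast
  then show False
    using wf_measure_less unfolding wf_iff_no_infinite_down_chain by contradiction
qed

end

theorem theorem26:
  fixes G :: "'v pnetwork" and adj :: "'v \<Rightarrow> 'v list"
  assumes "parametric_flow_network G"
    and "source_sink_monotone G"
    and "adjacency_lists G adj"
  shows "terminates_from (pbfs_step G adj) Start \<and>
         (\<forall>C. halts_in (pbfs_step G adj) Start C \<longrightarrow>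
            (\<exists>\<beta>. C = Return \<beta> \<and> breakpoint_function G \<beta>))"
proof -
  interpret pbfs G adj
    by unfold_locales fact+
  have "\<exists>\<beta>. C = Return \<beta> \<and> breakpoint_function G \<beta>" if "halts_in (pbfs_step G adj) Start C" for C
  proof -
    have inv: "config_inv C" and stuck: "\<nexists>C'. pbfs_step G adj C C'"
      using that reachable_inv by (auto simp: halts_in_def)
    then obtain \<beta> where "C = Return \<beta>"
      using progress by blast
    then show ?thesis
      using inv by simp
  qed
  then show ?thesis
    using terminates by blast
qed

end
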